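(* Let $m,n\ge 1$, let $\Phi:\mathbb R^n\to[0,\infty)$ and let $A_1(t),\dots,A_m(t)$ be real $n\times n$ matrices that are invertible for almost every $t$ in the support of $\Phi$. Let $\gamma_1,\dots,\gamma_m\in\mathbb R$, $\gamma=\gamma_1+\cdots+\gamma_m$, $\omega_i(x)=|x|^{\gamma_i}$, $\omega(x)=|x|^{\gamma}$. Let $q_1(\cdot),\dots,q_m(\cdot),q(\cdot)\in\mathcal P_b(\mathbb R^n)$ with $\frac1{q_1(\cdot)}+\cdots+\frac1{q_m(\cdot)}=\frac1{q(\cdot)}$. Let $\lambda_1,\dots,\lambda_m,\zeta>0$, $\lambda=\lambda_1+\cdots+\lambda_m$, $p,p_1,\dots,p_m\in(0,\infty)$, and $\alpha_1,\dots,\alpha_m\in L^\infty(\mathbb R^n)\cap\mathbf C_0^{\log}(\mathbb R^n)\cap\mathbf C_\infty^{\log}(\mathbb R^n)$, $\alpha(\cdot)=\alpha_1(\cdot)+\cdots+\alpha_m(\cdot)$. Suppose that for almost every $t\in\operatorname{supp}(\Phi)$ and all $i=1,\dots,m$, $$q_i(A_i^{-1}(t)\cdot)\le \zeta\, q_i(\cdot)\quad\text{and}\quad \|1\|_{L^{r_i(t,\cdot)}}<\infty,\qquad \text{where } \frac1{r_i(t,\cdot)}=\frac1{q_i(A_i^{-1}(t)\cdot)}-\frac1{\zeta q_i(\cdot)},$$ that $\alpha_i(0)-\alpha_{i\infty}\ge0$ for all $i$, and that $$\mathcal C_3=\int_{\mathbb R^n}\frac{\Phi(t)}{|t|^n}\prod_{i=1}^m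 c_{A_i,q_i,\gamma_i}(t)\|1\|_{L^{r_i(t,\cdot)}}\max\Big\{\|A_i(t)\|^{\lambda_i-\alpha_i(0)},\|A_i(t)\|^{\lambda_i-\alpha_{i\infty}}\Big\}\max\Big\{\sum_{r=\Theta_n^*-1}^0 2^{r(\lambda_i-\alpha_i(0))},\sum_{r=\Theta_n^*-1}^0 2^{r(\lambda_i-\alpha_{i\infty})}\Big\}dt<\infty,$$ where $$c_{A_i,q_i,\gamma_i}(t)=\max\{\|A_i(t)\|^{-\gamma_i},\|A_i^{-1}(t)\|^{\gamma_i}\}\,\max\{|\det A_i^{-1}(t)|^{1/q_{i+}},|\det A_i^{-1}(t)|^{1/q_{i-}}\}$$ and $\Theta_n^*=\Theta_n^*(t)$ is the greatest integer satisfying $\max_{i=1,\dots,m}\{\|A_i(t)\|\,\|A_i^{-1}(t)\|\}<2^{-\Theta_n^*}$ for a.e. $t\in\mathbb R^n$. Then $H_{\Phi,\vec A}$ is a bounded operator from $M\dot K^{\alpha_1(\cdot),\lambda_1}_{p_1,\zeta q_1(\cdot),\omega_1}\times\cdots\times M\dot K^{\alpha_m(\cdot),\lambda_m}_{p_m,\zeta q_m(\cdot),\omega_m}$ to $M\dot K^{\alpha(\cdot),\lambda}_{p,q(\cdot),\omega}$.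
   Context: All functions and matrix-valued functions are Lebesgue measurable. The multilinear Hausdorff operator is $H_{\Phi,\vec A}(\vec f)(x)=\int_{\mathbb R^n}\frac{\Phi(t)}{|t|^n}\prod_{i=1}^m f_i(A_i(t)x)\,dt$, $x\in\mathbb R^n$, for $\vec f=(f_1,\dots,f_m)$ measurable functions $\mathbb R^n\to\mathbb C$, $\vec A=(A_1,\dots,A_m)$. Bounded means $\|H_{\Phi,\vec A}(\vec f)\|\le C\prod_i\|f_i\|$ with $C$ independent of $\vec f$. For a matrix $A=(a_{ij})$, $\|A\|=(\sum_{i,j}|a_{ij}|^2)^{1/2}$. $\mathcal P(\mathbb R^n)$ is the set of measurable $p(\cdot):\mathbb R^n\to[1,\infty]$. For $p(\cdot)\in\mathcal P(\mathbb R^n)$ let $\Omega_\infty=\{x:p(x)=\infty\}$ and $F_p(g)=\int_{\mathbb R^n\setminus\Omega_\infty}|g(x)|^{p(x)}dx+\|g\|_{L^\infty(\Omega_\infty)}$; $L^{p(\cdot)}=L^{p(\cdot)}(\mathbb R^n)$ is the set of complex-valued measurable $f$ with $F_p(f/\eta)<\infty$ for some $\eta>0$, with norm $\|f\|_{L^{p(\cdot)}}=\inf\{\eta>0:F_p(f/\eta)\le1\}$. For a weight $\omega\ge 0$, $\|f\|_{L^{p(\cdot)}_\omega}=\|f\omega\|_{L^{p(\cdot)}}$. $q_-=\operatorname{ess\,inf}q$, $q_+=\operatorname{ess\,sup}q$ ($q_{i\pm}$ for $q_i$); $\mathcal P_b(\mathbb R^n)$ is the class of $q(\cdot)\in\mathcal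 P(\mathbb R^n)$ with $1<q_-\le q(x)\le q_+<\infty$ for all $x$. In $1/r$, $1/\infty=0$. $\mathbf C_0^{\log}(\mathbb R^n)$: functions $\alpha(\cdot):\mathbb R^n\to\mathbb R$ with $|\alpha(x)-\alpha(0)|\le \frac{C_0^\alpha}{\log(e+1/|x|)}$ for all $x$ and some constant $C_0^\alpha$. $\mathbf C_\infty^{\log}(\mathbb R^n)$: functions with $|\alpha(x)-\alpha_\infty|\le\frac{C_\infty^\alpha}{\log(e+|x|)}$ for all $x$ and some constants $\alpha_\infty$, $C_\infty^\alpha$ (so $\alpha_\infty$ is the limit at infinity; $\alpha_{i\infty}$ denotes it for $\alpha_i$). Let $B_k=\{x:|x|\le2^k\}$, $C_k=B_k\setminus B_{k-1}$, $\chi_k=\chi_{C_k}$, $k\in\mathbb Z$. For $0\le\lambda<\infty$, $0<p<\infty$, $q(\cdot)\in\mathcal P_b(\mathbb R^n)$, $\alpha(\cdot)\in L^\infty(\mathbb R^n)$, the weighted variable exponent Morrey–Herz space $M\dot K^{\alpha(\cdot),\lambda}_{p,q(\cdot),\omega}$ is the set of $f\in L^{q(\cdot)}_{\rm loc}(\mathbb R^n\setminus\{0\})$ with $$\|f\|_{M\dot K^{\alpha(\cdot),\lambda}_{p,q(\cdot),\omega}}=\sup_{k_0\in\mathbb Z}2^{-k_0\lambda}\Big(\sum_{k=-\infty}^{k_0}\|2^{k\alpha(\cdot)}f\chi_k\|^p_{L^{q(\cdot)}_\omega}\Big)^{1/p}<\infty.$$ *)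

theory Defs
  imports "HOL-Analysis.Analysis" "HOL-Probability.Essential_Supremum"
begin

text \<open>The norm of the library on \<open>real^'n^'n\<close> is the Hilbert-Schmidt norm used here.\<close>

lemma norm_matrix_eq:
  fixes A :: "real^'n^'m"
  shows "norm A = sqrt (\<Sum>i\<in>UNIV. \<Sum>j\<in>UNIV. \<bar>A $ i $ j\<bar>\<^sup>2)"
  by (simp add: norm_vec_def L2_set_def sum_nonneg)

text \<open>
  Exponents take values in \<^typ>\<open>ennreal\<close>, where \<open>inverse top = 0\<close> and \<open>inverse 0 = top\<close>.
  Only the essential supremum is in the library.
\<close>

definition essinf :: "'a measure \<Rightarrow> ('a \<Rightarrow> ennreal) \<Rightarrow> ennreal" where
  "essinf M f = Sup {z. AE x in M. z \<le> f x}"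

definition exponent_minus :: "(real^'n \<Rightarrow> ennreal) \<Rightarrow> ennreal" where
  "exponent_minus q = essinf lebesgue q"

definition exponent_plus :: "(real^'n \<Rightarrow> ennreal) \<Rightarrow> ennreal" where
  "exponent_plus q = esssup lebesgue q"

definition exponents :: "(real^'n \<Rightarrow> ennreal) set" where
  "exponents = {p. p \<in> borel_measurable lebesgue \<and> (\<forall>x. 1 \<le> p x)}"

definition bounded_exponents :: "(real^'n \<Rightarrow> ennreal) set" where
  "bounded_exponents = {q \<in> exponents. 1 < exponent_minus q \<and>
     (\<forall>x. exponent_minus q \<le> q x \<and> q x \<le> exponent_plus q) \<and> exponent_plus q < top}"

text \<open>
  Since \<open>0\<close> is the bottom element of \<^typ>\<open>ennreal\<close>, the essential supremum over a subset is
  that of the function cut off by the indicator of the subset.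
\<close>

definition lp_modular :: "(real^'n \<Rightarrow> ennreal) \<Rightarrow> (real^'n \<Rightarrow> complex) \<Rightarrow> ennreal" where
  "lp_modular p g =
     (\<integral>\<^sup>+x\<in>{x. p x \<noteq> top}. ennreal (norm (g x) powr enn2real (p x)) \<partial>lebesgue)
     + esssup lebesgue (\<lambda>x. ennreal (norm (g x)) * indicator {x. p x = top} x)"

definition lp_space :: "(real^'n \<Rightarrow> ennreal) \<Rightarrow> (real^'n \<Rightarrow> complex) set" where
  "lp_space p = {f \<in> borel_measurable lebesgue.
     \<exists>\<eta>>0. lp_modular p (\<lambda>x. f x / complex_of_real \<eta>) < top}"

text \<open>The value is \<open>top\<close> when no \<open>\<eta>\<close> is admissible.\<close>

definition lp_norm :: "(real^'n \<Rightarrow> ennreal) \<Rightarrow> (real^'n \<Rightarrow> complex) \<Rightarrow> ennreal" where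
  "lp_norm p f = Inf {ennreal \<eta> | \<eta>. \<eta> > 0 \<and> lp_modular p (\<lambda>x. f x / complex_of_real \<eta>) \<le> 1}"

definition lp_norm_weighted ::
  "(real^'n \<Rightarrow> ennreal) \<Rightarrow> (real^'n \<Rightarrow> real) \<Rightarrow> (real^'n \<Rightarrow> complex) \<Rightarrow> ennreal" where
  "lp_norm_weighted p \<omega> f = lp_norm p (\<lambda>x. f x * complex_of_real (\<omega> x))"

text \<open>Local integrability on \<open>\<real>\<^sup>n\<close> minus the origin: compact sets have to avoid the origin.\<close>

definition lp_loc_punctured :: "(real^'n \<Rightarrow> ennreal) \<Rightarrow> (real^'n \<Rightarrow> complex) set" where
  "lp_loc_punctured p = {f \<in> borel_measurable lebesgue.
     \<forall>K. compact K \<and> 0 \<notin> K \<longrightarrow> (\<lambda>x. f x * indicator K x) \<in> lp_space p}"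

definition L_infinity :: "(real^'n \<Rightarrow> real) set" where
  "L_infinity = {\<alpha> \<in> borel_measurable lebesgue. esssup lebesgue (\<lambda>x. ennreal \<bar>\<alpha> x\<bar>) < top}"

definition C_log_zero :: "(real^'n \<Rightarrow> real) set" where
  "C_log_zero = {\<alpha>. \<exists>C. \<forall>x. \<bar>\<alpha> x - \<alpha> 0\<bar> \<le> C / ln (exp 1 + 1 / norm x)}"

definition C_log_infinity :: "(real^'n \<Rightarrow> real) set" where
  "C_log_infinity = {\<alpha>. \<exists>a C. \<forall>x. \<bar>\<alpha> x - a\<bar> \<le> C / ln (exp 1 + norm x)}"

text \<open>The constant \<open>a\<close> in the previous definition is unique, namely this limit.\<close>

definition value_infinity :: "(real^'n \<Rightarrow> real) \<Rightarrow> real" where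
  "value_infinity \<alpha> = Lim at_infinity \<alpha>"

definition dyadic_ball :: "int \<Rightarrow> (real^'n) set" where
  "dyadic_ball k = {x. norm x \<le> 2 powr of_int k}"

definition dyadic_annulus :: "int \<Rightarrow> (real^'n) set" where
  "dyadic_annulus k = dyadic_ball k - dyadic_ball (k - 1)"

text \<open>Only meant for exponents \<open>p > 0\<close>.\<close>

definition ennreal_powr :: "ennreal \<Rightarrow> real \<Rightarrow> ennreal" where
  "ennreal_powr x p = (if x = top then top else ennreal (enn2real x powr p))"

definition morrey_herz_norm ::
  "(real^'n \<Rightarrow> real) \<Rightarrow> real \<Rightarrow> real \<Rightarrow> (real^'n \<Rightarrow> ennreal) \<Rightarrow> (real^'n \<Rightarrow> real)
     \<Rightarrow> (real^'n \<Rightarrow> complex) \<Rightarrow> ennreal" where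
  "morrey_herz_norm \<alpha> lam p q \<omega> f =
     (SUP k0\<in>(UNIV :: int set). ennreal (2 powr (- of_int k0 * lam)) *
        ennreal_powr
          (\<Sum>\<^sub>\<infinity>k\<in>{..k0}. ennreal_powr
             (lp_norm_weighted q \<omega>
                (\<lambda>x. complex_of_real (2 powr (of_int k * \<alpha> x)) * f x * indicator (dyadic_annulus k) x)) p)
          (1 / p))"

definition morrey_herz ::
  "(real^'n \<Rightarrow> real) \<Rightarrow> real \<Rightarrow> real \<Rightarrow> (real^'n \<Rightarrow> ennreal) \<Rightarrow> (real^'n \<Rightarrow> real)
     \<Rightarrow> (real^'n \<Rightarrow> complex) set" where
  "morrey_herz \<alpha> lam p q \<omega> = {f \<in> lp_loc_punctured q. morrey_herz_norm \<alpha> lam p q \<omega> f < top}"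

definition hausdorff_integrand ::
  "nat \<Rightarrow> (real^'n \<Rightarrow> real) \<Rightarrow> (nat \<Rightarrow> real^'n \<Rightarrow> real^'n^'n) \<Rightarrow> (nat \<Rightarrow> real^'n \<Rightarrow> complex)
     \<Rightarrow> real^'n \<Rightarrow> real^'n \<Rightarrow> complex" where
  "hausdorff_integrand m \<Phi> A f x t =
     complex_of_real (\<Phi> t / norm t ^ CARD('n)) * (\<Prod>i\<in>{1..m}. f i (A i t *v x))"

definition hausdorff ::
  "nat \<Rightarrow> (real^'n \<Rightarrow> real) \<Rightarrow> (nat \<Rightarrow> real^'n \<Rightarrow> real^'n^'n) \<Rightarrow> (nat \<Rightarrow> real^'n \<Rightarrow> complex)
     \<Rightarrow> real^'n \<Rightarrow> complex" where
  "hausdorff m \<Phi> A f x = (\<integral>t. hausdorff_integrand m \<Phi> A f x t \<partial>lebesgue)"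

text \<open>
  \<open>1 / r = 1 / q(B \<cdot>) - 1 / (\<zeta> q)\<close>, with \<open>r = top\<close> where the right-hand side vanishes. The
  subtraction of \<^typ>\<open>ennreal\<close> truncates at \<open>0\<close>, which is harmless where
  \<open>q(B \<cdot>) \<le> \<zeta> q\<close>.
\<close>

definition r_exponent ::
  "(real^'n \<Rightarrow> ennreal) \<Rightarrow> real \<Rightarrow> real^'n^'n \<Rightarrow> real^'n \<Rightarrow> ennreal" where
  "r_exponent q \<zeta> B x = inverse (inverse (q (B *v x)) - inverse (ennreal \<zeta> * q x))"

text \<open>
  The essential bounds of the exponent are finite for bounded exponents, so \<open>enn2real\<close> loses nothing.
\<close>

definition c_factor :: "real^'n^'n \<Rightarrow> (real^'n \<Rightarrow> ennreal) \<Rightarrow> real \<Rightarrow> real" where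
  "c_factor B q \<gamma> =
     max (norm B powr (- \<gamma>)) (norm (matrix_inv B) powr \<gamma>) *
     max (\<bar>det (matrix_inv B)\<bar> powr (1 / enn2real (exponent_plus q)))
         (\<bar>det (matrix_inv B)\<bar> powr (1 / enn2real (exponent_minus q)))"

text \<open>
  The greatest integer exists whenever all \<open>A i t\<close> with \<open>1 \<le> i \<le> m\<close> are invertible (and
  \<open>m \<ge> 1\<close>); it is then negative, because the product of the norms is at least \<open>1\<close>.
\<close>

definition Theta :: "nat \<Rightarrow> (nat \<Rightarrow> real^'n \<Rightarrow> real^'n^'n) \<Rightarrow> real^'n \<Rightarrow> int" where
  "Theta m A t = (GREATEST \<theta>::int.
     Max ((\<lambda>i. norm (A i t) * norm (matrix_inv (A i t))) ` {1..m}) < 2 powr (- of_int \<theta>))"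

definition C3 ::
  "nat \<Rightarrow> (real^'n \<Rightarrow> real) \<Rightarrow> (nat \<Rightarrow> real^'n \<Rightarrow> real^'n^'n) \<Rightarrow> (nat \<Rightarrow> real^'n \<Rightarrow> ennreal)
     \<Rightarrow> (nat \<Rightarrow> real) \<Rightarrow> real \<Rightarrow> (nat \<Rightarrow> real) \<Rightarrow> (nat \<Rightarrow> real^'n \<Rightarrow> real) \<Rightarrow> ennreal" where
  "C3 m \<Phi> A q \<gamma> \<zeta> lam \<alpha> =
     (\<integral>\<^sup>+t. ennreal (\<Phi> t / norm t ^ CARD('n)) *
        (\<Prod>i\<in>{1..m}.
           ennreal (c_factor (A i t) (q i) (\<gamma> i)) *
           lp_norm (r_exponent (q i) \<zeta> (matrix_inv (A i t))) (\<lambda>_. 1) *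
           ennreal (max (norm (A i t) powr (lam i - \<alpha> i 0))
                        (norm (A i t) powr (lam i - value_infinity (\<alpha> i)))) *
           ennreal (max (\<Sum>r\<in>{Theta m A t - 1..0}. 2 powr (of_int r * (lam i - \<alpha> i 0)))
                        (\<Sum>r\<in>{Theta m A t - 1..0}. 2 powr (of_int r * (lam i - value_infinity (\<alpha> i))))))
      \<partial>lebesgue)"

end

theory Submission
  imports Defs
begin

text \<open>
  Boundedness comes from estimating the operator slice by slice in \<open>t\<close>, one dyadic annulus at a time.

  Minkowski's integral inequality in variable Lebesgue spaces (\<open>minkowski_integral\<close>, \<open>weighted_integral_bound\<close>)
  bounds the norm of the operator on the annulus \<open>k\<close> by the integral over \<open>t\<close> of the norms of the slices
  \<open>x \<mapsto> \<Phi> t / \<bar>t\<bar>^n * (\<Prod>i. f i (A i t x))\<close>. Both the weight and the factor \<open>2 powr (k * \<alpha> x)\<close> split into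
  products over \<open>i\<close>, so by Hoelder's inequality it is enough to treat one factor \<open>f i (A i t x)\<close> in the space with
  exponent \<open>q i\<close> (\<open>lp_norm_prod_le\<close>).

  For one factor (\<open>modular_factor_le\<close>), a linear change of variables moves the matrix into the exponent and
  produces the powers of the determinant and of the norms of the matrix and its inverse in \<open>c_factor\<close>. The exponent
  \<open>q i \<circ> A\<inverse>\<close> is then replaced by the larger exponent \<open>\<zeta> * q i\<close>, at the cost of the norm of the constant \<open>1\<close>
  (\<open>modular_smaller_exponent\<close>). The image of the annulus \<open>k\<close> under the matrix meets only annuli \<open>k + l\<close>, where \<open>l\<close> runs
  over the finite range counted by \<open>Theta\<close>, and there the Morrey--Herz norm controls \<open>f i\<close>. For \<open>x\<close> and \<open>z\<close> on two
  such annuli, the log-Hoelder conditions and \<open>\<alpha>\<^sub>\<infinity> \<le> \<alpha> 0\<close> bound \<open>2 powr (k * \<alpha> x)\<close> by a constant times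
  \<open>2 powr ((k + l) * \<alpha> z)\<close> times the larger of \<open>2 powr (- l * \<alpha> 0)\<close> and \<open>2 powr (- l * \<alpha>\<^sub>\<infinity>)\<close>
  (\<open>annulus_weight_transfer\<close>). Altogether the slice is bounded by
  \<open>2 powr (k * \<lambda>)\<close> times the integrand of \<open>C3\<close> times the product of the norms (\<open>slice_norm_le\<close>).

  Integrating in \<open>t\<close> gives a bound proportional to \<open>2 powr (k * \<lambda>)\<close> on the annulus \<open>k\<close>, and since \<open>\<lambda> > 0\<close> the
  geometric series over \<open>k \<le> k0\<close> converges (\<open>morrey_herz_norm_le\<close>). This is why the summation exponents \<open>p i\<close> and \<open>p0\<close> are
  unrelated.

  The estimates are carried out for the modulars \<open>\<integral> g powr e\<close>, from which the norms are recovered by scaling. A point of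
  measure theory is that the integrand need not be jointly measurable for Lebesgue measurable \<open>f i\<close>; it agrees with
  a jointly measurable function almost everywhere in either order of the variables (\<open>measurable_version_of_integrand\<close>).
\<close>

section \<open>Linear change of variables\<close>

lemma borel_measurable_matrix: "(*v) (A :: real^'n^'m) \<in> borel_measurable borel"
  by (intro borel_measurable_continuous_onI continuous_intros)

text \<open>
  A shear moves a box to a parallelepiped, which can be cut and translated back into the box; the boxes determine
  the measure.
\<close>

lemma shear_preserves_lborel:
  fixes a b :: "'n::finite"
  assumes "a \<noteq> b"
  defines "f \<equiv> \<lambda>v::real^'n. \<chi> i. if i = a then v $ a + v $ b else v $ i"
  shows "distr lborel borel f = lborel"
proof (rule lborel_eqI[symmetric])
  have lin: "linear f"
    unfolding f_def by (rule linearI) (auto simp: algebra_simps vec_eq_iff)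
  have meas: "f \<in> borel_measurable borel"
    by (intro borel_measurable_continuous_onI linear_continuous_on linear_conv_bounded_linear[THEN iffD1] lin)
  \<comment> \<open>The fact \<open>measure_shear_interval\<close> is about boxes above the hyperplane \<open>x $ b = 0\<close>; a translation
    moves every box there.\<close>
  have cb: "measure lebesgue (f ` cbox u v) = 1 * measure lebesgue (cbox u v)" for u v
  proof (cases "cbox u v = {}")
    case False
    define w :: "real^'n" where "w = (\<chi> i. if i = b then - u $ b else 0)"
    have ne: "cbox (w + u) (w + v) \<noteq> {}"
      using False by (metis cbox_translation image_is_empty)
    have "f ` cbox (w + u) (w + v) = (+) (f w) ` f ` cbox u v"
      unfolding cbox_translation image_image by (simp add: linear_add[OF lin])
    then have "measure lebesgue (f ` cbox u v) = measure lebesgue (f ` cbox (w + u) (w + v))"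
      by (simp add: measure_translation)
    also have "\<dots> = measure lebesgue (cbox (w + u) (w + v))"
      unfolding f_def by (rule measure_shear_interval[OF \<open>a \<noteq> b\<close> ne]) (simp add: w_def)
    also have "\<dots> = measure lebesgue (cbox u v)"
      by (simp only: cbox_translation measure_translation)
    finally show ?thesis by simp
  qed simp
  define g where "g = (\<lambda>v::real^'n. \<chi> i. if i = a then v $ a - v $ b else v $ i)"
  have gf: "g (f x) = x" "f (g x) = x" for x
    using \<open>a \<noteq> b\<close> by (auto simp: f_def g_def vec_eq_iff)
  have ling: "linear g"
    unfolding g_def by (rule linearI) (auto simp: algebra_simps vec_eq_iff)
  fix l u :: "real^'n" assume le: "\<And>b. b \<in> Basis \<Longrightarrow> l \<bullet> b \<le> u \<bullet> b"
  have vim: "f -` box l u = g ` box l u"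
    using gf by (metis bijI' bij_vimage_eq_inv_image inv_equality)
  have "open (f -` box l u)"
    by (intro open_vimage open_box linear_continuous_on linear_conv_bounded_linear[THEN iffD1] lin)
  moreover have "bounded (f -` box l u)"
    unfolding vim by (intro bounded_linear_image bounded_box linear_conv_bounded_linear[THEN iffD1] ling)
  ultimately have lm: "f -` box l u \<in> lmeasurable"
    by (simp add: lmeasurable_open)
  have im: "f ` (f -` box l u) = box l u"
    using gf by (metis surj_def surj_image_vimage_eq)
  have "measure lebesgue (f -` box l u) = measure lebesgue (box l u)"
    using measure_linear_sufficient[OF lin lm cb] im by simp
  then have "emeasure lebesgue (f -` box l u) = emeasure lebesgue (box l u)"
    using lm by (simp add: emeasure_eq_measure2)
  moreover have "f -` box l u \<in> sets borel"
    using \<open>open (f -` box l u)\<close> by simp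
  ultimately show "emeasure (distr lborel borel f) (box l u) = (\<Prod>b\<in>Basis. (u - l) \<bullet> b)"
    using meas le by (simp add: emeasure_distr emeasure_lborel_box inner_diff_left)
qed simp

lemma prod_Basis_axis:
  fixes g :: "real^'n \<Rightarrow> real"
  shows "(\<Prod>b\<in>Basis. g b) = (\<Prod>i\<in>UNIV. g (axis i 1))"
proof -
  have B: "(Basis :: (real^'n) set) = range (\<lambda>i. axis i 1)"
    by (auto simp: Basis_vec_def)
  have inj: "inj (\<lambda>i. axis i 1 :: real^'n)"
    by (auto intro: injI simp: axis_eq_axis)
  show ?thesis unfolding B by (simp add: prod.reindex[OF inj])
qed

text \<open>
  A square matrix is a product of elementary ones, for which the formula holds by scaling the coordinates, permuting
  them, or by the invariance under shears.
\<close>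

lemma nn_integral_lborel_matrix:
  fixes A :: "real^'n^'n" and h :: "real^'n \<Rightarrow> ennreal"
  assumes "det A \<noteq> 0" "h \<in> borel_measurable borel"
  shows "ennreal \<bar>det A\<bar> * (\<integral>\<^sup>+x. h (A *v x) \<partial>lborel) = (\<integral>\<^sup>+x. h x \<partial>lborel)"
proof -
  have "det A \<noteq> 0 \<longrightarrow> (\<forall>h\<in>borel_measurable borel.
      ennreal \<bar>det A\<bar> * (\<integral>\<^sup>+x. h (A *v x) \<partial>lborel) = (\<integral>\<^sup>+x. h x \<partial>lborel))"
  proof (induct A rule: induct_matrix_elementary_alt)
    case (1 A B)
    have [measurable]: "(*v) A \<in> borel_measurable borel"
      by (intro borel_measurable_continuous_onI continuous_intros)
    show ?case
    proof (intro impI ballI)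
      fix h :: "real^'n \<Rightarrow> ennreal" assume [measurable]: "h \<in> borel_measurable borel"
      assume "det (A ** B) \<noteq> 0"
      then have d: "det A \<noteq> 0" "det B \<noteq> 0" by (auto simp: det_mul)
      have "ennreal \<bar>det (A ** B)\<bar> * (\<integral>\<^sup>+x. h (A ** B *v x) \<partial>lborel)
         = ennreal \<bar>det A\<bar> * (ennreal \<bar>det B\<bar> * (\<integral>\<^sup>+x. h (A *v (B *v x)) \<partial>lborel))"
        by (simp add: det_mul abs_mult ennreal_mult' matrix_vector_mul_assoc mult.assoc)
      also have "ennreal \<bar>det B\<bar> * (\<integral>\<^sup>+x. h (A *v (B *v x)) \<partial>lborel) = (\<integral>\<^sup>+x. h (A *v x) \<partial>lborel)"
        by (rule 1(2)[rule_format, OF d(2), of "\<lambda>x. h (A *v x)"]) simp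
      also have "ennreal \<bar>det A\<bar> * \<dots> = (\<integral>\<^sup>+x. h x \<partial>lborel)"
        by (rule 1(1)[rule_format, OF d(1), of h]) simp
      finally show "ennreal \<bar>det (A ** B)\<bar> * (\<integral>\<^sup>+x. h (A ** B *v x) \<partial>lborel) = (\<integral>\<^sup>+x. h x \<partial>lborel)" .
    qed
  next
    case (2 A i)
    then show ?case by (simp add: det_zero_row)
  next
    case (3 A)
    show ?case
    proof (intro impI ballI)
      fix h :: "real^'n \<Rightarrow> ennreal" assume [measurable]: "h \<in> borel_measurable borel"
      assume "det A \<noteq> 0"
      then have nz: "A $ i $ i \<noteq> 0" for i
        using det_diagonal[of A, OF 3] by auto
      define c where "c j = j \<bullet> (A *v j)" for j
      have col: "A *v axis i 1 = axis i (A $ i $ i)" for i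
        unfolding matrix_vector_mult_basis using 3 by (auto simp: column_def vec_eq_iff axis_def)
      have c: "c (axis i 1) = A $ i $ i" for i
        by (simp add: c_def inner_axis' col)
      have B: "(Basis :: (real^'n) set) = range (\<lambda>i. axis i 1)"
        by (auto simp: Basis_vec_def)
      have inj: "inj (\<lambda>i. axis i 1 :: real^'n)"
        by (auto intro: injI simp: axis_eq_axis)
      have T: "0 + (\<Sum>j\<in>Basis. (c j * (x \<bullet> j)) *\<^sub>R j) = A *v x" for x
      proof -
        have "A *v x = (\<chi> i. A $ i $ i * x $ i)"
        proof -
          have "(\<Sum>j\<in>UNIV. A $ i $ j * x $ j) = A $ i $ i * x $ i" for i
            using 3 by (subst sum.remove[of _ i]) (auto intro!: sum.neutral)
          then show ?thesis by (simp add: matrix_vector_mult_def)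
        qed
        moreover have "(\<Sum>j\<in>Basis. (c j * (x \<bullet> j)) *\<^sub>R j) = (\<Sum>i\<in>UNIV. (A $ i $ i * x $ i) *\<^sub>R axis i 1)"
          unfolding B by (simp add: sum.reindex[OF inj] c inner_axis)
        moreover have "(\<Sum>i\<in>UNIV. (A $ i $ i * x $ i) *\<^sub>R axis i 1) = (\<chi> i. A $ i $ i * x $ i)"
        proof -
          have "(\<Sum>i\<in>UNIV. (A $ i $ i * x $ i) * axis i 1 $ k) = (\<Sum>i\<in>UNIV. if i = k then A $ i $ i * x $ i else 0)" for k
            by (rule sum.cong) (auto simp: axis_def)
          then show ?thesis by (simp add: vec_eq_iff)
        qed
        ultimately show ?thesis by simp
      qed
      have P: "(\<Prod>j\<in>(Basis::(real^'n) set). \<bar>c j\<bar>) = \<bar>det A\<bar>"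
        unfolding prod_Basis_axis det_diagonal[OF 3, simplified] by (simp add: c abs_prod)
      have "\<And>j. j \<in> Basis \<Longrightarrow> c j \<noteq> 0"
        unfolding B using c nz by auto
      from lborel_affine_euclidean[of c 0, OF this]
      have L: "lborel = density (distr lborel borel ((*v) A)) (\<lambda>_. ennreal \<bar>det A\<bar>)"
        unfolding T P .
      have [measurable]: "(*v) A \<in> borel_measurable borel"
        by (intro borel_measurable_continuous_onI continuous_intros)
      show "ennreal \<bar>det A\<bar> * (\<integral>\<^sup>+x. h (A *v x) \<partial>lborel) = (\<integral>\<^sup>+x. h x \<partial>lborel)"
        by (subst (2) L) (simp add: nn_integral_density nn_integral_distr nn_integral_cmult)
    qed
  next
    case (4 a b)
    let ?A = "(\<chi> i j. mat 1 $ i $ Transposition.transpose a b j) :: real^'n^'n"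
    have A: "?A *v x = (\<chi> i. x $ Transposition.transpose a b i)" for x
    proof -
      have "(\<Sum>j\<in>UNIV. ?A $ i $ j * x $ j) = x $ Transposition.transpose a b i" for i
      proof -
        have "(\<Sum>j\<in>UNIV. ?A $ i $ j * x $ j) = (\<Sum>j\<in>UNIV. if j = Transposition.transpose a b i then x $ j else 0)"
          by (rule sum.cong) (auto simp: mat_def)
        then show ?thesis by simp
      qed
      then show ?thesis by (simp add: matrix_vector_mult_def)
    qed
    have d: "\<bar>det ?A\<bar> = 1"
      by (simp add: det_permute_columns permutes_swap_id sign_swap_id abs_mult)
    have [measurable]: "(*v) ?A \<in> borel_measurable borel"
      by (intro borel_measurable_continuous_onI continuous_intros)
    have L: "lborel = distr lborel borel ((*v) ?A)"
    proof (rule lborel_eqI)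
      fix l u :: "real^'n" assume le: "\<And>b. b \<in> Basis \<Longrightarrow> l \<bullet> b \<le> u \<bullet> b"
      let ?s = "\<lambda>v::real^'n. \<chi> i. v $ Transposition.transpose a b i"
      have "(*v) ?A -` box l u = box (?s l) (?s u)"
        by (auto simp: A mem_box_cart) (metis transpose_involutory)+
      moreover have "l $ i \<le> u $ i" for i
        using le[of "axis i 1"] by (auto simp: inner_axis Basis_vec_def)
      ultimately have "emeasure (distr lborel borel ((*v) ?A)) (box l u) = ennreal (\<Prod>b\<in>Basis. (?s u - ?s l) \<bullet> b)"
        by (subst emeasure_distr, simp add: borel_measurable_matrix, simp, simp only: space_borel space_lborel Int_UNIV_right)
          (rule emeasure_lborel_box, auto simp: Basis_vec_def inner_axis)
      also have "(\<Prod>b\<in>Basis. (?s u - ?s l) \<bullet> b) = (\<Prod>i\<in>UNIV. (u - l) $ Transposition.transpose a b i)"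
        by (simp add: prod_Basis_axis inner_axis)
      also have "\<dots> = (\<Prod>i\<in>UNIV. (u - l) $ i)"
        using prod.permute[OF permutes_swap_id[OF UNIV_I UNIV_I, of a b], of "\<lambda>i. (u - l) $ i"]
        by (simp add: o_def)
      also have "\<dots> = (\<Prod>b\<in>Basis. (u - l) \<bullet> b)"
        by (simp add: prod_Basis_axis inner_axis)
      finally show "emeasure (distr lborel borel ((*v) ?A)) (box l u) = (\<Prod>b\<in>Basis. (u - l) \<bullet> b)" .
    qed simp
    show ?case
    proof (intro impI ballI)
      fix h :: "real^'n \<Rightarrow> ennreal" assume [measurable]: "h \<in> borel_measurable borel"
      show "ennreal \<bar>det ?A\<bar> * (\<integral>\<^sup>+x. h (?A *v x) \<partial>lborel) = (\<integral>\<^sup>+x. h x \<partial>lborel)"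
        unfolding d by (subst (2) L) (simp add: nn_integral_distr)
    qed
  next
    case (5 a b)
    let ?A = "(\<chi> i j. of_bool (i = a \<and> j = b \<or> i = j)) :: real^'n^'n"
    have A: "(*v) ?A = (\<lambda>v. \<chi> i. if i = a then v $ a + v $ b else v $ i)"
    proof
      fix v :: "real^'n"
      have "(\<Sum>j\<in>UNIV. ?A $ i $ j * v $ j) = (if i = a then v $ a + v $ b else v $ i)" for i
      proof (cases "i = a")
        case True
        have "(\<Sum>j\<in>UNIV. ?A $ i $ j * v $ j)
          = (\<Sum>j\<in>UNIV. (if j = a then v $ j else 0) + (if j = b then v $ j else 0))"
          using True 5 by (intro sum.cong) auto
        also have "\<dots> = v $ a + v $ b" by (simp add: sum.distrib)
        finally show ?thesis using True by simp
      next
        case False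
        have "(\<Sum>j\<in>UNIV. ?A $ i $ j * v $ j) = (\<Sum>j\<in>UNIV. (if j = i then v $ j else 0))"
          using False by (intro sum.cong) auto
        then show ?thesis using False by simp
      qed
      then show "?A *v v = (\<chi> i. if i = a then v $ a + v $ b else v $ i)"
        by (simp add: matrix_vector_mult_def)
    qed
    have "?A = (\<chi> k. if k = a then row a (mat 1) + 1 *s row b (mat 1) else row k (mat 1))"
      using 5 by (auto simp: vec_eq_iff row_def mat_def)
    then have d: "det ?A = 1"
      using det_row_operation[OF 5, of "mat 1" 1] by simp
    have L: "distr lborel borel ((*v) ?A) = lborel"
      unfolding A by (rule shear_preserves_lborel[OF 5])
    show ?case
    proof (intro impI ballI)
      fix h :: "real^'n \<Rightarrow> ennreal" assume [measurable]: "h \<in> borel_measurable borel"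
      show "ennreal \<bar>det ?A\<bar> * (\<integral>\<^sup>+x. h (?A *v x) \<partial>lborel) = (\<integral>\<^sup>+x. h x \<partial>lborel)"
        using nn_integral_distr[of "(*v) ?A" lborel borel h, unfolded L] borel_measurable_matrix[of ?A]
        unfolding d by simp
    qed
  qed
  then show ?thesis using assms by blast
qed

lemma null_sets_lborel_matrix:
  fixes A :: "real^'n^'n"
  assumes "det A \<noteq> 0" "N \<in> null_sets lborel"
  shows "(*v) A -` N \<in> null_sets lborel"
proof -
  have N: "N \<in> sets borel" "emeasure lborel N = 0"
    using assms(2) by (auto simp: null_sets_def)
  have V: "(*v) A -` N \<in> sets borel"
    using measurable_sets[OF borel_measurable_matrix N(1), of A] by simp
  have ind: "(\<lambda>x. indicator N (A *v x) :: ennreal) = indicator ((*v) A -` N)"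
    by (auto simp: fun_eq_iff indicator_def)
  have "ennreal \<bar>det A\<bar> * emeasure lborel ((*v) A -` N) = emeasure lborel N"
    using nn_integral_lborel_matrix[OF assms(1) borel_measurable_indicator[OF N(1)]] N(1) V
    unfolding ind by (subst (asm) (1 2) nn_integral_indicator) simp_all
  then show ?thesis
    using N V assms(1) by (simp add: null_sets_def)
qed

lemma measurable_matrix_lebesgue:
  fixes A :: "real^'n^'n"
  assumes "det A \<noteq> 0"
  shows "(*v) A \<in> lebesgue \<rightarrow>\<^sub>M lebesgue"
proof (rule completion.measurable_completion2)
  show M: "(*v) A \<in> lebesgue \<rightarrow>\<^sub>M lborel"
    by (simp add: measurable_completion borel_measurable_matrix)
  show "null_sets lborel \<subseteq> null_sets (distr lebesgue lborel ((*v) A))"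
  proof
    fix N assume N: "N \<in> null_sets (lborel :: (real^'n) measure)"
    have "(*v) A -` N \<in> null_sets lebesgue"
      using null_sets_lborel_matrix[OF assms N] by (rule null_sets_completionI)
    then show "N \<in> null_sets (distr lebesgue lborel ((*v) A))"
      using N by (intro null_setsI) (simp_all add: null_sets_def emeasure_distr[OF M])
  qed
qed

lemma AE_lebesgue_matrix:
  fixes A :: "real^'n^'n"
  assumes "det A \<noteq> 0" "AE x in lebesgue. P x"
  shows "AE x in lebesgue. P (A *v x)"
proof -
  obtain N where N: "N \<in> null_sets lborel" "{x. \<not> P x} \<subseteq> N"
    using AE_completion_iff[THEN iffD1, OF assms(2)] by (auto simp: eventually_ae_filter)
  have "{x. \<not> P (A *v x)} \<subseteq> (*v) A -` N"
    using N(2) by auto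
  with null_sets_lborel_matrix[OF assms(1) N(1)] show ?thesis
    by (intro AE_completion AE_I'[of "(*v) A -` N"]) auto
qed

text \<open>
  The formula passes from Borel to Lebesgue measurable functions because an invertible matrix pulls null sets
  back to null sets.
\<close>

lemma nn_integral_lebesgue_matrix:
  fixes A :: "real^'n^'n" and h :: "real^'n \<Rightarrow> ennreal"
  assumes A: "det A \<noteq> 0" and h: "h \<in> borel_measurable lebesgue"
  shows "ennreal \<bar>det A\<bar> * (\<integral>\<^sup>+x. h (A *v x) \<partial>lebesgue) = (\<integral>\<^sup>+x. h x \<partial>lebesgue)"
proof -
  obtain h' where h': "h' \<in> borel_measurable borel" "AE x in lborel. h x = h' x"
    using completion_ex_borel_measurable[OF h] by auto
  have 1: "AE x in lebesgue. h x = h' x"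
    using h'(2) by (rule AE_completion)
  have 2: "AE x in lebesgue. h (A *v x) = h' (A *v x)"
    by (rule AE_lebesgue_matrix[OF A 1])
  have h'A: "(\<lambda>x. h' (A *v x)) \<in> borel_measurable lborel"
    using measurable_comp[OF borel_measurable_matrix h'(1), of A] by (simp add: comp_def)
  have "(\<integral>\<^sup>+x. h (A *v x) \<partial>lebesgue) = (\<integral>\<^sup>+x. h' (A *v x) \<partial>lborel)"
    by (subst nn_integral_completion[symmetric]) (rule nn_integral_cong_AE[OF 2])
  moreover have "(\<integral>\<^sup>+x. h x \<partial>lebesgue) = (\<integral>\<^sup>+x. h' x \<partial>lborel)"
    by (subst nn_integral_completion[symmetric]) (rule nn_integral_cong_AE[OF 1])
  ultimately show ?thesis
    using nn_integral_lborel_matrix[OF A h'(1)] by simp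
qed

lemma matrix_inv_mult:
  fixes A :: "real^'n^'n"
  assumes "invertible A"
  shows "A ** matrix_inv A = mat 1" "matrix_inv A ** A = mat 1"
  using someI_ex[OF assms[unfolded invertible_def]] by (auto simp: matrix_inv_def)

lemma norm_matrix_vector_le:
  fixes A :: "real^'n^'m"
  shows "norm (A *v x) \<le> norm A * norm x"
proof -
  have "norm (A *v x) \<le> L2_set (\<lambda>i. norm (A $ i) * norm x) UNIV"
    unfolding norm_vec_def[of "A *v x"]
    by (intro L2_set_mono) (simp_all add: matrix_vector_mul_component Cauchy_Schwarz_ineq2)
  also have "\<dots> = norm A * norm x"
    by (simp add: norm_vec_def[of A] L2_set_left_distrib)
  finally show ?thesis .
qed

section \<open>Modulars and Luxemburg norms\<close>

lemma sigma_finite_lebesgue: "sigma_finite_measure (lebesgue :: 'a::euclidean_space measure)"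
proof
  obtain F :: "'a set set" where "countable F" "F \<subseteq> sets lborel" "\<Union> F = space lborel"
      "\<forall>a\<in>F. emeasure lborel a \<noteq> \<infinity>"
    using lborel.sigma_finite_countable by blast
  then show "\<exists>F::'a set set. countable F \<and> F \<subseteq> sets lebesgue \<and> \<Union> F = space lebesgue \<and> (\<forall>a\<in>F. emeasure lebesgue a \<noteq> \<infinity>)"
    by (intro exI[of _ F]) auto
qed

text \<open>
  The modular for a finite exponent, where \<open>g\<close> stands for the absolute value of the function.
\<close>

definition modular :: "(real^'n \<Rightarrow> real) \<Rightarrow> (real^'n \<Rightarrow> real) \<Rightarrow> ennreal" where
  "modular e g = (\<integral>\<^sup>+x. ennreal (g x powr e x) \<partial>lebesgue)"

lemma lp_modular_finite_exponent:
  assumes "\<And>x. p x \<noteq> top"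
  shows "lp_modular p g = modular (\<lambda>x. enn2real (p x)) (\<lambda>x. norm (g x))"
proof -
  have "esssup lebesgue (\<lambda>x::real^'a. 0 :: ennreal) \<le> 0"
    by (rule esssup_I) auto
  then show ?thesis
    using assms by (simp add: lp_modular_def modular_def)
qed

lemma modular_mono:
  assumes "\<And>x. 0 \<le> e x" "AE x in lebesgue. 0 \<le> g x \<and> g x \<le> h x"
  shows "modular e g \<le> modular e h"
  unfolding modular_def
  by (rule nn_integral_mono_AE) (use assms(2) in eventually_elim, auto intro!: ennreal_leI powr_mono2 assms(1))

lemma modular_divide_le_one:
  assumes "\<And>x. 1 \<le> e x" "\<And>x. 0 \<le> g x" "1 \<le> c"
    and "e \<in> borel_measurable lebesgue" "g \<in> borel_measurable lebesgue"
    and "modular e g \<le> ennreal c"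
  shows "modular e (\<lambda>x. g x / c) \<le> 1"
proof -
  have "modular e (\<lambda>x. g x / c) \<le> (\<integral>\<^sup>+x. ennreal (1 / c) * ennreal (g x powr e x) \<partial>lebesgue)"
    unfolding modular_def
  proof (intro nn_integral_mono)
    fix x
    have "c powr 1 \<le> c powr e x"
      using assms(1,3) by (intro powr_mono) auto
    then have "(g x / c) powr e x \<le> 1 / c * g x powr e x"
      using assms(2,3) by (simp add: powr_divide field_simps mult_right_mono)
    then show "ennreal ((g x / c) powr e x) \<le> ennreal (1 / c) * ennreal (g x powr e x)"
      using assms(3) by (simp add: ennreal_leI flip: ennreal_mult')
  qed
  also have "\<dots> = ennreal (1 / c) * modular e g"
    unfolding modular_def using assms by (intro nn_integral_cmult) simp
  also have "\<dots> \<le> ennreal (1 / c) * ennreal c"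
    by (intro mult_left_mono assms) simp
  also have "\<dots> = 1"
    using assms(3) by (simp flip: ennreal_mult')
  finally show ?thesis .
qed

lemma lp_norm_le_of_modular:
  assumes p: "\<And>x. p x \<noteq> top" "\<And>x. 1 \<le> p x" "p \<in> borel_measurable lebesgue"
    and f: "f \<in> borel_measurable lebesgue"
    and "0 < \<eta>" "1 \<le> c" "modular (\<lambda>x. enn2real (p x)) (\<lambda>x. norm (f x) / \<eta>) \<le> ennreal c"
  shows "lp_norm p f \<le> ennreal (c * \<eta>)"
proof -
  have "1 \<le> enn2real (p x)" for x
    using p(1,2)[of x] enn2real_mono[of 1 "p x"] by (simp add: less_top)
  from modular_divide_le_one[OF this _ \<open>1 \<le> c\<close> _ _ assms(7)] f p(3) \<open>0 < \<eta>\<close>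
  have "modular (\<lambda>x. enn2real (p x)) (\<lambda>x. norm (f x) / \<eta> / c) \<le> 1"
    by simp
  then have "lp_modular p (\<lambda>x. f x / complex_of_real (c * \<eta>)) \<le> 1"
    using \<open>0 < \<eta>\<close> \<open>1 \<le> c\<close>
    by (simp add: lp_modular_finite_exponent[OF p(1)] norm_divide norm_mult ac_simps)
  then show ?thesis
    unfolding lp_norm_def using \<open>0 < \<eta>\<close> \<open>1 \<le> c\<close>
    by (intro Inf_lower CollectI exI[of _ "c * \<eta>"]) auto
qed

lemma modular_le_one_of_lp_norm:
  assumes p: "\<And>x. p x \<noteq> top" and "lp_norm p f < ennreal \<eta>"
  shows "modular (\<lambda>x. enn2real (p x)) (\<lambda>x. norm (f x) / \<eta>) \<le> 1"
proof -
  obtain \<theta> where \<theta>: "ennreal \<theta> < ennreal \<eta>" "0 < \<theta>" "lp_modular p (\<lambda>x. f x / complex_of_real \<theta>) \<le> 1"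
    using assms(2) unfolding lp_norm_def Inf_less_iff by auto
  then have "\<theta> < \<eta>"
    by (metis ennreal_less_iff less_eq_real_def)
  have "modular (\<lambda>x. enn2real (p x)) (\<lambda>x. norm (f x) / \<eta>) \<le> modular (\<lambda>x. enn2real (p x)) (\<lambda>x. norm (f x) / \<theta>)"
    using \<open>\<theta> < \<eta>\<close> \<theta>(2) by (intro modular_mono) (auto intro!: divide_left_mono)
  also have "\<dots> \<le> 1"
    using \<theta>(2,3) by (simp add: lp_modular_finite_exponent[OF p] norm_divide)
  finally show ?thesis .
qed

text \<open>
  Rational witnesses exhibit the sublevel sets of the norm as countable unions, which makes the norm of a slice
  a measurable function of the parameter.
\<close>

lemma lp_norm_less_iff:
  assumes p: "\<And>x. p x \<noteq> top"
  shows "lp_norm p f < c \<longleftrightarrow>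
    (\<exists>r\<in>\<rat>. 0 < r \<and> ennreal r < c \<and> modular (\<lambda>x. enn2real (p x)) (\<lambda>x. norm (f x) / r) \<le> 1)"
proof
  assume *: "lp_norm p f < c"
  then obtain \<theta> where \<theta>: "ennreal \<theta> < c" "0 < \<theta>" "lp_norm p f \<le> ennreal \<theta>"
    unfolding lp_norm_def Inf_less_iff by (auto intro: Inf_lower)
  obtain d where d: "\<theta> < d" "ennreal d \<le> c"
  proof (cases c)
    case (real r)
    then show ?thesis using \<theta> that[of r] by (simp add: ennreal_less_iff)
  next
    case top
    then show ?thesis using that[of "\<theta> + 1"] by simp
  qed
  obtain r where r: "r \<in> \<rat>" "\<theta> < r" "r < d"
    using Rats_dense_in_real[OF d(1)] by auto
  have "ennreal r < c"
    using r d \<theta>(2) by (meson ennreal_lessI less_le_trans less_trans)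
  moreover have "lp_norm p f < ennreal r"
    using \<theta> r by (meson ennreal_lessI le_less_trans less_trans)
  ultimately show "\<exists>r\<in>\<rat>. 0 < r \<and> ennreal r < c \<and> modular (\<lambda>x. enn2real (p x)) (\<lambda>x. norm (f x) / r) \<le> 1"
    using r \<theta>(2) modular_le_one_of_lp_norm[OF p] by (intro bexI[of _ r]) auto
next
  assume "\<exists>r\<in>\<rat>. 0 < r \<and> ennreal r < c \<and> modular (\<lambda>x. enn2real (p x)) (\<lambda>x. norm (f x) / r) \<le> 1"
  then obtain r where r: "0 < r" "ennreal r < c" "modular (\<lambda>x. enn2real (p x)) (\<lambda>x. norm (f x) / r) \<le> 1"
    by auto
  then have "lp_norm p f \<le> ennreal r"
    unfolding lp_norm_def
    by (intro Inf_lower) (auto simp: lp_modular_finite_exponent[OF p] norm_divide)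
  with r(2) show "lp_norm p f < c" by simp
qed

lemma young_tangent_line:
  fixes a y e :: real
  assumes "1 \<le> e" "0 < a" "0 \<le> y"
  shows "e * a powr (e - 1) * y \<le> y powr e + (e - 1) * a powr e"
proof (cases "y = 0")
  case False
  have "(y powr e) powr (1/e) * (a powr e) powr (1 - 1/e) \<le> 1/e * y powr e + (1 - 1/e) * a powr e"
    using assms False by (intro Youngs_inequality_0) auto
  moreover have "(y powr e) powr (1/e) = y" "(a powr e) powr (1 - 1/e) = a powr (e - 1)"
    using assms False by (simp_all add: powr_powr algebra_simps)
  ultimately have "e * (y * a powr (e - 1)) \<le> e * (1/e * y powr e + (1 - 1/e) * a powr e)"
    using assms by (intro mult_left_mono) auto
  also have "\<dots> = y powr e + (e - 1) * a powr e"
    using assms by (simp add: field_simps)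
  finally show ?thesis by (simp add: ac_simps)
qed (use assms in simp)

text \<open>
  Minkowski's integral inequality. When each slice is normalised by a number \<open>v t\<close> slightly larger than
  its norm, convexity of \<open>y \<mapsto> y powr e\<close> reduces the claim to Tonelli's theorem. Convexity enters
  through the tangent lines at all levels \<open>a\<close> below the mean, so an infinite mean is covered by the same
  computation and is excluded only afterwards.
\<close>

lemma minkowski_integral:
  fixes K :: "real^'n \<Rightarrow> 'b \<Rightarrow> real" and p :: "real^'n \<Rightarrow> ennreal"
  assumes N: "sigma_finite_measure N"
    and K0: "\<And>x t. 0 \<le> K x t"
    and K[measurable]: "(\<lambda>(x, t). K x t) \<in> borel_measurable (lebesgue \<Otimes>\<^sub>M N)"
    and p: "\<And>x. p x \<noteq> top" "\<And>x. 1 \<le> p x" and [measurable]: "p \<in> borel_measurable lebesgue"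
    and less: "(\<integral>\<^sup>+t. lp_norm p (\<lambda>x. complex_of_real (K x t)) \<partial>N) < ennreal \<eta>"
  shows "(AE x in lebesgue. (\<integral>\<^sup>+t. ennreal (K x t) \<partial>N) < \<infinity>) \<and>
    modular (\<lambda>x. enn2real (p x)) (\<lambda>x. enn2real (\<integral>\<^sup>+t. ennreal (K x t) \<partial>N) / \<eta>) \<le> 1"
proof -
  interpret N: sigma_finite_measure N by (rule N)
  interpret L: sigma_finite_measure "lebesgue :: (real^'n) measure" by (rule sigma_finite_lebesgue)
  interpret P: pair_sigma_finite "lebesgue :: (real^'n) measure" N ..
  define e where "e = (\<lambda>x. enn2real (p x))"
  have [measurable]: "e \<in> borel_measurable lebesgue"
    by (simp add: e_def)
  have e: "1 \<le> e x" for x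
    using p(1,2)[of x] enn2real_mono[of 1 "p x"] by (simp add: less_top e_def)
  have K'[measurable]: "(\<lambda>(t, x). K x t) \<in> borel_measurable (N \<Otimes>\<^sub>M lebesgue)"
    using measurable_pair_swap[OF K] by (simp add: case_prod_beta')
  define w where "w t = lp_norm p (\<lambda>x. complex_of_real (K x t))" for t
  have [measurable]: "w \<in> borel_measurable N"
  proof (rule borel_measurableI_less)
    fix c
    have "{t \<in> space N. w t < c} = (\<Union>r\<in>{r\<in>\<rat>. 0 < r \<and> ennreal r < c}.
        {t \<in> space N. (\<integral>\<^sup>+x. ennreal ((K x t / r) powr e x) \<partial>lebesgue) \<le> 1})"
      using K0 by (auto simp: w_def lp_norm_less_iff[OF p(1)] modular_def e_def)
    also have "\<dots> \<in> sets N"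
      by (intro sets.countable_UN'' countable_subset[OF _ countable_rat]) auto
    finally show "{t \<in> space N. w t < c} \<in> sets N" .
  qed
  \<comment> \<open>Adding a small multiple of a strictly positive integrable function keeps the normalising factors
    positive and strictly above the norms.\<close>
  obtain h where [measurable]: "h \<in> borel_measurable N"
    and h: "integral\<^sup>N N h \<noteq> \<infinity>" "\<And>t. t \<in> space N \<Longrightarrow> 0 < h t \<and> h t < \<infinity>"
    using N.Ex_finite_integrable_function by blast
  obtain I H where I: "integral\<^sup>N N w = ennreal I" "0 \<le> I" and H: "integral\<^sup>N N h = ennreal H" "0 \<le> H"
    using less h(1) by (cases "integral\<^sup>N N w"; cases "integral\<^sup>N N h") (auto simp: w_def[abs_def])
  have "I < \<eta>"
    using less I by (simp add: w_def[abs_def] ennreal_less_iff)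
  then have "0 < \<eta>" using I by simp
  define \<delta> where "\<delta> = (\<eta> - I) / (H + 1)"
  have "0 < \<delta>" using \<open>I < \<eta>\<close> H by (simp add: \<delta>_def)
  have \<delta>: "I + \<delta> * H \<le> \<eta>"
    using \<open>I < \<eta>\<close> H by (simp add: \<delta>_def field_simps)
  define v where "v t = enn2real (w t + ennreal \<delta> * h t)" for t
  have [measurable]: "v \<in> borel_measurable N" by (simp add: v_def[abs_def])
  have "AE t in N. w t \<noteq> \<infinity>"
    using I by (intro nn_integral_noteq_infinite) auto
  with AE_space have v: "AE t in N. ennreal (v t) = w t + ennreal \<delta> * h t \<and> 0 < v t \<and> w t < ennreal (v t)"
  proof eventually_elim
    case (elim t)
    note t = h(2)[OF elim(1)] elim(2)
    then have fin: "w t + ennreal \<delta> * h t < \<infinity>"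
      by (auto simp: ennreal_mult_eq_top_iff simp flip: less_top)
    then have eq: "ennreal (v t) = w t + ennreal \<delta> * h t"
      by (simp add: v_def)
    have pos: "0 < ennreal \<delta> * h t"
      using t \<open>0 < \<delta>\<close> by (simp add: ennreal_zero_less_mult_iff)
    then have "0 < ennreal (v t)"
      unfolding eq by (simp add: add_nonneg_pos)
    then have "0 < v t" by simp
    moreover have "w t < ennreal (v t)"
      unfolding eq using t(2) pos ennreal_add_left_cancel_less[of "w t" 0] by (simp add: less_top)
    ultimately show ?case using eq by simp
  qed
  have v0: "0 \<le> v t" for t by (simp add: v_def)
  have intv: "(\<integral>\<^sup>+t. ennreal (v t) \<partial>N) \<le> ennreal \<eta>"
  proof -
    have "(\<integral>\<^sup>+t. ennreal (v t) \<partial>N) = (\<integral>\<^sup>+t. w t + ennreal \<delta> * h t \<partial>N)"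
      using v by (intro nn_integral_cong_AE) auto
    also have "\<dots> = ennreal I + ennreal \<delta> * ennreal H"
      by (simp add: nn_integral_add nn_integral_cmult I H)
    also have "\<dots> = ennreal (I + \<delta> * H)"
      using I H \<open>0 < \<delta>\<close> by (simp add: ennreal_mult)
    finally show ?thesis using \<delta> by (simp add: ennreal_leI)
  qed
  define R where "R x = (\<integral>\<^sup>+t. ennreal (v t * (K x t / v t) powr e x) \<partial>N)" for x
  have [measurable]: "R \<in> borel_measurable lebesgue" unfolding R_def by measurable
  have intR: "(\<integral>\<^sup>+x. R x \<partial>lebesgue) \<le> ennreal \<eta>"
  proof -
    have "(\<integral>\<^sup>+x. R x \<partial>lebesgue) = (\<integral>\<^sup>+t. (\<integral>\<^sup>+x. ennreal (v t * (K x t / v t) powr e x) \<partial>lebesgue) \<partial>N)"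
      unfolding R_def by (rule P.Fubini'[symmetric]) measurable
    also have "\<dots> = (\<integral>\<^sup>+t. ennreal (v t) * modular e (\<lambda>x. K x t / v t) \<partial>N)"
    proof (rule nn_integral_cong)
      fix t assume [measurable]: "t \<in> space N"
      show "(\<integral>\<^sup>+x. ennreal (v t * (K x t / v t) powr e x) \<partial>lebesgue) = ennreal (v t) * modular e (\<lambda>x. K x t / v t)"
        unfolding modular_def ennreal_mult'[OF v0] by (rule nn_integral_cmult) measurable
    qed
    also have "\<dots> \<le> (\<integral>\<^sup>+t. ennreal (v t) \<partial>N)"
    proof (rule nn_integral_mono_AE)
      show "AE t in N. ennreal (v t) * modular e (\<lambda>x. K x t / v t) \<le> ennreal (v t)"
        using v
      proof eventually_elim
        case (elim t)
        then have "lp_norm p (\<lambda>x. complex_of_real (K x t)) < ennreal (v t)"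
          unfolding w_def by blast
        from modular_le_one_of_lp_norm[OF p(1) this]
        have "modular e (\<lambda>x. K x t / v t) \<le> 1"
          using K0 by (simp add: e_def)
        then show ?case using mult_left_mono[of _ 1 "ennreal (v t)"] by simp
      qed
    qed
    also note intv
    finally show ?thesis .
  qed
  have key: "ennreal (\<eta> * a powr e x) \<le> R x"
    if "0 \<le> a" "ennreal (a * \<eta>) \<le> (\<integral>\<^sup>+t. ennreal (K x t) \<partial>N)" for a x
  proof (cases "a = 0")
    case False
    with that have "0 < a" by simp
    have mx[measurable]: "(\<lambda>t. K x t) \<in> borel_measurable N"
      using measurable_Pair2[OF K, of x] by simp
    let ?c = "e x * a powr (e x - 1)" and ?d = "(e x - 1) * a powr e x"
    have c0: "0 \<le> ?c" and d0: "0 \<le> ?d" using e[of x] by auto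
    have "ennreal ?c * ennreal (a * \<eta>) \<le> ennreal ?c * (\<integral>\<^sup>+t. ennreal (K x t) \<partial>N)"
      by (intro mult_left_mono that) simp
    also have "\<dots> = (\<integral>\<^sup>+t. ennreal (?c * K x t) \<partial>N)"
      unfolding ennreal_mult'[OF c0] by (rule nn_integral_cmult[symmetric]) measurable
    also have "\<dots> \<le> (\<integral>\<^sup>+t. ennreal (v t * (K x t / v t) powr e x) + ennreal ?d * ennreal (v t) \<partial>N)"
    proof (rule nn_integral_mono_AE)
      show "AE t in N. ennreal (?c * K x t) \<le> ennreal (v t * (K x t / v t) powr e x) + ennreal ?d * ennreal (v t)"
        using v
      proof eventually_elim
        case (elim t)
        then have vt: "0 < v t" by simp
        have "v t * (?c * (K x t / v t)) \<le> v t * ((K x t / v t) powr e x + ?d)"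
          using vt K0[of x t] young_tangent_line[OF e \<open>0 < a\<close>, of "K x t / v t" x]
          by (intro mult_left_mono) auto
        then have "?c * K x t \<le> v t * (K x t / v t) powr e x + ?d * v t"
          using vt by (simp add: algebra_simps)
        then show ?case
          using vt d0 by (simp add: ennreal_leI flip: ennreal_mult' ennreal_plus)
      qed
    qed
    also have "\<dots> = R x + ennreal ?d * (\<integral>\<^sup>+t. ennreal (v t) \<partial>N)"
      unfolding R_def by (subst nn_integral_add) (simp_all add: nn_integral_cmult)
    also have "\<dots> \<le> R x + ennreal ?d * ennreal \<eta>"
      by (intro add_left_mono mult_left_mono intv) simp
    finally have le: "ennreal (?c * (a * \<eta>)) \<le> R x + ennreal (?d * \<eta>)"
      using c0 d0 by (simp add: ennreal_mult')
    have "a * a powr (e x - 1) = a powr e x"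
      using \<open>0 < a\<close> by (simp add: powr_diff)
    then have "?c * (a * \<eta>) = \<eta> * a powr e x + ?d * \<eta>"
      by (simp add: algebra_simps)
    then have "ennreal (\<eta> * a powr e x) + ennreal (?d * \<eta>) \<le> R x + ennreal (?d * \<eta>)"
      using le \<open>0 < \<eta>\<close> d0 by (simp flip: ennreal_plus)
    then show ?thesis
      by (simp only: add.commute[of _ "ennreal (?d * \<eta>)"] ennreal_add_left_cancel_le) simp
  qed simp
  have fin: "AE x in lebesgue. R x \<noteq> \<infinity>"
    using intR by (intro nn_integral_noteq_infinite) (auto simp: top_unique)
  then have fin': "AE x in lebesgue. (\<integral>\<^sup>+t. ennreal (K x t) \<partial>N) < \<infinity>"
  proof eventually_elim
    case (elim x)
    show ?case
    proof (rule ccontr)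
      assume "\<not> ?thesis"
      then have top: "(\<integral>\<^sup>+t. ennreal (K x t) \<partial>N) = \<infinity>" by (simp flip: less_top)
      obtain r where r: "R x = ennreal r" "0 \<le> r" using elim by (cases "R x") auto
      define a where "a = r / \<eta> + 1"
      have "1 \<le> a" using r \<open>0 < \<eta>\<close> by (simp add: a_def)
      have "a powr 1 \<le> a powr e x" using \<open>1 \<le> a\<close> e by (intro powr_mono) auto
      moreover have "\<eta> * a powr e x \<le> r"
        using key[of a x] \<open>1 \<le> a\<close> r top by simp
      ultimately have "\<eta> * a \<le> r"
        using \<open>0 < \<eta>\<close> \<open>1 \<le> a\<close> by (smt (verit) mult_left_mono powr_one)
      then show False using \<open>0 < \<eta>\<close> by (simp add: a_def distrib_left)
    qed
  qed
  have "modular e (\<lambda>x. enn2real (\<integral>\<^sup>+t. ennreal (K x t) \<partial>N) / \<eta>) \<le> (\<integral>\<^sup>+x. R x / ennreal \<eta> \<partial>lebesgue)"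
    unfolding modular_def
  proof (rule nn_integral_mono_AE)
    show "AE x in lebesgue. ennreal ((enn2real (\<integral>\<^sup>+t. ennreal (K x t) \<partial>N) / \<eta>) powr e x) \<le> R x / ennreal \<eta>"
      using fin'
    proof eventually_elim
      case (elim x)
      let ?a = "enn2real (\<integral>\<^sup>+t. ennreal (K x t) \<partial>N) / \<eta>"
      have "ennreal (\<eta> * ?a powr e x) \<le> R x"
        using elim \<open>0 < \<eta>\<close> by (intro key) (auto simp: less_top)
      then have "ennreal (\<eta> * ?a powr e x) / ennreal \<eta> \<le> R x / ennreal \<eta>"
        by (rule divide_right_mono_ennreal)
      then show ?case using \<open>0 < \<eta>\<close> by (simp add: divide_ennreal)
    qed
  qed
  also have "\<dots> = (\<integral>\<^sup>+x. R x \<partial>lebesgue) / ennreal \<eta>"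
    by (rule nn_integral_divide) measurable
  also have "\<dots> \<le> ennreal \<eta> / ennreal \<eta>"
    by (rule divide_right_mono_ennreal[OF intR])
  also have "\<dots> = 1"
    using \<open>0 < \<eta>\<close> by (simp add: divide_ennreal)
  finally show ?thesis
    using fin' by (simp add: e_def)
qed

text \<open>
  If \<open>s\<close> denotes the right-hand side, then each factor is at most \<open>s powr (1 / e i)\<close>, and the exponents \<open>1 / e i\<close> add
  up to \<open>1 / d\<close>.
\<close>

lemma prod_powr_le_sum_powr:
  fixes g e :: "'i \<Rightarrow> real"
  assumes "finite I" "I \<noteq> {}" "\<And>i. i \<in> I \<Longrightarrow> 0 \<le> g i" "\<And>i. i \<in> I \<Longrightarrow> 0 < e i"
    and "0 < d" "(\<Sum>i\<in>I. 1 / e i) = 1 / d"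
  shows "(\<Prod>i\<in>I. g i) powr d \<le> (\<Sum>i\<in>I. g i powr e i)"
proof (cases "\<exists>i\<in>I. g i = 0")
  case True
  then have "(\<Prod>i\<in>I. g i) = 0" using assms(1) by auto
  then show ?thesis by (simp add: sum_nonneg)
next
  case False
  then have g: "i \<in> I \<Longrightarrow> 0 < g i" for i using assms(3) by force
  define s where "s = (\<Sum>i\<in>I. g i powr e i)"
  have s: "i \<in> I \<Longrightarrow> g i powr e i \<le> s" for i
    unfolding s_def by (rule member_le_sum) (use assms in auto)
  have "0 < g i powr e i" if "i \<in> I" for i
    using g[OF that] by simp
  then have "0 < s" unfolding s_def using assms(1,2) by (intro sum_pos) auto
  have "g i \<le> s powr (1 / e i)" if "i \<in> I" for i
  proof -
    have "g i = (g i powr e i) powr (1 / e i)"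
      using g[OF that] assms(4)[OF that] by (simp add: powr_powr)
    also have "\<dots> \<le> s powr (1 / e i)"
      using s[OF that] assms(4)[OF that] by (intro powr_mono2) auto
    finally show ?thesis .
  qed
  then have "(\<Prod>i\<in>I. g i) \<le> (\<Prod>i\<in>I. s powr (1 / e i))"
    using assms(3) by (intro prod_mono) auto
  also have "\<dots> = s powr (1 / d)"
    unfolding assms(6)[symmetric] using \<open>0 < s\<close> by (subst powr_sum) (use assms(1) in auto)
  finally have "(\<Prod>i\<in>I. g i) powr d \<le> (s powr (1 / d)) powr d"
    using assms by (intro powr_mono2) (auto intro: prod_nonneg)
  also have "\<dots> = s"
    using \<open>0 < s\<close> assms(5) by (simp add: powr_powr)
  finally show ?thesis by (simp add: s_def)
qed

lemma modular_prod_le_sum: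
  assumes "finite I" "I \<noteq> {}" "\<And>i x. i \<in> I \<Longrightarrow> 0 \<le> g i x" "\<And>i x. i \<in> I \<Longrightarrow> 0 < e i x"
    and "\<And>x. 0 < d x" "\<And>x. (\<Sum>i\<in>I. 1 / e i x) = 1 / d x"
    and [measurable]: "\<And>i. i \<in> I \<Longrightarrow> g i \<in> borel_measurable lebesgue" "\<And>i. i \<in> I \<Longrightarrow> e i \<in> borel_measurable lebesgue"
  shows "modular d (\<lambda>x. \<Prod>i\<in>I. g i x) \<le> (\<Sum>i\<in>I. modular (e i) (g i))"
proof -
  have "modular d (\<lambda>x. \<Prod>i\<in>I. g i x) \<le> (\<integral>\<^sup>+x. (\<Sum>i\<in>I. ennreal (g i x powr e i x)) \<partial>lebesgue)"
    unfolding modular_def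
    by (intro nn_integral_mono) (auto simp: sum_ennreal intro!: ennreal_leI prod_powr_le_sum_powr assms)
  also have "\<dots> = (\<Sum>i\<in>I. modular (e i) (g i))"
    unfolding modular_def by (rule nn_integral_sum) measurable
  finally show ?thesis .
qed

lemma lp_norm_one_lessD:
  assumes "lp_norm r (\<lambda>_. 1) < ennreal \<eta>"
  shows "0 < \<eta>" "(\<integral>\<^sup>+x\<in>{x. r x \<noteq> top}. ennreal ((1 / \<eta>) powr enn2real (r x)) \<partial>lebesgue) \<le> 1"
    "AE x in lebesgue. r x = top \<longrightarrow> 1 \<le> \<eta>"
proof -
  obtain \<theta> where \<theta>: "ennreal \<theta> < ennreal \<eta>" "0 < \<theta>" "lp_modular r (\<lambda>x. 1 / complex_of_real \<theta>) \<le> 1"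
    using assms unfolding lp_norm_def Inf_less_iff by auto
  then have "\<theta> < \<eta>"
    by (metis ennreal_less_iff less_eq_real_def)
  with \<theta> show "0 < \<eta>" by simp
  have 1: "(\<integral>\<^sup>+x\<in>{x. r x \<noteq> top}. ennreal ((1 / \<theta>) powr enn2real (r x)) \<partial>lebesgue) \<le> 1"
    and 2: "esssup lebesgue (\<lambda>x. ennreal (1 / \<theta>) * indicator {x. r x = top} x) \<le> 1"
    using \<theta>(2,3) order_trans[OF add_increasing2[OF zero_le order_refl]] order_trans[OF add_increasing[OF zero_le order_refl]]
    unfolding lp_modular_def by (force simp: norm_divide)+
  have "(\<integral>\<^sup>+x\<in>{x. r x \<noteq> top}. ennreal ((1 / \<eta>) powr enn2real (r x)) \<partial>lebesgue)
     \<le> (\<integral>\<^sup>+x\<in>{x. r x \<noteq> top}. ennreal ((1 / \<theta>) powr enn2real (r x)) \<partial>lebesgue)"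
    using \<open>\<theta> < \<eta>\<close> \<theta>(2)
    by (intro nn_integral_mono mult_right_mono ennreal_leI powr_mono2) (auto intro: divide_left_mono)
  with 1 show "(\<integral>\<^sup>+x\<in>{x. r x \<noteq> top}. ennreal ((1 / \<eta>) powr enn2real (r x)) \<partial>lebesgue) \<le> 1"
    by simp
  show "AE x in lebesgue. r x = top \<longrightarrow> 1 \<le> \<eta>"
    using esssup_AE[of "\<lambda>x. ennreal (1 / \<theta>) * indicator {x. r x = top} x" lebesgue]
  proof eventually_elim
    case (elim x)
    show ?case
    proof
      assume "r x = top"
      with order_trans[OF elim 2] have "ennreal (1 / \<theta>) \<le> 1" by simp
      then have "1 / \<theta> \<le> 1" by (simp only: ennreal_le_1)
      then show "1 \<le> \<eta>" using \<open>\<theta> < \<eta>\<close> \<theta>(2) by simp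
    qed
  qed
qed

lemma inverse_diff_exponent:
  fixes s a :: real
  assumes "1 \<le> s" "s \<le> a"
  defines "r \<equiv> inverse (inverse (ennreal s) - inverse (ennreal a))"
  shows "r = top \<and> s = a \<or> r \<noteq> top \<and> 0 < enn2real r \<and> 1 / a + 1 / enn2real r = 1 / s"
proof -
  have r: "r = inverse (ennreal (1 / s - 1 / a))"
    using assms(1,2) by (simp add: r_def inverse_ennreal ennreal_minus divide_inverse)
  show ?thesis
  proof (cases "s = a")
    case False
    then have "0 < 1 / s - 1 / a" using assms(1,2) by (simp add: field_simps)
    then have "r = ennreal (1 / (1 / s - 1 / a))"
      unfolding r by (simp add: inverse_ennreal divide_inverse)
    with \<open>0 < 1 / s - 1 / a\<close> show ?thesis by simp
  qed (simp add: r)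
qed

text \<open>
  The embedding of the space with exponent \<open>a\<close> into the one with the smaller exponent \<open>s\<close> is
  Hoelder's inequality against the constant \<open>1\<close>. Where \<open>s = a\<close>, the exponent of the constant is
  infinite; if this happens on a set of positive measure, the norm of the constant is at least \<open>1\<close> and
  dividing by \<open>\<eta>\<close> does not increase \<open>V\<close>.
\<close>

lemma modular_smaller_exponent:
  assumes s: "\<And>x. 1 \<le> s x" "\<And>x. s x \<le> a x"
    and [measurable]: "s \<in> borel_measurable lebesgue" "a \<in> borel_measurable lebesgue" "V \<in> borel_measurable lebesgue"
    and V: "\<And>x. 0 \<le> V x" "modular a V \<le> 1"
    and r: "lp_norm (\<lambda>x. inverse (inverse (ennreal (s x)) - inverse (ennreal (a x)))) (\<lambda>_. 1) < ennreal \<eta>"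
  shows "modular s (\<lambda>x. V x / \<eta>) \<le> 2"
proof -
  define r where "r x = inverse (inverse (ennreal (s x)) - inverse (ennreal (a x)))" for x
  have [measurable]: "r \<in> borel_measurable lebesgue"
    unfolding r_def by measurable
  note D = lp_norm_one_lessD[OF r, folded r_def]
  have "modular s (\<lambda>x. V x / \<eta>) \<le> (\<integral>\<^sup>+x. ennreal (V x powr a x) +
      ennreal ((1 / \<eta>) powr enn2real (r x)) * indicator {x. r x \<noteq> top} x \<partial>lebesgue)"
    unfolding modular_def
  proof (rule nn_integral_mono_AE)
    show "AE x in lebesgue. ennreal ((V x / \<eta>) powr s x) \<le> ennreal (V x powr a x) +
      ennreal ((1 / \<eta>) powr enn2real (r x)) * indicator {x. r x \<noteq> top} x"
      using D(3)
    proof eventually_elim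
      case (elim x)
      show ?case
      proof (cases "r x = top")
        case True
        then have "s x = a x" using inverse_diff_exponent[OF s, of x] by (auto simp: r_def)
        moreover have "(V x / \<eta>) powr s x \<le> V x powr s x"
          using elim True V(1)[of x] s(1)[of x] D(1)
          by (intro powr_mono2) (auto simp: field_simps intro: mult_left_mono[of 1 \<eta> "V x", simplified])
        ultimately show ?thesis using True by (simp add: ennreal_leI)
      next
        case False
        then have r': "0 < enn2real (r x)" "1 / a x + 1 / enn2real (r x) = 1 / s x"
          using inverse_diff_exponent[OF s, of x] by (auto simp: r_def)
        have "(\<Prod>i\<in>{False, True}. if i then V x else 1 / \<eta>) powr s x
          \<le> (\<Sum>i\<in>{False, True}. (if i then V x else 1 / \<eta>) powr (if i then a x else enn2real (r x)))"
          using V(1)[of x] s[of x] D(1) r' by (intro prod_powr_le_sum_powr) auto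
        then have "(V x / \<eta>) powr s x \<le> V x powr a x + (1 / \<eta>) powr enn2real (r x)"
          by simp
        then show ?thesis using False by (simp flip: ennreal_plus)
      qed
    qed
  qed
  also have "\<dots> = modular a V + (\<integral>\<^sup>+x\<in>{x. r x \<noteq> top}. ennreal ((1 / \<eta>) powr enn2real (r x)) \<partial>lebesgue)"
    unfolding modular_def by (rule nn_integral_add) measurable
  also have "\<dots> \<le> 1 + 1"
    by (intro add_mono V D)
  finally show ?thesis by (simp add: one_add_one)
qed

section \<open>Dyadic annuli and log-Hoelder exponents\<close>

lemma dyadic_annulus_iff:
  "x \<in> dyadic_annulus k \<longleftrightarrow> 2 powr (of_int k - 1) < norm x \<and> norm x \<le> 2 powr of_int k"
  by (auto simp: dyadic_annulus_def dyadic_ball_def)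

lemma dyadic_annulus_iff_ceiling:
  "x \<in> dyadic_annulus k \<longleftrightarrow> x \<noteq> 0 \<and> k = \<lceil>log 2 (norm x)\<rceil>"
proof (cases "x = 0")
  case False
  then have "2 powr (of_int k - 1) < norm x \<and> norm x \<le> 2 powr of_int k \<longleftrightarrow>
      of_int k - 1 < log 2 (norm x) \<and> log 2 (norm x) \<le> of_int k"
    by (simp add: less_log_iff log_le_iff)
  also have "\<dots> \<longleftrightarrow> k = \<lceil>log 2 (norm x)\<rceil>"
    by linarith
  finally show ?thesis using False by (simp add: dyadic_annulus_iff)
qed (simp add: dyadic_annulus_iff)

lemma sets_dyadic_annulus [measurable]: "dyadic_annulus k \<in> sets lebesgue"
proof -
  have "dyadic_annulus k = cball 0 (2 powr of_int k) - cball (0::real^'a) (2 powr of_int (k - 1))"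
    by (auto simp: dyadic_annulus_def dyadic_ball_def)
  then show ?thesis by (simp add: borel_closed)
qed

lemma C_log_zero_bounded:
  assumes "\<alpha> \<in> C_log_zero"
  obtains B where "\<And>x. \<bar>\<alpha> x\<bar> \<le> B"
proof -
  obtain C where C: "\<And>x. \<bar>\<alpha> x - \<alpha> 0\<bar> \<le> C / ln (exp 1 + 1 / norm x)"
    using assms by (auto simp: C_log_zero_def)
  have "0 \<le> C" using C[of 0] by simp
  have "\<bar>\<alpha> x\<bar> \<le> \<bar>\<alpha> 0\<bar> + C" for x
  proof -
    have "ln (exp 1) \<le> ln (exp 1 + 1 / norm x)"
      by (intro ln_mono) (auto intro: add_pos_nonneg)
    then have "C / ln (exp 1 + 1 / norm x) \<le> C / 1"
      using \<open>0 \<le> C\<close> by (intro divide_left_mono) auto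
    with C[of x] show ?thesis by simp
  qed
  then show ?thesis by (rule that)
qed

lemma C_log_zero_annulus:
  assumes "\<alpha> \<in> C_log_zero"
  obtains c where "0 \<le> c" "\<And>k x. k \<le> 0 \<Longrightarrow> x \<in> dyadic_annulus k \<Longrightarrow> \<bar>of_int k * (\<alpha> x - \<alpha> 0)\<bar> \<le> c"
proof -
  obtain C where C: "\<And>x. \<bar>\<alpha> x - \<alpha> 0\<bar> \<le> C / ln (exp 1 + 1 / norm x)"
    using assms by (auto simp: C_log_zero_def)
  have "0 \<le> C" using C[of 0] by simp
  have "\<bar>of_int k * (\<alpha> x - \<alpha> 0)\<bar> \<le> C / ln 2" if k: "k \<le> 0" and x: "x \<in> dyadic_annulus k" for k x
  proof -
    have nx: "0 < norm x" "norm x \<le> 2 powr of_int k"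
      using x dyadic_annulus_iff_ceiling[of x k] by (auto simp: dyadic_annulus_iff)
    have "2 powr (- real_of_int k) = 1 / 2 powr real_of_int k"
      by (simp add: powr_minus divide_inverse)
    also have "\<dots> \<le> 1 / norm x"
      using nx by (intro divide_left_mono) auto
    also have "\<dots> \<le> exp 1 + 1 / norm x" by simp
    finally have "ln (2 powr (- of_int k)) \<le> ln (exp 1 + 1 / norm x)"
      by (intro ln_mono) auto
    then have l: "- of_int k * ln 2 \<le> ln (exp 1 + 1 / norm x)"
      by (simp add: ln_powr)
    have "ln (exp 1) \<le> ln (exp 1 + 1 / norm x)"
      by (intro ln_mono) (auto intro: add_pos_nonneg)
    then have l1: "1 \<le> ln (exp 1 + 1 / norm x)" by simp
    have "\<bar>of_int k * (\<alpha> x - \<alpha> 0)\<bar> = - of_int k * \<bar>\<alpha> x - \<alpha> 0\<bar>"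
      using k by (simp add: abs_mult)
    also have "\<dots> \<le> - of_int k * (C / ln (exp 1 + 1 / norm x))"
      using k by (intro mult_left_mono C) simp
    also have "\<dots> \<le> ln (exp 1 + 1 / norm x) / ln 2 * (C / ln (exp 1 + 1 / norm x))"
      using l l1 \<open>0 \<le> C\<close> by (intro mult_right_mono) (simp_all add: field_simps)
    also have "\<dots> = C / ln 2" using l1 by simp
    finally show ?thesis .
  qed
  then show ?thesis using \<open>0 \<le> C\<close> by (intro that[of "C / ln 2"]) auto
qed

lemma value_infinity_eq:
  fixes \<alpha> :: "real^'n \<Rightarrow> real"
  assumes C: "\<And>x. \<bar>\<alpha> x - a\<bar> \<le> C / ln (exp 1 + norm x)"
  shows "value_infinity \<alpha> = a"
proof -
  have "filterlim (\<lambda>x::real^'n. exp 1 + norm x) at_top at_infinity"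
    by (intro filterlim_tendsto_add_at_top[OF tendsto_const] filterlim_norm_at_top)
  then have "filterlim (\<lambda>x::real^'n. ln (exp 1 + norm x)) at_infinity at_infinity"
    by (intro filterlim_at_top_imp_at_infinity filterlim_compose[OF ln_at_top])
  then have "((\<lambda>x::real^'n. C / ln (exp 1 + norm x)) \<longlongrightarrow> 0) at_infinity"
    by (rule tendsto_divide_0[OF tendsto_const])
  then have "((\<lambda>x. \<alpha> x - a) \<longlongrightarrow> 0) at_infinity"
    by (rule Lim_null_comparison[rotated]) (simp add: C)
  then have "(\<alpha> \<longlongrightarrow> a) at_infinity"
    by (simp add: LIM_zero_iff)
  then show ?thesis
    unfolding value_infinity_def by (intro tendsto_Lim) (simp_all add: trivial_limit_at_infinity)
qed

lemma C_log_infinity_annulus: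
  assumes "\<alpha> \<in> C_log_infinity"
  obtains c where "0 \<le> c"
    "\<And>k x. 0 \<le> k \<Longrightarrow> x \<in> dyadic_annulus k \<Longrightarrow> \<bar>of_int k * (\<alpha> x - value_infinity \<alpha>)\<bar> \<le> c"
proof -
  obtain a C where C: "\<And>x. \<bar>\<alpha> x - a\<bar> \<le> C / ln (exp 1 + norm x)"
    using assms by (auto simp: C_log_infinity_def)
  have "0 \<le> C" using C[of 0] by simp
  have "\<bar>of_int k * (\<alpha> x - a)\<bar> \<le> 2 * C / ln 2" if k: "0 \<le> k" and x: "x \<in> dyadic_annulus k" for k x
  proof -
    let ?y = "exp 1 + norm x"
    have nx: "2 powr (of_int k - 1) < norm x"
      using x by (auto simp: dyadic_annulus_iff)
    have y1: "1 \<le> ?y"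
      using exp_ge_add_one_self[of 1] norm_ge_zero[of x] by linarith
    \<comment> \<open>The annulus is only known to lie outside the ball of radius \<open>2 powr (k - 1)\<close>; squaring
      makes up for the missing factor \<open>2\<close>.\<close>
    have "2 powr real_of_int k = 2 * 2 powr (of_int k - 1)"
      by (simp add: powr_diff)
    also have "\<dots> \<le> ?y * ?y"
      using nx exp_ge_add_one_self[of 1] norm_ge_zero[of x] by (intro mult_mono) (auto intro: add_increasing2)
    finally have "ln (2 powr of_int k) \<le> ln (?y * ?y)"
      using y1 by (intro ln_mono) auto
    then have l: "of_int k * ln 2 \<le> 2 * ln ?y"
      using y1 by (simp add: ln_mult ln_powr)
    have "ln (exp 1) \<le> ln ?y"
      by (intro ln_mono) (auto intro: add_pos_nonneg)
    then have l1: "1 \<le> ln ?y" by simp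
    have "\<bar>of_int k * (\<alpha> x - a)\<bar> = of_int k * \<bar>\<alpha> x - a\<bar>"
      using k by (simp add: abs_mult)
    also have "\<dots> \<le> of_int k * (C / ln ?y)"
      using k by (intro mult_left_mono C) simp
    also have "\<dots> \<le> 2 * ln ?y / ln 2 * (C / ln ?y)"
      using l l1 \<open>0 \<le> C\<close> by (intro mult_right_mono) (simp_all add: field_simps)
    also have "\<dots> = 2 * C / ln 2" using l1 by simp
    finally show ?thesis .
  qed
  then show ?thesis
    using \<open>0 \<le> C\<close> value_infinity_eq[OF C] by (intro that[of "2 * C / ln 2"]) auto
qed

text \<open>
  Up to a constant, \<open>2 powr (k * \<alpha> x)\<close> is \<open>2 powr (k * \<alpha> 0)\<close> on the annuli inside the unit ball and
  \<open>2 powr (k * \<alpha>\<^sub>\<infinity>)\<close> on those outside. The sign condition is what is needed when the two annuli lie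
  on different sides of the unit sphere.
\<close>

lemma annulus_weight_transfer:
  fixes \<alpha> :: "real^'n \<Rightarrow> real"
  assumes "\<alpha> \<in> C_log_zero" "\<alpha> \<in> C_log_infinity" "value_infinity \<alpha> \<le> \<alpha> 0"
  obtains c where "0 < c"
    "\<And>k j x z. x \<in> dyadic_annulus k \<Longrightarrow> z \<in> dyadic_annulus j \<Longrightarrow>
      2 powr (of_int k * \<alpha> x) \<le>
        c * max (2 powr (of_int (k - j) * \<alpha> 0)) (2 powr (of_int (k - j) * value_infinity \<alpha>)) * 2 powr (of_int j * \<alpha> z)"
proof -
  let ?b = "value_infinity \<alpha>"
  obtain c0 where c0: "0 \<le> c0" "\<And>k x. k \<le> 0 \<Longrightarrow> x \<in> dyadic_annulus k \<Longrightarrow> \<bar>of_int k * (\<alpha> x - \<alpha> 0)\<bar> \<le> c0"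
    using C_log_zero_annulus[OF assms(1)] by blast
  obtain c1 where c1: "0 \<le> c1" "\<And>k x. 0 \<le> k \<Longrightarrow> x \<in> dyadic_annulus k \<Longrightarrow> \<bar>of_int k * (\<alpha> x - ?b)\<bar> \<le> c1"
    using C_log_infinity_annulus[OF assms(2)] by blast
  let ?c = "2 * (c0 + c1)"
  have "of_int k * \<alpha> x \<le> ?c + max (of_int (k - j) * \<alpha> 0) (of_int (k - j) * ?b) + of_int j * \<alpha> z"
    if x: "x \<in> dyadic_annulus k" and z: "z \<in> dyadic_annulus j" for k j x z
  proof -
    have k: "of_int k * \<alpha> x \<le> c0 + c1 + of_int k * (if k \<le> 0 then \<alpha> 0 else ?b)"
      using c0(2)[OF _ x] c1(2)[OF _ x] c0(1) c1(1) by (auto simp: abs_le_iff right_diff_distrib)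
    have j: "of_int j * (if j \<le> 0 then \<alpha> 0 else ?b) \<le> c0 + c1 + of_int j * \<alpha> z"
      using c0(2)[OF _ z] c1(2)[OF _ z] c0(1) c1(1) by (auto simp: abs_le_iff right_diff_distrib)
    have "of_int k * (if k \<le> 0 then \<alpha> 0 else ?b)
        \<le> of_int j * (if j \<le> 0 then \<alpha> 0 else ?b) + max (of_int (k - j) * \<alpha> 0) (of_int (k - j) * ?b)"
    proof -
      have "of_int k * \<alpha> 0 \<le> of_int k * ?b" if "k \<le> 0"
        using assms(3) that by (intro mult_left_mono_neg) auto
      moreover have "of_int k * ?b \<le> of_int k * \<alpha> 0" if "0 \<le> k"
        using assms(3) that by (intro mult_left_mono) auto
      moreover have "of_int (k - j) * v = of_int k * v - of_int j * v" for v :: real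
        by (simp add: left_diff_distrib)
      ultimately show ?thesis
        using max.cobounded1[of "of_int (k - j) * \<alpha> 0" "of_int (k - j) * ?b"]
          max.cobounded2[of "of_int (k - j) * ?b" "of_int (k - j) * \<alpha> 0"]
        by (cases "k \<le> 0"; cases "j \<le> 0") (simp_all only: if_True if_False, linarith+)
    qed
    note * = this
    have arith: "\<lbrakk>a \<le> c + x; x \<le> y + m; y \<le> c + z\<rbrakk> \<Longrightarrow> a \<le> 2 * c + m + z" for a c x y m z :: real
      by linarith
    show ?thesis by (rule arith[OF k * j])
  qed
  note exponents = this
  show ?thesis
  proof (rule that[of "2 powr ?c"])
    fix k j and x z :: "real^'n" assume xz: "x \<in> dyadic_annulus k" "z \<in> dyadic_annulus j"
    have "2 powr (of_int k * \<alpha> x) \<le> 2 powr (?c + max (of_int (k - j) * \<alpha> 0) (of_int (k - j) * ?b) + of_int j * \<alpha> z)"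
      using exponents[OF xz] by (intro powr_mono) auto
    also have "\<dots> = 2 powr ?c * 2 powr (max (of_int (k - j) * \<alpha> 0) (of_int (k - j) * ?b)) * 2 powr (of_int j * \<alpha> z)"
      by (simp only: powr_add)
    also have "2 powr (max (of_int (k - j) * \<alpha> 0) (of_int (k - j) * ?b)) =
        max (2 powr (of_int (k - j) * \<alpha> 0)) (2 powr (of_int (k - j) * ?b))"
      by (simp add: max_def)
    finally show "2 powr (of_int k * \<alpha> x) \<le> 2 powr ?c *
        max (2 powr (of_int (k - j) * \<alpha> 0)) (2 powr (of_int (k - j) * ?b)) * 2 powr (of_int j * \<alpha> z)" .
  qed simp
qed

lemma powr_ceiling_log_le:
  fixes N a :: real
  assumes "0 < N"
  shows "2 powr (of_int \<lceil>log 2 N\<rceil> * a) \<le> 2 powr \<bar>a\<bar> * N powr a"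
proof (cases "0 \<le> a")
  case True
  have "of_int \<lceil>log 2 N\<rceil> * a \<le> (log 2 N + 1) * a"
    by (intro mult_right_mono True) linarith
  then have "2 powr (of_int \<lceil>log 2 N\<rceil> * a) \<le> 2 powr ((log 2 N + 1) * a)"
    by (intro powr_mono) auto
  also have "\<dots> = 2 powr a * (2 powr log 2 N) powr a"
    by (simp add: powr_powr powr_add[symmetric] algebra_simps)
  finally show ?thesis using assms True by simp
next
  case False
  have "of_int \<lceil>log 2 N\<rceil> * a \<le> log 2 N * a"
    using False by (intro mult_right_mono_neg) linarith+
  also have "\<dots> \<le> log 2 N * a + \<bar>a\<bar>" by simp
  finally have "2 powr (of_int \<lceil>log 2 N\<rceil> * a) \<le> 2 powr (log 2 N * a + \<bar>a\<bar>)"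
    by (intro powr_mono) auto
  also have "\<dots> = 2 powr \<bar>a\<bar> * (2 powr log 2 N) powr a"
    by (simp add: powr_powr powr_add)
  finally show ?thesis using assms by simp
qed

text \<open>
  The maximum of the terms is at most their sum, which separates the two exponents; the rounding of \<open>log 2 N\<close> costs
  a factor \<open>2\<close> to the power \<open>\<bar>a\<bar>\<close> or \<open>\<bar>b\<bar>\<close>.
\<close>

lemma shifted_geometric_sum_le:
  fixes N a b :: real and I :: "int set"
  assumes "0 < N" "finite I"
  shows "(\<Sum>r\<in>I. max (2 powr (of_int (\<lceil>log 2 N\<rceil> + r) * a)) (2 powr (of_int (\<lceil>log 2 N\<rceil> + r) * b)))
    \<le> 2 * 2 powr (\<bar>a\<bar> + \<bar>b\<bar>) * max (N powr a) (N powr b) *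
        max (\<Sum>r\<in>I. 2 powr (of_int r * a)) (\<Sum>r\<in>I. 2 powr (of_int r * b))" (is "_ \<le> 2 * ?c * ?M * ?S")
proof -
  have *: "(\<Sum>r\<in>I. 2 powr (of_int (\<lceil>log 2 N\<rceil> + r) * d)) \<le> ?c * ?M * ?S" if "d = a \<or> d = b" for d
  proof -
    have "(\<Sum>r\<in>I. 2 powr (of_int (\<lceil>log 2 N\<rceil> + r) * d)) = 2 powr (of_int \<lceil>log 2 N\<rceil> * d) * (\<Sum>r\<in>I. 2 powr (of_int r * d))"
      by (simp add: distrib_right powr_add sum_distrib_left)
    also have "\<dots> \<le> (2 powr \<bar>d\<bar> * N powr d) * (\<Sum>r\<in>I. 2 powr (of_int r * d))"
      by (intro mult_right_mono powr_ceiling_log_le assms sum_nonneg) auto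
    also have "\<dots> \<le> (?c * ?M) * ?S"
      using that by (intro mult_mono sum_nonneg) (auto intro!: sum_nonneg simp: max_def)
    finally show ?thesis .
  qed
  have "(\<Sum>r\<in>I. max (2 powr (of_int (\<lceil>log 2 N\<rceil> + r) * a)) (2 powr (of_int (\<lceil>log 2 N\<rceil> + r) * b)))
     \<le> (\<Sum>r\<in>I. 2 powr (of_int (\<lceil>log 2 N\<rceil> + r) * a) + 2 powr (of_int (\<lceil>log 2 N\<rceil> + r) * b))"
    by (intro sum_mono) auto
  also have "\<dots> \<le> ?c * ?M * ?S + ?c * ?M * ?S"
    unfolding sum.distrib by (intro add_mono *) auto
  also have "\<dots> = 2 * ?c * ?M * ?S"
    by (simp only: mult.assoc mult_2[symmetric])
  finally show ?thesis .
qed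

lemma powr_norm_matrix_le:
  fixes A :: "real^'n^'n"
  assumes A: "invertible A" and "x \<noteq> 0"
  shows "norm x powr \<gamma> \<le> max (norm A powr (- \<gamma>)) (norm (matrix_inv A) powr \<gamma>) * norm (A *v x) powr \<gamma>"
proof -
  have inv: "matrix_inv A *v (A *v x) = x"
    using matrix_inv_mult[OF A] by (simp add: matrix_vector_mul_assoc)
  have 1: "norm x \<le> norm (matrix_inv A) * norm (A *v x)"
    using norm_matrix_vector_le[of "matrix_inv A" "A *v x"] by (simp add: inv)
  have 2: "norm (A *v x) \<le> norm A * norm x"
    by (rule norm_matrix_vector_le)
  have "A *v x \<noteq> 0" using inv \<open>x \<noteq> 0\<close> by auto
  show ?thesis
  proof (cases "0 \<le> \<gamma>")
    case True
    have "norm x powr \<gamma> \<le> (norm (matrix_inv A) * norm (A *v x)) powr \<gamma>"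
      using True 1 by (intro powr_mono2) auto
    also have "\<dots> = norm (matrix_inv A) powr \<gamma> * norm (A *v x) powr \<gamma>"
      by (simp add: powr_mult)
    also have "\<dots> \<le> max (norm A powr (- \<gamma>)) (norm (matrix_inv A) powr \<gamma>) * norm (A *v x) powr \<gamma>"
      by (intro mult_right_mono) auto
    finally show ?thesis .
  next
    case False
    have "0 < norm A" using 2 \<open>A *v x \<noteq> 0\<close> \<open>x \<noteq> 0\<close> by (auto simp: zero_less_mult_iff)
    have "norm A powr \<gamma> * norm x powr \<gamma> = (norm A * norm x) powr \<gamma>"
      by (simp add: powr_mult)
    also have "\<dots> \<le> norm (A *v x) powr \<gamma>"
      using False 2 \<open>A *v x \<noteq> 0\<close> by (intro powr_mono2') auto
    finally have "norm x powr \<gamma> \<le> norm A powr (- \<gamma>) * norm (A *v x) powr \<gamma>"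
      using \<open>0 < norm A\<close> by (simp add: powr_minus field_simps)
    also have "\<dots> \<le> max (norm A powr (- \<gamma>)) (norm (matrix_inv A) powr \<gamma>) * norm (A *v x) powr \<gamma>"
      by (intro mult_right_mono) auto
    finally show ?thesis .
  qed
qed

text \<open>
  The image of an annulus is stretched by at most \<open>norm A\<close> and shrunk by at most \<open>norm (matrix_inv A)\<close>. Rounding
  \<open>norm A\<close> up to a power of \<open>2\<close> costs one further annulus at the inner end, whence the bound \<open>\<theta> - 1\<close>.
\<close>

lemma matrix_image_annulus:
  fixes A :: "real^'n^'n" and \<theta> :: int
  assumes A: "invertible A" and \<theta>: "norm A * norm (matrix_inv A) \<le> 2 powr (- of_int \<theta>)"
    and x: "x \<in> dyadic_annulus k"
  obtains r where "r \<in> {\<theta> - 1..0}" "A *v x \<in> dyadic_annulus (k + (\<lceil>log 2 (norm A)\<rceil> + r))"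
proof -
  let ?z = "A *v x"
  have inv: "matrix_inv A *v ?z = x"
    using matrix_inv_mult[OF A] by (simp add: matrix_vector_mul_assoc)
  have 1: "norm x \<le> norm (matrix_inv A) * norm ?z"
    using norm_matrix_vector_le[of "matrix_inv A" ?z] by (simp add: inv)
  have 2: "norm ?z \<le> norm A * norm x"
    by (rule norm_matrix_vector_le)
  have "x \<noteq> 0" and k: "of_int k - 1 < log 2 (norm x)" "log 2 (norm x) \<le> of_int k"
    using x by (auto simp: dyadic_annulus_iff_ceiling) linarith+
  have "?z \<noteq> 0" using inv \<open>x \<noteq> 0\<close> by auto
  have "0 < norm A" using 2 \<open>?z \<noteq> 0\<close> \<open>x \<noteq> 0\<close> by (auto simp: zero_less_mult_iff)
  have "0 < norm (matrix_inv A)" using 1 \<open>?z \<noteq> 0\<close> \<open>x \<noteq> 0\<close> by (auto simp: zero_less_mult_iff)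
  have "log 2 (norm ?z) \<le> log 2 (norm A * norm x)"
    using 2 \<open>?z \<noteq> 0\<close> by (intro log_mono) auto
  then have u: "log 2 (norm ?z) \<le> log 2 (norm A) + log 2 (norm x)"
    using \<open>0 < norm A\<close> \<open>x \<noteq> 0\<close> by (simp add: log_mult)
  have "log 2 (norm x) \<le> log 2 (norm (matrix_inv A) * norm ?z)"
    using 1 \<open>x \<noteq> 0\<close> by (intro log_mono) auto
  then have l: "log 2 (norm x) \<le> log 2 (norm (matrix_inv A)) + log 2 (norm ?z)"
    using \<open>0 < norm (matrix_inv A)\<close> \<open>?z \<noteq> 0\<close> by (simp add: log_mult)
  have "log 2 (norm A * norm (matrix_inv A)) \<le> log 2 (2 powr (- of_int \<theta>))"
    using \<theta> \<open>0 < norm A\<close> \<open>0 < norm (matrix_inv A)\<close> by (intro log_mono) auto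
  then have t: "log 2 (norm A) + log 2 (norm (matrix_inv A)) \<le> - of_int \<theta>"
    using \<open>0 < norm A\<close> \<open>0 < norm (matrix_inv A)\<close> by (simp add: log_mult)
  show ?thesis
  proof (rule that[of "\<lceil>log 2 (norm ?z)\<rceil> - k - \<lceil>log 2 (norm A)\<rceil>"])
    have "\<lceil>log 2 (norm ?z)\<rceil> \<le> k + \<lceil>log 2 (norm A)\<rceil>"
      using u k by linarith
    moreover have "\<theta> - 1 + k + \<lceil>log 2 (norm A)\<rceil> \<le> \<lceil>log 2 (norm ?z)\<rceil>"
      using l k t by linarith
    ultimately show "\<lceil>log 2 (norm ?z)\<rceil> - k - \<lceil>log 2 (norm A)\<rceil> \<in> {\<theta> - 1..0}" by auto
  qed (use \<open>?z \<noteq> 0\<close> in \<open>simp add: dyadic_annulus_iff_ceiling\<close>)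
qed

section \<open>Estimates for a fixed matrix\<close>

lemma bounded_exponentsD:
  assumes "q \<in> bounded_exponents"
  shows "q \<in> borel_measurable lebesgue" "q x \<noteq> top" "1 \<le> q x" "1 \<le> enn2real (q x)"
    "0 < enn2real (exponent_minus q)" "enn2real (exponent_minus q) \<le> enn2real (q x)"
    "enn2real (q x) \<le> enn2real (exponent_plus q)" "ennreal (enn2real (q x)) = q x"
proof -
  have q: "q \<in> exponents" "1 < exponent_minus q" "exponent_minus q \<le> q x" "q x \<le> exponent_plus q" "exponent_plus q < top"
    using assms by (auto simp: bounded_exponents_def)
  then show m: "q \<in> borel_measurable lebesgue" and 1: "1 \<le> q x"
    by (auto simp: exponents_def)
  have lt: "q x < top" "exponent_minus q < top"
    using q by auto
  show "q x \<noteq> top" using lt by simp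
  then show "ennreal (enn2real (q x)) = q x" by (simp add: less_top)
  show "1 \<le> enn2real (q x)"
    using enn2real_mono[OF 1 lt(1)] by simp
  show "0 < enn2real (exponent_minus q)"
    using less_trans[OF zero_less_one q(2)] lt(2) by (simp add: enn2real_positive_iff)
  show "enn2real (exponent_minus q) \<le> enn2real (q x)"
    by (rule enn2real_mono[OF q(3) lt(1)])
  show "enn2real (q x) \<le> enn2real (exponent_plus q)"
    by (rule enn2real_mono[OF q(4,5)])
qed

lemma measurable_norm_powr_lebesgue [measurable]:
  "(\<lambda>x::real^'n. norm x powr \<gamma>) \<in> borel_measurable lebesgue"
  by (rule measurable_completion) measurable

lemma norm_indicator_complex: "norm (indicator S x :: complex) = indicator S x"
  by (simp add: indicator_def)

lemma det_matrix_inv: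
  fixes A :: "real^'n^'n"
  assumes "invertible A"
  shows "det A \<noteq> 0" "det (matrix_inv A) = 1 / det A"
proof -
  have "det A * det (matrix_inv A) = 1"
    using matrix_inv_mult(1)[OF assms] by (metis det_I det_mul)
  then show "det A \<noteq> 0" "det (matrix_inv A) = 1 / det A"
    by (auto simp: eq_divide_eq mult.commute)
qed

lemma norm_pos_of_invertible:
  fixes A :: "real^'n^'n"
  assumes "invertible A"
  shows "0 < norm A" "0 < norm (matrix_inv A)"
proof -
  have "A \<noteq> 0" "matrix_inv A \<noteq> 0"
    using det_matrix_inv[OF assms] by (auto simp: det_0[unfolded mat_0])
  then show "0 < norm A" "0 < norm (matrix_inv A)" by auto
qed

text \<open>
  The factor \<open>\<bar>det A\<bar>\<close> of the change of variables is raised to a variable power when it is absorbed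
  in the norm, which explains the maximum over the two extreme powers.
\<close>

lemma modular_linear_change:
  fixes A :: "real^'n^'n" and q :: "real^'n \<Rightarrow> ennreal"
  defines "d \<equiv> max (\<bar>det (matrix_inv A)\<bar> powr (1 / enn2real (exponent_plus q)))
         (\<bar>det (matrix_inv A)\<bar> powr (1 / enn2real (exponent_minus q)))"
  assumes A: "invertible A" and q: "q \<in> bounded_exponents"
    and W[measurable]: "W \<in> borel_measurable lebesgue" and W0: "\<And>z. 0 \<le> W z"
  shows "modular (\<lambda>x. enn2real (q x)) (\<lambda>x. W (A *v x) / d) \<le> modular (\<lambda>z. enn2real (q (matrix_inv A *v z))) W"
proof -
  note detA = det_matrix_inv[OF A]
  note Q = bounded_exponentsD[OF q]
  have inv: "matrix_inv A *v (A *v x) = x" for x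
    using matrix_inv_mult[OF A] by (simp add: matrix_vector_mul_assoc)
  have di: "det (matrix_inv A) \<noteq> 0" using detA by simp
  define s where "s z = enn2real (q (matrix_inv A *v z))" for z
  have [measurable]: "s \<in> borel_measurable lebesgue"
    unfolding s_def using measurable_comp[OF measurable_matrix_lebesgue[OF di] Q(1)] by (simp add: comp_def)
  have s: "1 \<le> s z" for z by (simp add: s_def Q)
  have "0 < d" using di by (simp add: d_def less_max_iff_disj)
  let ?D = "\<bar>det (matrix_inv A)\<bar>"
  have d_le: "?D \<le> d powr s z" for z
  proof -
    have "?D powr (1 / s z) \<le> d"
    proof (cases "1 \<le> ?D")
      case True
      then have "?D powr (1 / s z) \<le> ?D powr (1 / enn2real (exponent_minus q))"
        using Q(5,6) s by (intro powr_mono divide_left_mono) (auto simp: s_def intro: less_le_trans)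
      then show ?thesis by (simp add: d_def)
    next
      case False
      have "0 < enn2real (exponent_plus q)" using Q(4,7)[of undefined] by linarith
      then have "1 / enn2real (exponent_plus q) \<le> 1 / s z"
        using Q(7) s[of z] by (intro divide_left_mono) (auto simp: s_def intro: less_le_trans[OF zero_less_one])
      then have "?D powr (1 / s z) \<le> ?D powr (1 / enn2real (exponent_plus q))"
        using False by (intro powr_mono') auto
      then show ?thesis by (simp add: d_def)
    qed
    then have "(?D powr (1 / s z)) powr s z \<le> d powr s z"
      using s[of z] by (intro powr_mono2) auto
    then show ?thesis using s[of z] by (simp add: powr_powr)
  qed
  define h where "h z = ennreal ((W z / d) powr s z)" for z
  have [measurable]: "h \<in> borel_measurable lebesgue"
    unfolding h_def by measurable
  have "ennreal \<bar>det A\<bar> * modular (\<lambda>x. enn2real (q x)) (\<lambda>x. W (A *v x) / d)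
      = ennreal \<bar>det A\<bar> * (\<integral>\<^sup>+x. h (A *v x) \<partial>lebesgue)"
    by (simp add: modular_def h_def s_def inv)
  also have "\<dots> = (\<integral>\<^sup>+z. h z \<partial>lebesgue)"
    by (rule nn_integral_lebesgue_matrix) (use detA in auto)
  also have "\<dots> \<le> (\<integral>\<^sup>+z. ennreal \<bar>det A\<bar> * ennreal (W z powr s z) \<partial>lebesgue)"
  proof (rule nn_integral_mono)
    fix z
    have "1 \<le> \<bar>det A\<bar> * d powr s z"
      using mult_left_mono[OF d_le[of z], of "\<bar>det A\<bar>"] detA by (simp add: abs_mult[symmetric])
    then have "1 * W z powr s z \<le> \<bar>det A\<bar> * d powr s z * W z powr s z"
      by (intro mult_right_mono) auto
    then have "(W z / d) powr s z \<le> \<bar>det A\<bar> * W z powr s z"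
      using \<open>0 < d\<close> W0[of z] by (simp add: powr_divide field_simps)
    then show "h z \<le> ennreal \<bar>det A\<bar> * ennreal (W z powr s z)"
      by (simp add: h_def ennreal_leI flip: ennreal_mult')
  qed
  also have "\<dots> = ennreal \<bar>det A\<bar> * modular s W"
    unfolding modular_def by (rule nn_integral_cmult) measurable
  finally show ?thesis
    using detA(1) by (simp add: ennreal_mult_le_mult_iff s_def[abs_def])
qed

text \<open>
  At each point only one summand is nonzero, because the annuli are disjoint, and a weight \<open>w r \<le> 1\<close> leaves a power
  with exponent at least \<open>1\<close> as a factor not larger than \<open>w r\<close>.
\<close>

lemma annular_superposition:
  fixes v :: "int \<Rightarrow> real^'n \<Rightarrow> real"
  assumes I: "finite I" and w: "\<And>r. r \<in> I \<Longrightarrow> 0 \<le> w r" "(\<Sum>r\<in>I. w r) = 1"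
    and a: "\<And>x. 1 \<le> a x" and [measurable]: "a \<in> borel_measurable lebesgue"
    and v0: "\<And>r x. 0 \<le> v r x" and supp: "\<And>r x. x \<notin> dyadic_annulus (l + r) \<Longrightarrow> v r x = 0"
    and [measurable]: "\<And>r. v r \<in> borel_measurable lebesgue"
    and v1: "\<And>r. r \<in> I \<Longrightarrow> modular a (v r) \<le> 1"
  shows "modular a (\<lambda>x. \<Sum>r\<in>I. w r * v r x) \<le> 1"
proof -
  have w1: "w r \<le> 1" if "r \<in> I" for r
    using member_le_sum[OF that, of w] I w by auto
  have single: "(\<Sum>r\<in>I. w r * v r x) = w r0 * v r0 x" if "r0 \<in> I" "x \<in> dyadic_annulus (l + r0)" for r0 x
  proof -
    have "v r x = 0" if "r \<noteq> r0" for r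
      using supp[of x r] \<open>x \<in> dyadic_annulus (l + r0)\<close> that by (auto simp: dyadic_annulus_iff_ceiling)
    then show ?thesis
      using I that(1) by (subst sum.remove[of _ r0]) (auto intro!: sum.neutral)
  qed
  have "modular a (\<lambda>x. \<Sum>r\<in>I. w r * v r x) \<le> (\<integral>\<^sup>+x. (\<Sum>r\<in>I. ennreal (w r) * ennreal (v r x powr a x)) \<partial>lebesgue)"
    unfolding modular_def
  proof (rule nn_integral_mono)
    fix x
    have nonneg: "0 \<le> w r * v r x powr a x" if "r \<in> I" for r using w that by simp
    show "ennreal ((\<Sum>r\<in>I. w r * v r x) powr a x) \<le> (\<Sum>r\<in>I. ennreal (w r) * ennreal (v r x powr a x))"
    proof (cases "\<exists>r\<in>I. x \<in> dyadic_annulus (l + r)")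
      case True
      then obtain r0 where r0: "r0 \<in> I" "x \<in> dyadic_annulus (l + r0)" by auto
      have "w r0 powr a x \<le> w r0 powr 1"
        using a w(1)[OF r0(1)] w1[OF r0(1)] by (intro powr_mono') auto
      then have "(w r0 * v r0 x) powr a x \<le> w r0 * v r0 x powr a x"
        using w(1)[OF r0(1)] by (simp add: powr_mult mult_right_mono)
      also have "\<dots> \<le> (\<Sum>r\<in>I. w r * v r x powr a x)"
        by (rule member_le_sum[OF r0(1)]) (use nonneg I in auto)
      finally have "ennreal ((w r0 * v r0 x) powr a x) \<le> ennreal (\<Sum>r\<in>I. w r * v r x powr a x)"
        by (rule ennreal_leI)
      also have "\<dots> = (\<Sum>r\<in>I. ennreal (w r * v r x powr a x))"
        by (rule sum_ennreal[symmetric]) (rule nonneg)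
      also have "\<dots> = (\<Sum>r\<in>I. ennreal (w r) * ennreal (v r x powr a x))"
        by (intro sum.cong ennreal_mult' w refl)
      finally show ?thesis
        unfolding single[OF r0] .
    next
      case False
      then have "(\<Sum>r\<in>I. w r * v r x) = 0"
        using supp by (intro sum.neutral) auto
      then show ?thesis by simp
    qed
  qed
  also have "\<dots> = (\<Sum>r\<in>I. ennreal (w r) * modular a (v r))"
    unfolding modular_def by (subst nn_integral_sum) (auto intro!: sum.cong nn_integral_cmult)
  also have "\<dots> \<le> (\<Sum>r\<in>I. ennreal (w r) * 1)"
    by (intro sum_mono mult_left_mono v1) auto
  also have "\<dots> = 1"
    using w by (simp add: sum_ennreal)
  finally show ?thesis .
qed

text \<open>
  The estimate of one factor. On the annulus \<open>k\<close>, the function \<open>f (A x)\<close> sees only the pieces of \<open>f\<close> on the annuli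
  \<open>k + \<lceil>log 2 (norm A)\<rceil> + r\<close> with \<open>\<theta> - 1 \<le> r \<le> 0\<close>. Their contributions are weighted by the summands of \<open>S\<close>, in which
  \<open>lam\<close> comes from the Morrey--Herz norm and \<open>a\<close>, \<open>b\<close> from comparing the weights \<open>2 powr (j * \<alpha>)\<close> on different annuli.
\<close>

lemma modular_factor_le:
  fixes A :: "real^'n^'n" and q :: "real^'n \<Rightarrow> ennreal" and f :: "real^'n \<Rightarrow> complex" and \<theta> :: int
    and lam a b c P \<rho> \<gamma> \<zeta> :: real
  defines "S \<equiv> \<Sum>r\<in>{\<theta> - 1..0}. max (2 powr (of_int (\<lceil>log 2 (norm A)\<rceil> + r) * (lam - a)))
                                       (2 powr (of_int (\<lceil>log 2 (norm A)\<rceil> + r) * (lam - b)))"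
  assumes A: "invertible A" and q: "q \<in> bounded_exponents" and \<zeta>: "0 < \<zeta>"
    and qle: "\<And>x. q (matrix_inv A *v x) \<le> ennreal \<zeta> * q x"
    and [measurable]: "f \<in> borel_measurable lebesgue" "\<alpha> \<in> borel_measurable lebesgue"
    and P: "0 < P" "\<And>j. lp_norm_weighted (\<lambda>x. ennreal \<zeta> * q x) (\<lambda>x. norm x powr \<gamma>)
        (\<lambda>x. complex_of_real (2 powr (of_int j * \<alpha> x)) * f x * indicator (dyadic_annulus j) x)
        < ennreal (2 powr (of_int j * lam) * P)"
    and \<rho>: "lp_norm (r_exponent q \<zeta> (matrix_inv A)) (\<lambda>_. 1) < ennreal \<rho>"
    and c: "0 < c" "\<And>k j x z. x \<in> dyadic_annulus k \<Longrightarrow> z \<in> dyadic_annulus j \<Longrightarrow>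
      2 powr (of_int k * \<alpha> x) \<le> c * max (2 powr (of_int (k - j) * a)) (2 powr (of_int (k - j) * b)) * 2 powr (of_int j * \<alpha> z)"
    and \<theta>: "norm A * norm (matrix_inv A) \<le> 2 powr (- of_int \<theta>)"
  shows "0 < S" "0 < \<rho>" "0 < c_factor A q \<gamma>"
    and "modular (\<lambda>x. enn2real (q x)) (\<lambda>x. 2 powr (of_int k * \<alpha> x) * norm x powr \<gamma> * indicator (dyadic_annulus k) x * norm (f (A *v x))
        / (c * c_factor A q \<gamma> * 2 powr (of_int k * lam) * P * S * \<rho>)) \<le> 2"
proof -
  note Q = bounded_exponentsD[OF q]
  note detA = det_matrix_inv[OF A]
  have di: "det (matrix_inv A) \<noteq> 0" using detA by simp
  define I where "I = {\<theta> - 1..0::int}"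
  have fin: "finite I" by (simp add: I_def)
  define l where "l = k + \<lceil>log 2 (norm A)\<rceil>"
  define M where "M r = max (2 powr (of_int (\<lceil>log 2 (norm A)\<rceil> + r) * (lam - a)))
                              (2 powr (of_int (\<lceil>log 2 (norm A)\<rceil> + r) * (lam - b)))" for r
  have M0: "0 < M r" for r by (simp add: M_def less_max_iff_disj)
  have S: "S = sum M I" by (simp add: S_def M_def I_def)
  have "I \<noteq> {}"
  proof -
    have "(2 powr of_int k) *\<^sub>R axis undefined 1 \<in> (dyadic_annulus k :: (real^'n) set)"
      by (simp add: dyadic_annulus_iff)
    from matrix_image_annulus[OF A \<theta> this] show ?thesis unfolding I_def by blast
  qed
  then show "0 < S" unfolding S using fin M0 by (intro sum_pos) auto
  show "0 < \<rho>" by (rule lp_norm_one_lessD(1)[OF \<rho>])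
  define d where "d = max (\<bar>det (matrix_inv A)\<bar> powr (1 / enn2real (exponent_plus q)))
         (\<bar>det (matrix_inv A)\<bar> powr (1 / enn2real (exponent_minus q)))"
  define g where "g = max (norm A powr (- \<gamma>)) (norm (matrix_inv A) powr \<gamma>)"
  have "0 < d" "0 < g" using di norm_pos_of_invertible[OF A] by (simp_all add: d_def g_def less_max_iff_disj)
  have cf: "c_factor A q \<gamma> = g * d" by (simp add: c_factor_def d_def g_def)
  show "0 < c_factor A q \<gamma>" using \<open>0 < d\<close> \<open>0 < g\<close> by (simp add: cf)
  define s where "s z = enn2real (q (matrix_inv A *v z))" for z
  define a' where "a' z = \<zeta> * enn2real (q z)" for z
  have a'_eq: "ennreal (a' z) = ennreal \<zeta> * q z" "enn2real (ennreal \<zeta> * q z) = a' z" for z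
    using \<zeta> Q(8)[of z] by (simp_all add: a'_def ennreal_mult' enn2real_mult)
  have s_eq: "ennreal (s z) = q (matrix_inv A *v z)" for z
    by (simp add: s_def Q)
  have [measurable]: "s \<in> borel_measurable lebesgue"
    unfolding s_def using measurable_comp[OF measurable_matrix_lebesgue[OF di] Q(1)] by (simp add: comp_def)
  have [measurable]: "a' \<in> borel_measurable lebesgue"
    unfolding a'_def using Q(1) by measurable
  have s1: "1 \<le> s z" for z by (simp add: s_def Q)
  have sa: "s z \<le> a' z" for z
  proof -
    have "ennreal (s z) \<le> ennreal (a' z)" using qle[of z] by (simp add: s_eq a'_eq)
    then show ?thesis using \<zeta> by (subst (asm) ennreal_le_iff) (auto simp: a'_def)
  qed
  have a'1: "1 \<le> a' z" for z using s1 sa order_trans by blast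
  \<comment> \<open>Dividing by the bound \<open>P\<close> makes each annular piece of \<open>f\<close> have modular at most \<open>1\<close>.\<close>
  define v where "v r z = 2 powr (of_int (l + r) * \<alpha> z) * norm (f z) * indicator (dyadic_annulus (l + r)) z * norm z powr \<gamma>
      / (2 powr (of_int (l + r) * lam) * P)" for r z
  have [measurable]: "v r \<in> borel_measurable lebesgue" for r
    unfolding v_def by measurable
  have v0: "0 \<le> v r z" for r z using P(1) by (simp add: v_def)
  have v1: "modular a' (v r) \<le> 1" for r
  proof -
    have "ennreal \<zeta> * q x \<noteq> top" for x using Q(2)[of x] by (simp add: ennreal_mult_eq_top_iff)
    from modular_le_one_of_lp_norm[OF this P(2)[of "l + r", unfolded lp_norm_weighted_def]]
    show ?thesis
      unfolding v_def a'_eq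
      by (simp add: norm_mult norm_indicator_complex)
  qed
  define V where "V z = (\<Sum>r\<in>I. M r / S * v r z)" for z
  have [measurable]: "V \<in> borel_measurable lebesgue" unfolding V_def by measurable
  have V0: "0 \<le> V z" for z
    unfolding V_def using M0 \<open>0 < S\<close> v0 by (intro sum_nonneg) (simp add: less_imp_le)
  have V1: "modular a' V \<le> 1"
    unfolding V_def
    by (rule annular_superposition[OF fin, where l=l])
       (use M0 \<open>0 < S\<close> a'1 v0 v1 in \<open>auto simp: less_imp_le S sum_divide_distrib[symmetric]\<close>, auto simp: v_def)
  have "modular s (\<lambda>z. V z / \<rho>) \<le> 2"
    using \<rho> by (intro modular_smaller_exponent[of s a']) (simp_all add: s1 sa V0 V1 a'_eq s_eq r_exponent_def[abs_def])
  then have mod2: "modular (\<lambda>x. enn2real (q x)) (\<lambda>x. V (A *v x) / \<rho> / d) \<le> 2"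
    using modular_linear_change[OF A q, of "\<lambda>z. V z / \<rho>"] V0 \<open>0 < \<rho>\<close>
    unfolding d_def s_def[abs_def] by (auto intro: order_trans)
  have "modular (\<lambda>x. enn2real (q x)) (\<lambda>x. 2 powr (of_int k * \<alpha> x) * norm x powr \<gamma> * indicator (dyadic_annulus k) x * norm (f (A *v x))
        / (c * c_factor A q \<gamma> * 2 powr (of_int k * lam) * P * S * \<rho>))
     \<le> modular (\<lambda>x. enn2real (q x)) (\<lambda>x. V (A *v x) / \<rho> / d)"
  proof (rule modular_mono, simp, rule AE_I2, rule conjI)
    fix x
    have pos: "0 < c * c_factor A q \<gamma> * 2 powr (of_int k * lam) * P * S * \<rho>"
      using c(1) \<open>0 < c_factor A q \<gamma>\<close> P(1) \<open>0 < S\<close> \<open>0 < \<rho>\<close> by simp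
    then show "0 \<le> 2 powr (of_int k * \<alpha> x) * norm x powr \<gamma> * indicator (dyadic_annulus k) x * norm (f (A *v x))
        / (c * c_factor A q \<gamma> * 2 powr (of_int k * lam) * P * S * \<rho>)"
      by (intro divide_nonneg_pos) auto
    have "2 powr (of_int k * \<alpha> x) * norm x powr \<gamma> * norm (f (A *v x))
        \<le> c * g * 2 powr (of_int k * lam) * P * S * V (A *v x)" if x: "x \<in> dyadic_annulus k"
    proof -
      let ?z = "A *v x"
      obtain r where r: "r \<in> I" "?z \<in> dyadic_annulus (l + r)"
        using matrix_image_annulus[OF A \<theta> x] unfolding I_def l_def by (metis add.assoc)
      let ?l = "\<lceil>log 2 (norm A)\<rceil> + r"
      have kl: "k - (l + r) = - ?l" by (simp add: l_def)
      have "x \<noteq> 0" using x by (auto simp: dyadic_annulus_iff_ceiling)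
      have 1: "2 powr (of_int k * \<alpha> x) \<le> c * max (2 powr (- of_int ?l * a)) (2 powr (- of_int ?l * b)) * 2 powr (of_int (l + r) * \<alpha> ?z)"
        using c(2)[OF x r(2)] unfolding kl by simp
      have 2: "norm x powr \<gamma> \<le> g * norm ?z powr \<gamma>"
        unfolding g_def by (rule powr_norm_matrix_le[OF A \<open>x \<noteq> 0\<close>])
      have 3: "2 powr (of_int (l + r) * \<alpha> ?z) * norm ?z powr \<gamma> * norm (f ?z) = v r ?z * (2 powr (of_int (l + r) * lam) * P)"
        using r(2) P(1) by (simp add: v_def)
      have 4: "max (2 powr (- of_int ?l * a)) (2 powr (- of_int ?l * b)) * 2 powr (of_int (l + r) * lam) = M r * 2 powr (of_int k * lam)"
      proof -
        have e: "2 powr (- of_int ?l * t) * 2 powr (of_int (l + r) * lam) = 2 powr (of_int ?l * (lam - t)) * 2 powr (of_int k * lam)" for t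
          unfolding powr_add[symmetric] by (rule arg_cong[where f="\<lambda>y. 2 powr y"]) (simp add: l_def algebra_simps)
        show ?thesis
          unfolding M_def by (subst (1 2) max_mult_distrib_right) (simp only: e powr_ge_zero if_True)
      qed
      have 5: "M r * v r ?z \<le> S * V ?z"
      proof -
        have "M r * v r ?z = S * (M r / S * v r ?z)" using \<open>0 < S\<close> by simp
        also have "\<dots> \<le> S * V ?z"
          unfolding V_def using \<open>0 < S\<close> M0 v0 fin r(1)
          by (intro mult_left_mono member_le_sum) (auto simp: less_imp_le)
        finally show ?thesis .
      qed
      have "2 powr (of_int k * \<alpha> x) * norm x powr \<gamma> * norm (f ?z)
        \<le> (c * max (2 powr (- of_int ?l * a)) (2 powr (- of_int ?l * b)) * 2 powr (of_int (l + r) * \<alpha> ?z)) * (g * norm ?z powr \<gamma>) * norm (f ?z)"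
        using c(1) by (intro mult_right_mono mult_mono 1 2) (auto intro!: mult_nonneg_nonneg simp: le_max_iff_disj)
      also have "\<dots> = c * g * max (2 powr (- of_int ?l * a)) (2 powr (- of_int ?l * b)) * (2 powr (of_int (l + r) * \<alpha> ?z) * norm ?z powr \<gamma> * norm (f ?z))"
        by (simp only: ac_simps)
      also have "\<dots> = c * g * P * (max (2 powr (- of_int ?l * a)) (2 powr (- of_int ?l * b)) * 2 powr (of_int (l + r) * lam)) * v r ?z"
        unfolding 3 by (simp only: ac_simps)
      also have "\<dots> = c * g * P * 2 powr (of_int k * lam) * (M r * v r ?z)"
        unfolding 4 by (simp only: ac_simps)
      also have "\<dots> \<le> c * g * P * 2 powr (of_int k * lam) * (S * V ?z)"
        using c(1) \<open>0 < g\<close> P(1) by (intro mult_left_mono 5) auto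
      finally show ?thesis by (simp only: ac_simps)
    qed
    then have "2 powr (of_int k * \<alpha> x) * norm x powr \<gamma> * indicator (dyadic_annulus k) x * norm (f (A *v x))
        \<le> c * g * 2 powr (of_int k * lam) * P * S * V (A *v x)"
      using c(1) \<open>0 < g\<close> P(1) \<open>0 < S\<close> V0[of "A *v x"] by (cases "x \<in> dyadic_annulus k") auto
    then have "2 powr (of_int k * \<alpha> x) * norm x powr \<gamma> * indicator (dyadic_annulus k) x * norm (f (A *v x))
        / (c * c_factor A q \<gamma> * 2 powr (of_int k * lam) * P * S * \<rho>)
       \<le> c * g * 2 powr (of_int k * lam) * P * S * V (A *v x) / (c * c_factor A q \<gamma> * 2 powr (of_int k * lam) * P * S * \<rho>)"
      by (rule divide_right_mono) (use pos in linarith)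
    also have "\<dots> = V (A *v x) / \<rho> / d"
      using c(1) \<open>0 < g\<close> \<open>0 < d\<close> P(1) \<open>0 < S\<close> \<open>0 < \<rho>\<close> by (simp add: cf)
    finally show "2 powr (of_int k * \<alpha> x) * norm x powr \<gamma> * indicator (dyadic_annulus k) x * norm (f (A *v x))
        / (c * c_factor A q \<gamma> * 2 powr (of_int k * lam) * P * S * \<rho>) \<le> V (A *v x) / \<rho> / d" .
  qed
  also note mod2
  finally show "modular (\<lambda>x. enn2real (q x)) (\<lambda>x. 2 powr (of_int k * \<alpha> x) * norm x powr \<gamma> * indicator (dyadic_annulus k) x * norm (f (A *v x))
        / (c * c_factor A q \<gamma> * 2 powr (of_int k * lam) * P * S * \<rho>)) \<le> 2" .
qed

lemma lp_norm_cong_AE: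
  assumes "\<And>x. p x \<noteq> top" "AE x in lebesgue. norm (f x) = norm (g x)"
  shows "lp_norm p f = lp_norm p g"
proof -
  have "modular (\<lambda>x. enn2real (p x)) (\<lambda>x. norm (f x / complex_of_real \<eta>))
      = modular (\<lambda>x. enn2real (p x)) (\<lambda>x. norm (g x / complex_of_real \<eta>))" for \<eta>
    unfolding modular_def by (rule nn_integral_cong_AE) (use assms(2) in \<open>eventually_elim, simp add: norm_divide\<close>)
  then show ?thesis
    by (simp add: lp_norm_def lp_modular_finite_exponent[OF assms(1)])
qed

lemma lp_norm_zero:
  assumes "\<And>x. p x \<noteq> top"
  shows "lp_norm p (\<lambda>_. 0) = 0"
proof -
  have "lp_norm p (\<lambda>_. 0) \<le> ennreal \<eta>" if "0 < \<eta>" for \<eta>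
    unfolding lp_norm_def using that
    by (intro Inf_lower) (auto simp: lp_modular_finite_exponent[OF assms] modular_def)
  then have "lp_norm p (\<lambda>_. 0) \<le> 0 + ennreal \<eta>" if "0 < \<eta>" for \<eta>
    using that by simp
  then show ?thesis
    using ennreal_le_epsilon[of 0 "lp_norm p (\<lambda>_. 0)"] by simp
qed

text \<open>
  Hoelder's inequality for several factors. The constant \<open>2 * card I\<close> is the sum of the bounds for the modulars of the factors;
  since all exponents are at least \<open>1\<close>, it can be moved out of the modular.
\<close>

lemma lp_norm_prod_le:
  fixes u :: "'i \<Rightarrow> real^'n \<Rightarrow> real" and q :: "'i \<Rightarrow> real^'n \<Rightarrow> ennreal" and q0 :: "real^'n \<Rightarrow> ennreal"
  assumes I: "finite I" "I \<noteq> {}" and q: "\<And>i. i \<in> I \<Longrightarrow> q i \<in> bounded_exponents" "q0 \<in> bounded_exponents"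
    and sum: "\<And>x. (\<Sum>i\<in>I. 1 / q i x) = 1 / q0 x"
    and u: "\<And>i x. i \<in> I \<Longrightarrow> 0 \<le> u i x" "\<And>i. i \<in> I \<Longrightarrow> u i \<in> borel_measurable lebesgue"
    and \<eta>: "\<And>i. i \<in> I \<Longrightarrow> 0 < \<eta> i"
    and mod: "\<And>i. i \<in> I \<Longrightarrow> modular (\<lambda>x. enn2real (q i x)) (\<lambda>x. u i x / \<eta> i) \<le> 2"
    and "0 \<le> \<phi>"
  shows "lp_norm q0 (\<lambda>x. complex_of_real (\<phi> * (\<Prod>i\<in>I. u i x))) \<le> ennreal (\<phi> * (2 * card I) * (\<Prod>i\<in>I. \<eta> i))"
proof (cases "\<phi> = 0")
  case True
  then show ?thesis using lp_norm_zero[of q0] bounded_exponentsD(2)[OF q(2)] by simp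
next
  case False
  with \<open>0 \<le> \<phi>\<close> have "0 < \<phi>" by simp
  note Q0 = bounded_exponentsD[OF q(2)] and Qi = bounded_exponentsD[OF q(1)]
  have sum': "(\<Sum>i\<in>I. 1 / enn2real (q i x)) = 1 / enn2real (q0 x)" for x
  proof -
    have inv: "1 / q' x = ennreal (1 / enn2real (q' x))" if "q' \<in> bounded_exponents" for q' :: "real^'n \<Rightarrow> ennreal"
    proof -
      have "ennreal 1 / ennreal (enn2real (q' x)) = ennreal (1 / enn2real (q' x))"
        using bounded_exponentsD(4)[OF that, of x] by (intro divide_ennreal) auto
      then show ?thesis by (simp add: bounded_exponentsD(8)[OF that])
    qed
    have "(\<Sum>i\<in>I. 1 / q i x) = (\<Sum>i\<in>I. ennreal (1 / enn2real (q i x)))"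
      by (intro sum.cong inv q refl)
    also have "\<dots> = ennreal (\<Sum>i\<in>I. 1 / enn2real (q i x))"
      by (rule sum_ennreal) simp
    finally have "ennreal (\<Sum>i\<in>I. 1 / enn2real (q i x)) = ennreal (1 / enn2real (q0 x))"
      using sum[of x] inv[OF q(2)] by simp
    then show ?thesis by (subst (asm) ennreal_inj) (auto intro!: sum_nonneg)
  qed
  have "0 < (\<Prod>i\<in>I. \<eta> i)" using \<eta> by (rule prod_pos)
  have "modular (\<lambda>x. enn2real (q0 x)) (\<lambda>x. \<Prod>i\<in>I. u i x / \<eta> i)
      \<le> (\<Sum>i\<in>I. modular (\<lambda>x. enn2real (q i x)) (\<lambda>x. u i x / \<eta> i))"
  proof (rule modular_prod_le_sum[OF I])
    show "0 \<le> u i x / \<eta> i" if "i \<in> I" for i x using u(1) \<eta> that by (simp add: less_imp_le)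
    show "0 < enn2real (q i x)" if "i \<in> I" for i x using Qi(4)[OF that, of x] by simp
    show "0 < enn2real (q0 x)" for x using Q0(4)[of x] by simp
    show "(\<lambda>x. u i x / \<eta> i) \<in> borel_measurable lebesgue" if "i \<in> I" for i using u(2)[OF that] by simp
    show "(\<lambda>x. enn2real (q i x)) \<in> borel_measurable lebesgue" if "i \<in> I" for i using Qi(1)[OF that] by simp
  qed (rule sum')
  also have "\<dots> \<le> (\<Sum>i\<in>I. 2)"
    by (intro sum_mono mod)
  also have "\<dots> = ennreal (2 * card I)"
    by (simp add: ennreal_mult' mult.commute flip: ennreal_of_nat_eq_real_of_nat)
  finally have "modular (\<lambda>x. enn2real (q0 x)) (\<lambda>x. norm (complex_of_real (\<phi> * (\<Prod>i\<in>I. u i x))) / (\<phi> * (\<Prod>i\<in>I. \<eta> i))) \<le> ennreal (2 * card I)"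
    using \<open>0 < \<phi>\<close> u(1) by (simp add: prod_dividef norm_mult abs_prod prod_nonneg del: of_real_mult of_real_prod)
  then have "lp_norm q0 (\<lambda>x. complex_of_real (\<phi> * (\<Prod>i\<in>I. u i x))) \<le> ennreal (2 * card I * (\<phi> * (\<Prod>i\<in>I. \<eta> i)))"
  proof (rule lp_norm_le_of_modular[rotated 6])
    show "1 \<le> real (2 * card I)"
      using I card_0_eq[of I] by (cases "card I") auto
    have [measurable]: "(\<lambda>x. \<Prod>i\<in>I. u i x) \<in> borel_measurable lebesgue"
      by (rule borel_measurable_prod) (rule u(2))
    show "(\<lambda>x. complex_of_real (\<phi> * (\<Prod>i\<in>I. u i x))) \<in> borel_measurable lebesgue"
      by measurable
  qed (use Q0 \<open>0 < \<phi>\<close> \<open>0 < (\<Prod>i\<in>I. \<eta> i)\<close> in auto)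
  then show ?thesis by (simp add: ac_simps)
qed

section \<open>The estimate of one slice\<close>

text \<open>
  The Hoelder inequality combined with the estimates of the factors. The right-hand side is arranged as a constant
  depending on \<open>k\<close> and on the norms of the functions times the value at one point of the integrand of \<open>C3\<close>.
\<close>

lemma slice_norm_le:
  fixes A :: "'i \<Rightarrow> real^'n^'n" and q :: "'i \<Rightarrow> real^'n \<Rightarrow> ennreal" and q0 :: "real^'n \<Rightarrow> ennreal"
    and f :: "'i \<Rightarrow> real^'n \<Rightarrow> complex" and lam a b c P \<gamma> :: "'i \<Rightarrow> real" and \<theta> :: int
  defines "S1 \<equiv> \<lambda>i. max (norm (A i) powr (lam i - a i)) (norm (A i) powr (lam i - b i))"
    and "S2 \<equiv> \<lambda>i. max (\<Sum>r\<in>{\<theta> - 1..0}. 2 powr (of_int r * (lam i - a i))) (\<Sum>r\<in>{\<theta> - 1..0}. 2 powr (of_int r * (lam i - b i)))"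
  assumes I: "finite I" "I \<noteq> {}"
    and A: "\<And>i. i \<in> I \<Longrightarrow> invertible (A i)"
    and q: "\<And>i. i \<in> I \<Longrightarrow> q i \<in> bounded_exponents" "q0 \<in> bounded_exponents"
    and sum: "\<And>x. (\<Sum>i\<in>I. 1 / q i x) = 1 / q0 x" and \<zeta>: "0 < \<zeta>"
    and qle: "\<And>i x. i \<in> I \<Longrightarrow> q i (matrix_inv (A i) *v x) \<le> ennreal \<zeta> * q i x"
    and N: "\<And>i. i \<in> I \<Longrightarrow> lp_norm (r_exponent (q i) \<zeta> (matrix_inv (A i))) (\<lambda>_. 1) < top"
    and f: "\<And>i. i \<in> I \<Longrightarrow> f i \<in> borel_measurable lebesgue" and \<alpha>: "\<And>i. i \<in> I \<Longrightarrow> \<alpha> i \<in> borel_measurable lebesgue"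
    and P: "\<And>i. i \<in> I \<Longrightarrow> 0 \<le> P i"
      "\<And>i j. i \<in> I \<Longrightarrow> lp_norm_weighted (\<lambda>x. ennreal \<zeta> * q i x) (\<lambda>x. norm x powr \<gamma> i)
        (\<lambda>x. complex_of_real (2 powr (of_int j * \<alpha> i x)) * f i x * indicator (dyadic_annulus j) x)
        \<le> ennreal (2 powr (of_int j * lam i) * P i)"
    and c: "\<And>i. i \<in> I \<Longrightarrow> 0 < c i" "\<And>i k j x z. i \<in> I \<Longrightarrow> x \<in> dyadic_annulus k \<Longrightarrow> z \<in> dyadic_annulus j \<Longrightarrow>
      2 powr (of_int k * \<alpha> i x) \<le> c i * max (2 powr (of_int (k - j) * a i)) (2 powr (of_int (k - j) * b i)) * 2 powr (of_int j * \<alpha> i z)"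
    and \<theta>: "\<And>i. i \<in> I \<Longrightarrow> norm (A i) * norm (matrix_inv (A i)) \<le> 2 powr (- of_int \<theta>)"
    and \<phi>: "0 \<le> \<phi>"
  shows "lp_norm q0 (\<lambda>x. complex_of_real (\<phi> * (\<Prod>i\<in>I.
        2 powr (of_int k * \<alpha> i x) * norm x powr \<gamma> i * indicator (dyadic_annulus k) x * norm (f i (A i *v x)))))
    \<le> ennreal (2 * card I * (\<Prod>i\<in>I. c i * (2 * 2 powr (\<bar>lam i - a i\<bar> + \<bar>lam i - b i\<bar>))) *
          2 powr (of_int k * (\<Sum>i\<in>I. lam i)) * (\<Prod>i\<in>I. P i)) *
      (ennreal \<phi> * (\<Prod>i\<in>I. ennreal (c_factor (A i) (q i) (\<gamma> i)) *
          lp_norm (r_exponent (q i) \<zeta> (matrix_inv (A i))) (\<lambda>_. 1) * ennreal (S1 i) * ennreal (S2 i)))"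
proof -
  define n where "n i = enn2real (lp_norm (r_exponent (q i) \<zeta> (matrix_inv (A i))) (\<lambda>_. 1))" for i
  have n: "lp_norm (r_exponent (q i) \<zeta> (matrix_inv (A i))) (\<lambda>_. 1) = ennreal (n i)" "0 \<le> n i" if "i \<in> I" for i
    using N[OF that] by (simp_all add: n_def)
  define S where "S i = (\<Sum>r\<in>{\<theta> - 1..0}. max (2 powr (of_int (\<lceil>log 2 (norm (A i))\<rceil> + r) * (lam i - a i)))
                                       (2 powr (of_int (\<lceil>log 2 (norm (A i))\<rceil> + r) * (lam i - b i))))" for i
  define cf where "cf i = c_factor (A i) (q i) (\<gamma> i)" for i
  define d where "d i = 2 * 2 powr (\<bar>lam i - a i\<bar> + \<bar>lam i - b i\<bar>)" for i
  define u where "u i x = 2 powr (of_int k * \<alpha> i x) * norm x powr \<gamma> i * indicator (dyadic_annulus k) x * norm (f i (A i *v x))" for i x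
  let ?X = "lp_norm q0 (\<lambda>x. complex_of_real (\<phi> * (\<Prod>i\<in>I. u i x)))"
  let ?\<eta> = "\<lambda>\<epsilon> i. c i * cf i * 2 powr (of_int k * lam i) * (P i + \<epsilon>) * S i * (n i + \<epsilon>)"
  have factor: "0 < S i \<and> 0 < cf i \<and> modular (\<lambda>x. enn2real (q i x)) (\<lambda>x. u i x / ?\<eta> \<epsilon> i) \<le> 2"
    if "i \<in> I" "0 < \<epsilon>" for i \<epsilon>
  proof -
    have "ennreal (2 powr (of_int j * lam i) * P i) < ennreal (2 powr (of_int j * lam i) * (P i + \<epsilon>))" for j
      using P(1)[OF that(1)] that(2) by (intro ennreal_lessI) auto
    then have P': "lp_norm_weighted (\<lambda>x. ennreal \<zeta> * q i x) (\<lambda>x. norm x powr \<gamma> i)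
        (\<lambda>x. complex_of_real (2 powr (of_int j * \<alpha> i x)) * f i x * indicator (dyadic_annulus j) x)
        < ennreal (2 powr (of_int j * lam i) * (P i + \<epsilon>))" for j
      using P(2)[OF that(1), of j] by (rule le_less_trans[rotated])
    have n': "lp_norm (r_exponent (q i) \<zeta> (matrix_inv (A i))) (\<lambda>_. 1) < ennreal (n i + \<epsilon>)"
      unfolding n(1)[OF that(1)] using n(2)[OF that(1)] that(2) by (intro ennreal_lessI) auto
    have "0 < P i + \<epsilon>" using P(1)[OF that(1)] that(2) by simp
    note * = modular_factor_le[OF A[OF that(1)] q(1)[OF that(1)] \<zeta> qle[OF that(1)] f[OF that(1)] \<alpha>[OF that(1)]
        this P' n' c(1)[OF that(1)] c(2)[OF that(1)] \<theta>[OF that(1)]]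
    show ?thesis
      unfolding S_def cf_def u_def using *(1,3) *(4)[of k] by blast
  qed
  have meas: "u i \<in> borel_measurable lebesgue" if "i \<in> I" for i
  proof -
    have [measurable]: "(\<lambda>x. f i (A i *v x)) \<in> borel_measurable lebesgue"
      using measurable_comp[OF measurable_matrix_lebesgue[OF det_matrix_inv(1)[OF A[OF that]]] f[OF that]]
      by (simp add: comp_def)
    have [measurable]: "\<alpha> i \<in> borel_measurable lebesgue" by (rule \<alpha>[OF that])
    show ?thesis unfolding u_def by measurable
  qed
  have bound: "?X \<le> ennreal (\<phi> * (2 * card I) * (\<Prod>i\<in>I. ?\<eta> \<epsilon> i))" if "0 < \<epsilon>" for \<epsilon>
  proof (rule lp_norm_prod_le[OF I q sum _ meas _ _ \<phi>])
    show "0 \<le> u i x" for i x by (simp add: u_def)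
    show "0 < ?\<eta> \<epsilon> i" if "i \<in> I" for i
      using factor[OF that \<open>0 < \<epsilon>\<close>] c(1)[OF that] P(1)[OF that] n(2)[OF that] \<open>0 < \<epsilon>\<close>
      by (intro mult_pos_pos) (auto intro: add_nonneg_pos)
    show "modular (\<lambda>x. enn2real (q i x)) (\<lambda>x. u i x / ?\<eta> \<epsilon> i) \<le> 2" if "i \<in> I" for i
      using factor[OF that \<open>0 < \<epsilon>\<close>] by blast
  qed
  \<comment> \<open>The estimate of a factor requires numbers strictly above the norms, which moreover may vanish; hence the
    room \<open>\<epsilon>\<close>, which now tends to \<open>0\<close>.\<close>
  have "((\<lambda>\<epsilon>. ennreal (\<phi> * (2 * card I) * (\<Prod>i\<in>I. ?\<eta> \<epsilon> i))) \<longlongrightarrow> ennreal (\<phi> * (2 * card I) * (\<Prod>i\<in>I. ?\<eta> 0 i))) (at_right 0)"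
    by (intro tendsto_ennrealI tendsto_intros)
  moreover have "eventually (\<lambda>\<epsilon>. ?X \<le> ennreal (\<phi> * (2 * card I) * (\<Prod>i\<in>I. ?\<eta> \<epsilon> i))) (at_right 0)"
    using eventually_at_right_less[of 0] by eventually_elim (rule bound)
  ultimately have "?X \<le> ennreal (\<phi> * (2 * card I) * (\<Prod>i\<in>I. ?\<eta> 0 i))"
    by (rule tendsto_lowerbound) simp
  also have "\<dots> \<le> ennreal (\<phi> * (2 * card I) * (\<Prod>i\<in>I. (c i * d i) * 2 powr (of_int k * lam i) * P i * (cf i * n i * S1 i * S2 i)))"
  proof (intro ennreal_leI mult_left_mono prod_mono conjI)
    fix i assume i: "i \<in> I"
    have S: "S i \<le> d i * S1 i * S2 i"
      unfolding S_def d_def S1_def S2_def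
      by (rule shifted_geometric_sum_le) (use norm_pos_of_invertible[OF A[OF i]] in auto)
    have pos: "0 \<le> c i * cf i * 2 powr (of_int k * lam i) * (P i + 0)" "0 \<le> S i" "0 \<le> n i"
      using factor[OF i zero_less_one] c(1)[OF i] P(1)[OF i] n(2)[OF i] by auto
    then show "0 \<le> ?\<eta> 0 i" by (metis add.right_neutral mult_nonneg_nonneg)
    have "?\<eta> 0 i \<le> c i * cf i * 2 powr (of_int k * lam i) * (P i + 0) * (d i * S1 i * S2 i) * (n i + 0)"
      using pos by (intro mult_right_mono mult_left_mono S) auto
    also have "\<dots> = (c i * d i) * 2 powr (of_int k * lam i) * P i * (cf i * n i * S1 i * S2 i)"
      by (simp add: ac_simps)
    finally show "?\<eta> 0 i \<le> (c i * d i) * 2 powr (of_int k * lam i) * P i * (cf i * n i * S1 i * S2 i)" .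
  qed (use \<phi> in auto)
  also have "\<phi> * (2 * card I) * (\<Prod>i\<in>I. (c i * d i) * 2 powr (of_int k * lam i) * P i * (cf i * n i * S1 i * S2 i))
     = (2 * card I * (\<Prod>i\<in>I. c i * d i) * 2 powr (of_int k * (\<Sum>i\<in>I. lam i)) * (\<Prod>i\<in>I. P i)) *
        (\<phi> * (\<Prod>i\<in>I. cf i * n i * S1 i * S2 i))"
  proof -
    have "(\<Prod>i\<in>I. 2 powr (of_int k * lam i)) = 2 powr (of_int k * (\<Sum>i\<in>I. lam i))"
      unfolding sum_distrib_left by (rule powr_sum[symmetric]) (use I in auto)
    then show ?thesis by (simp add: prod.distrib)
  qed
  also have "ennreal \<dots> = ennreal (2 * card I * (\<Prod>i\<in>I. c i * d i) * 2 powr (of_int k * (\<Sum>i\<in>I. lam i)) * (\<Prod>i\<in>I. P i)) *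
        (ennreal \<phi> * (\<Prod>i\<in>I. ennreal (cf i) * lp_norm (r_exponent (q i) \<zeta> (matrix_inv (A i))) (\<lambda>_. 1) * ennreal (S1 i) * ennreal (S2 i)))"
  proof -
    have S: "0 \<le> S1 i" "0 \<le> S2 i" for i by (auto simp: S1_def S2_def le_max_iff_disj intro: sum_nonneg)
    have cd: "0 \<le> c i * d i" if "i \<in> I" for i using c(1)[OF that] by (simp add: d_def)
    have cf0: "0 \<le> cf i" if "i \<in> I" for i using factor[OF that zero_less_one] by simp
    have e: "ennreal (cf i * n i * S1 i * S2 i) = ennreal (cf i) * lp_norm (r_exponent (q i) \<zeta> (matrix_inv (A i))) (\<lambda>_. 1) * ennreal (S1 i) * ennreal (S2 i)"
      if "i \<in> I" for i
      using S cf0[OF that] n[OF that] by (simp add: ennreal_mult)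
    have "ennreal (\<Prod>i\<in>I. cf i * n i * S1 i * S2 i)
        = (\<Prod>i\<in>I. ennreal (cf i * n i * S1 i * S2 i))"
      by (rule prod_ennreal[symmetric]) (use S cf0 n in simp)
    also have "\<dots> = (\<Prod>i\<in>I. ennreal (cf i) * lp_norm (r_exponent (q i) \<zeta> (matrix_inv (A i))) (\<lambda>_. 1) * ennreal (S1 i) * ennreal (S2 i))"
      by (rule prod.cong[OF refl e])
    finally show ?thesis
      using cd P(1) \<phi> by (subst ennreal_mult') (simp_all add: prod_nonneg ennreal_mult')
  qed
  finally show ?thesis unfolding u_def cf_def d_def .
qed

section \<open>Morrey--Herz norms\<close>

lemma ennreal_powr_mono: "x \<le> y \<Longrightarrow> 0 \<le> p \<Longrightarrow> ennreal_powr x p \<le> ennreal_powr y p"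
  unfolding ennreal_powr_def
  by (auto simp: top_unique less_top intro!: ennreal_leI powr_mono2 enn2real_mono)

lemma ennreal_powr_inverse: "0 < p \<Longrightarrow> ennreal_powr (ennreal_powr x p) (1 / p) = x"
  by (cases x) (auto simp: ennreal_powr_def powr_powr)

lemma ennreal_powr_ennreal: "0 \<le> x \<Longrightarrow> ennreal_powr (ennreal x) p = ennreal (x powr p)"
  by (simp add: ennreal_powr_def)

lemma morrey_herz_norm_annulus:
  assumes "0 < p"
  shows "lp_norm_weighted q \<omega> (\<lambda>x. complex_of_real (2 powr (of_int j * \<alpha> x)) * f x * indicator (dyadic_annulus j) x)
    \<le> ennreal (2 powr (of_int j * lam)) * morrey_herz_norm \<alpha> lam p q \<omega> f"
proof -
  define X where "X k = lp_norm_weighted q \<omega> (\<lambda>x. complex_of_real (2 powr (of_int k * \<alpha> x)) * f x * indicator (dyadic_annulus k) x)" for k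
  have "ennreal_powr (X j) p = (\<Sum>\<^sub>\<infinity>k\<in>{j}. ennreal_powr (X k) p)" by simp
  also have "\<dots> \<le> (\<Sum>\<^sub>\<infinity>k\<in>{..j}. ennreal_powr (X k) p)"
    by (rule infsum_mono_neutral) (auto intro: nonneg_summable_on_complete)
  finally have "X j \<le> ennreal_powr (\<Sum>\<^sub>\<infinity>k\<in>{..j}. ennreal_powr (X k) p) (1 / p)"
    using ennreal_powr_mono[of "ennreal_powr (X j) p" _ "1 / p"] \<open>0 < p\<close> by (simp add: ennreal_powr_inverse)
  then have "ennreal (2 powr (- of_int j * lam)) * X j
      \<le> ennreal (2 powr (- of_int j * lam)) * ennreal_powr (\<Sum>\<^sub>\<infinity>k\<in>{..j}. ennreal_powr (X k) p) (1 / p)"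
    by (rule mult_left_mono) simp
  also have "\<dots> \<le> morrey_herz_norm \<alpha> lam p q \<omega> f"
    unfolding morrey_herz_norm_def X_def by (rule SUP_upper) simp
  finally have "ennreal (2 powr (of_int j * lam)) * (ennreal (2 powr (- of_int j * lam)) * X j)
      \<le> ennreal (2 powr (of_int j * lam)) * morrey_herz_norm \<alpha> lam p q \<omega> f"
    by (rule mult_left_mono) simp
  also have "ennreal (2 powr (of_int j * lam)) * (ennreal (2 powr (- of_int j * lam)) * X j) = X j"
    by (simp add: mult.assoc[symmetric] powr_add[symmetric] flip: ennreal_mult')
  finally show ?thesis by (simp add: X_def)
qed

lemma sum_powr_int_le:
  fixes s :: real
  assumes "0 < s" "finite F" "F \<subseteq> {..k0::int}"
  shows "(\<Sum>k\<in>F. 2 powr (of_int k * s)) \<le> 2 powr (of_int k0 * s) / (1 - 2 powr (- s))"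
proof -
  have q: "0 \<le> 2 powr (- s)" "2 powr (- s) < 1"
    using assms(1) powr_less_mono[of "- s" 0 2] by auto
  have inj: "inj_on (\<lambda>k. nat (k0 - k)) F"
  proof (rule inj_onI)
    fix x y assume "x \<in> F" "y \<in> F" "nat (k0 - x) = nat (k0 - y)"
    moreover have "x \<le> k0" "y \<le> k0" using assms(3) \<open>x \<in> F\<close> \<open>y \<in> F\<close> by auto
    ultimately show "x = y" by (simp add: eq_nat_nat_iff)
  qed
  have "(\<Sum>k\<in>F. 2 powr (of_int k * s)) = (\<Sum>k\<in>F. 2 powr (of_int k0 * s) * (2 powr (- s)) ^ nat (k0 - k))"
  proof (rule sum.cong[OF refl])
    fix k assume "k \<in> F"
    then have "real (nat (k0 - k)) = of_int k0 - of_int k" using assms(3) by auto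
    then have "(2 powr (- s)) ^ nat (k0 - k) = 2 powr (- s * (of_int k0 - of_int k))"
      by (simp add: powr_realpow[symmetric] powr_powr)
    then show "2 powr (of_int k * s) = 2 powr (of_int k0 * s) * (2 powr (- s)) ^ nat (k0 - k)"
      by (simp add: powr_add[symmetric] algebra_simps)
  qed
  also have "\<dots> = 2 powr (of_int k0 * s) * (\<Sum>n\<in>(\<lambda>k. nat (k0 - k)) ` F. (2 powr (- s)) ^ n)"
    by (simp add: sum.reindex[OF inj] sum_distrib_left)
  also have "\<dots> \<le> 2 powr (of_int k0 * s) * (\<Sum>n. (2 powr (- s)) ^ n)"
    using assms(2) q by (intro mult_left_mono sum_le_suminf) auto
  also have "\<dots> = 2 powr (of_int k0 * s) / (1 - 2 powr (- s))"
    using q by (simp add: suminf_geometric)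
  finally show ?thesis .
qed

text \<open>
  Because \<open>lam > 0\<close>, a bound proportional to \<open>2 powr (k * lam)\<close> on each annulus controls the whole norm, and
  the summation exponent \<open>p\<close> only enters the constant.
\<close>

lemma morrey_herz_norm_le:
  assumes "0 < p" "0 < lam" "0 \<le> Q"
    and X: "\<And>k. lp_norm_weighted q \<omega> (\<lambda>x. complex_of_real (2 powr (of_int k * \<alpha> x)) * f x * indicator (dyadic_annulus k) x)
      \<le> ennreal (2 powr (of_int k * lam) * Q)"
  shows "morrey_herz_norm \<alpha> lam p q \<omega> f \<le> ennreal ((1 / (1 - 2 powr (- (lam * p)))) powr (1 / p) * Q)"
  unfolding morrey_herz_norm_def
proof (rule SUP_least)
  fix k0 :: int
  define g where "g = 1 / (1 - 2 powr (- (lam * p)))"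
  have "0 \<le> g" using assms(1,2) powr_less_mono[of "- (lam * p)" 0 2] by (simp add: g_def)
  let ?Y = "\<lambda>k. ennreal_powr (lp_norm_weighted q \<omega> (\<lambda>x. complex_of_real (2 powr (of_int k * \<alpha> x)) * f x * indicator (dyadic_annulus k) x)) p"
  have "(\<Sum>\<^sub>\<infinity>k\<in>{..k0}. ?Y k) \<le> ennreal (2 powr (of_int k0 * (lam * p)) * g * Q powr p)"
  proof (rule infsum_le_finite_sums)
    show "?Y summable_on {..k0}" by (intro nonneg_summable_on_complete) simp
    fix F assume F: "finite F" "F \<subseteq> {..k0}"
    have "sum ?Y F \<le> (\<Sum>k\<in>F. ennreal (2 powr (of_int k * (lam * p)) * Q powr p))"
    proof (rule sum_mono)
      fix k
      have "?Y k \<le> ennreal_powr (ennreal (2 powr (of_int k * lam) * Q)) p"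
        using assms(1) by (intro ennreal_powr_mono X) auto
      also have "\<dots> = ennreal (2 powr (of_int k * (lam * p)) * Q powr p)"
        using assms(3) by (simp add: ennreal_powr_ennreal powr_mult powr_powr mult.assoc)
      finally show "?Y k \<le> ennreal (2 powr (of_int k * (lam * p)) * Q powr p)" .
    qed
    also have "\<dots> = ennreal ((\<Sum>k\<in>F. 2 powr (of_int k * (lam * p))) * Q powr p)"
      by (simp add: sum_ennreal sum_distrib_right)
    also have "\<dots> \<le> ennreal (2 powr (of_int k0 * (lam * p)) * g * Q powr p)"
      using sum_powr_int_le[of "lam * p", OF _ F] assms(1,2)
      by (intro ennreal_leI mult_right_mono) (auto simp: g_def)
    finally show "sum ?Y F \<le> ennreal (2 powr (of_int k0 * (lam * p)) * g * Q powr p)" .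
  qed
  then have "ennreal_powr (\<Sum>\<^sub>\<infinity>k\<in>{..k0}. ?Y k) (1 / p) \<le> ennreal_powr (ennreal (2 powr (of_int k0 * (lam * p)) * g * Q powr p)) (1 / p)"
    using assms(1) by (intro ennreal_powr_mono) auto
  also have "\<dots> = ennreal (2 powr (of_int k0 * lam) * g powr (1 / p) * Q)"
    using assms(1,3) \<open>0 \<le> g\<close> by (simp add: ennreal_powr_ennreal powr_mult powr_powr)
  finally have "ennreal (2 powr (- of_int k0 * lam)) * ennreal_powr (\<Sum>\<^sub>\<infinity>k\<in>{..k0}. ?Y k) (1 / p)
     \<le> ennreal (2 powr (- of_int k0 * lam)) * ennreal (2 powr (of_int k0 * lam) * g powr (1 / p) * Q)"
    by (rule mult_left_mono) simp
  also have "\<dots> = ennreal ((2 powr (- of_int k0 * lam) * 2 powr (of_int k0 * lam)) * (g powr (1 / p) * Q))"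
    by (simp add: mult.assoc flip: ennreal_mult')
  also have "2 powr (- of_int k0 * lam) * 2 powr (of_int k0 * lam) = 1"
    by (simp add: powr_add[symmetric])
  finally show "ennreal (2 powr (- of_int k0 * lam)) * ennreal_powr (\<Sum>\<^sub>\<infinity>k\<in>{..k0}. ?Y k) (1 / p)
      \<le> ennreal ((1 / (1 - 2 powr (- (lam * p)))) powr (1 / p) * Q)"
    by (simp add: g_def)
qed

lemma Theta_greatest:
  fixes A :: "nat \<Rightarrow> real^'n \<Rightarrow> real^'n^'n"
  assumes inv: "\<And>i. i \<in> {1..m} \<Longrightarrow> invertible (A i t)" and i: "i \<in> {1..m}"
  shows "norm (A i t) * norm (matrix_inv (A i t)) < 2 powr (- of_int (Theta m A t))"
proof -
  define X where "X = Max ((\<lambda>i. norm (A i t) * norm (matrix_inv (A i t))) ` {1..m})"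
  have X: "norm (A i t) * norm (matrix_inv (A i t)) \<le> X"
    unfolding X_def using i by (intro Max_ge) auto
  have "0 < X"
    using X norm_pos_of_invertible[OF inv[OF i]] by (smt (verit) mult_pos_pos)
  have iff: "X < 2 powr (- of_int \<theta>) \<longleftrightarrow> \<theta> \<le> \<lceil>- log 2 X\<rceil> - 1" for \<theta> :: int
  proof -
    have "X < 2 powr (- of_int \<theta>) \<longleftrightarrow> log 2 X < - of_int \<theta>"
      using \<open>0 < X\<close> by (simp add: log_less_iff)
    also have "\<dots> \<longleftrightarrow> \<theta> \<le> \<lceil>- log 2 X\<rceil> - 1" by linarith
    finally show ?thesis .
  qed
  have "Theta m A t = \<lceil>- log 2 X\<rceil> - 1"
    unfolding Theta_def X_def[symmetric] iff by (rule Greatest_equality) auto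
  then have "X < 2 powr (- of_int (Theta m A t))" unfolding iff by simp
  with X show ?thesis by simp
qed

section \<open>Measurability of the integrand\<close>

lemma borel_version_complex:
  fixes f :: "'a::euclidean_space \<Rightarrow> complex"
  assumes [measurable]: "f \<in> borel_measurable lebesgue"
  obtains g N where "g \<in> borel_measurable borel" "N \<in> null_sets lborel" "{x. f x \<noteq> g x} \<subseteq> N"
proof -
  have "(\<lambda>x. Re (f x)) \<in> borel_measurable lebesgue" "(\<lambda>x. Im (f x)) \<in> borel_measurable lebesgue"
    by measurable
  then obtain a b where ab: "a \<in> borel_measurable lborel" "AE x in lborel. Re (f x) = a x"
      "b \<in> borel_measurable lborel" "AE x in lborel. Im (f x) = b x"
    using completion_ex_borel_measurable_real[of "\<lambda>x. Re (f x)" lborel]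
      completion_ex_borel_measurable_real[of "\<lambda>x. Im (f x)" lborel] by blast
  have "AE x in lborel. f x = Complex (a x) (b x)"
    using ab(2,4) by eventually_elim (simp add: complex_eq_iff)
  then obtain N where N: "N \<in> null_sets lborel" "{x. f x \<noteq> Complex (a x) (b x)} \<subseteq> N"
    by (auto simp: eventually_ae_filter)
  have "(\<lambda>x. Complex (a x) (b x)) \<in> borel_measurable borel"
    unfolding Complex_eq using ab(1,3) by simp
  then show ?thesis using N by (rule that)
qed

text \<open>
  A composition of a Lebesgue measurable function with \<open>(x, t) \<mapsto> A t x\<close> may fail to be measurable. Replacing
  the function by a Borel one changes the integrand only where \<open>A t x\<close> hits a null set, and since \<open>A t\<close>
  is invertible this happens, for each \<open>t\<close>, on a null set of \<open>x\<close>.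
\<close>

lemma measurable_version_of_integrand:
  fixes A :: "nat \<Rightarrow> real^'n \<Rightarrow> real^'n^'n" and f :: "nat \<Rightarrow> real^'n \<Rightarrow> complex"
  assumes [measurable]: "\<Phi> \<in> borel_measurable lebesgue"
    and A: "\<And>i. i \<in> {1..m} \<Longrightarrow> A i \<in> borel_measurable lebesgue"
    and inv: "AE t in lebesgue. \<Phi> t \<noteq> 0 \<longrightarrow> (\<forall>i\<in>{1..m}. invertible (A i t))"
    and f: "\<And>i. i \<in> {1..m} \<Longrightarrow> f i \<in> borel_measurable lebesgue"
  obtains G where "(\<lambda>(x, t). G x t) \<in> borel_measurable (lebesgue \<Otimes>\<^sub>M lebesgue)"
    "AE t in lebesgue. AE x in lebesgue. hausdorff_integrand m \<Phi> A f x t = G x t"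
    "AE x in lebesgue. AE t in lebesgue. hausdorff_integrand m \<Phi> A f x t = G x t"
proof -
  interpret L: sigma_finite_measure "lebesgue :: (real^'n) measure" by (rule sigma_finite_lebesgue)
  interpret P: pair_sigma_finite "lebesgue :: (real^'n) measure" "lebesgue :: (real^'n) measure" ..
  have "\<forall>i\<in>{1..m}. \<exists>g N. g \<in> borel_measurable borel \<and> N \<in> null_sets lborel \<and> {x. f i x \<noteq> g x} \<subseteq> N"
    using borel_version_complex[OF f] by metis
  then obtain g N where gN: "\<And>i. i \<in> {1..m} \<Longrightarrow> g i \<in> borel_measurable borel"
      "\<And>i. i \<in> {1..m} \<Longrightarrow> N i \<in> null_sets lborel" "\<And>i. i \<in> {1..m} \<Longrightarrow> {x. f i x \<noteq> g i x} \<subseteq> N i"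
    by metis
  define G where "G x t = hausdorff_integrand m \<Phi> A g x t" for x t
  have id: "(\<lambda>x::real^'n. x) \<in> borel_measurable lebesgue"
    by (rule measurable_completion) simp
  have cont: "continuous_on UNIV (\<lambda>p::(real^'n^'n) \<times> (real^'n). fst p *v snd p)"
    unfolding matrix_vector_mult_def by (intro continuous_intros)
  have Ax: "(\<lambda>p. A i (snd p) *v fst p) \<in> borel_measurable (lebesgue \<Otimes>\<^sub>M lebesgue)" if "i \<in> {1..m}" for i
  proof (rule borel_measurable_continuous_Pair[OF _ _ cont])
    show "(\<lambda>p. A i (snd p)) \<in> borel_measurable (lebesgue \<Otimes>\<^sub>M lebesgue)"
      by (rule measurable_compose[OF measurable_snd A[OF that]])
    show "(\<lambda>p::(real^'n) \<times> (real^'n). fst p) \<in> borel_measurable (lebesgue \<Otimes>\<^sub>M lebesgue)"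
      using measurable_compose[OF measurable_fst[of lebesgue lebesgue] id] by simp
  qed
  have "(\<lambda>p. G (fst p) (snd p)) \<in> borel_measurable (lebesgue \<Otimes>\<^sub>M lebesgue)"
    unfolding G_def hausdorff_integrand_def
  proof (intro borel_measurable_times borel_measurable_prod)
    have [measurable]: "(\<lambda>t::real^'n. norm t) \<in> borel_measurable lebesgue"
      by (rule measurable_completion) simp
    have "(\<lambda>t. complex_of_real (\<Phi> t / norm t ^ CARD('n))) \<in> borel_measurable lebesgue"
      by measurable
    from measurable_compose[OF measurable_snd this]
    show "(\<lambda>p::(real^'n) \<times> (real^'n). complex_of_real (\<Phi> (snd p) / norm (snd p) ^ CARD('n))) \<in> borel_measurable (lebesgue \<Otimes>\<^sub>M lebesgue)" .
    show "(\<lambda>p. g i (A i (snd p) *v fst p)) \<in> borel_measurable (lebesgue \<Otimes>\<^sub>M lebesgue)" if "i \<in> {1..m}" for i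
      by (rule measurable_compose[OF Ax[OF that] gN(1)[OF that]])
  qed
  then have meas: "(\<lambda>(x, t). G x t) \<in> borel_measurable (lebesgue \<Otimes>\<^sub>M lebesgue)"
    by (simp add: case_prod_beta')
  obtain T where T: "T \<in> null_sets lebesgue" "{t. \<not> (\<Phi> t \<noteq> 0 \<longrightarrow> (\<forall>i\<in>{1..m}. invertible (A i t)))} \<subseteq> T"
    using inv by (auto simp: completion.AE_iff_null_sets)
  define Q where "Q x t \<longleftrightarrow> (t \<notin> T \<and> \<Phi> t \<noteq> 0 \<longrightarrow> (\<forall>i\<in>{1..m}. A i t *v x \<notin> N i))" for x t
  have eq: "hausdorff_integrand m \<Phi> A f x t = G x t" if "Q x t" "t \<notin> T" for x t
  proof (cases "\<Phi> t = 0")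
    case False
    then have "f i (A i t *v x) = g i (A i t *v x)" if "i \<in> {1..m}" for i
      using gN(3)[OF that] \<open>Q x t\<close> \<open>t \<notin> T\<close> that by (auto simp: Q_def)
    then show ?thesis by (simp add: G_def hausdorff_integrand_def)
  qed (simp add: G_def hausdorff_integrand_def)
  have Qx: "AE x in lebesgue. Q x t" for t
  proof (cases "t \<notin> T \<and> \<Phi> t \<noteq> 0")
    case True
    have "AE x in lebesgue. A i t *v x \<notin> N i" if "i \<in> {1..m}" for i
    proof (rule AE_lebesgue_matrix)
      have "invertible (A i t)" using True T(2) that by blast
      then show "det (A i t) \<noteq> 0" by (rule det_matrix_inv(1))
      show "AE x in lebesgue. x \<notin> N i"
        using gN(2)[OF that] by (intro AE_completion AE_not_in)
    qed
    then have "AE x in lebesgue. \<forall>i\<in>{1..m}. A i t *v x \<notin> N i"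
      by (intro AE_finite_allI) auto
    then show ?thesis by eventually_elim (simp add: Q_def)
  qed (auto simp: Q_def)
  have Qm: "{p \<in> space (lebesgue \<Otimes>\<^sub>M lebesgue). Q (fst p) (snd p)} \<in> sets (lebesgue \<Otimes>\<^sub>M lebesgue)"
  proof -
    have [measurable]: "Measurable.pred (lebesgue \<Otimes>\<^sub>M lebesgue) (\<lambda>p. A i (snd p) *v fst p \<notin> N i)" if "i \<in> {1..m}" for i
    proof -
      have "N i \<in> sets borel" using gN(2)[OF that] by (simp add: null_sets_def)
      from measurable_sets[OF Ax[OF that] this] show ?thesis
        by (simp add: pred_def vimage_def Int_def conj_commute)
    qed
    have [measurable]: "T \<in> sets lebesgue" using T by auto
    show ?thesis unfolding Q_def by measurable
  qed
  have "AE t in lebesgue. AE x in lebesgue. Q x t"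
    using Qx by simp
  then have Qt: "AE x in lebesgue. AE t in lebesgue. Q x t"
    by (subst P.AE_commute[OF Qm])
  have T': "AE t in lebesgue. t \<notin> T" by (rule AE_not_in[OF T(1)])
  show ?thesis
  proof (rule that[OF meas])
    show "AE t in lebesgue. AE x in lebesgue. hausdorff_integrand m \<Phi> A f x t = G x t"
      using T'
    proof eventually_elim
      case (elim t)
      show ?case using Qx[of t] by eventually_elim (rule eq[OF _ elim])
    qed
    show "AE x in lebesgue. AE t in lebesgue. hausdorff_integrand m \<Phi> A f x t = G x t"
      using Qt
    proof eventually_elim
      case (elim x)
      show ?case using elim T' by eventually_elim (rule eq)
    qed
  qed
qed

section \<open>The integral operator\<close>

text \<open>
  When \<open>D\<close> is not measurable, its integral is the supremum over the simple functions below it, and a simple function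
  below \<open>c * D\<close> can be divided by \<open>c\<close>.
\<close>

lemma nn_integral_cmult_le:
  "(\<integral>\<^sup>+x. ennreal c * D x \<partial>M) \<le> ennreal c * (\<integral>\<^sup>+x. D x \<partial>M)"
proof (cases "c \<le> 0")
  case False
  then have "0 < c" by simp
  show ?thesis
    unfolding nn_integral_def[of M "\<lambda>x. ennreal c * D x"]
  proof (rule SUP_least, clarify)
    fix g assume g: "simple_function M g" "g \<le> (\<lambda>x. ennreal c * D x)"
    have cc: "ennreal c * (ennreal (1 / c) * y) = y" for y
      using \<open>0 < c\<close> by (simp add: mult.assoc[symmetric] flip: ennreal_mult')
    have cc': "ennreal (1 / c) * (ennreal c * y) = y" for y
      using \<open>0 < c\<close> by (simp add: mult.assoc[symmetric] flip: ennreal_mult')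
    have "integral\<^sup>S M g = (\<integral>\<^sup>+x. g x \<partial>M)"
      by (rule nn_integral_eq_simple_integral[OF g(1), symmetric])
    also have "\<dots> = (\<integral>\<^sup>+x. ennreal c * (ennreal (1 / c) * g x) \<partial>M)"
      by (simp add: cc)
    also have "\<dots> = ennreal c * (\<integral>\<^sup>+x. ennreal (1 / c) * g x \<partial>M)"
      by (rule nn_integral_cmult) (use borel_measurable_simple_function[OF g(1)] in measurable)
    also have "\<dots> \<le> ennreal c * (\<integral>\<^sup>+x. D x \<partial>M)"
    proof (intro mult_left_mono nn_integral_mono)
      fix x
      have "ennreal (1 / c) * g x \<le> ennreal (1 / c) * (ennreal c * D x)"
        using g(2) by (intro mult_left_mono) (auto simp: le_fun_def)
      then show "ennreal (1 / c) * g x \<le> D x" by (simp add: cc')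
    qed simp
    finally show "integral\<^sup>S M g \<le> ennreal c * (\<integral>\<^sup>+x. D x \<partial>M)" .
  qed
qed (simp add: ennreal_neg)

text \<open>
  Minkowski's inequality for a kernel that is only known to agree almost everywhere with a measurable one. Where the
  weight is positive, finiteness of the weighted integral gives integrability of the kernel.
\<close>

lemma weighted_integral_bound:
  fixes F G :: "real^'n \<Rightarrow> real^'n \<Rightarrow> complex"
  assumes G: "(\<lambda>(x, t). G x t) \<in> borel_measurable (lebesgue \<Otimes>\<^sub>M lebesgue)"
    and FG: "AE t in lebesgue. AE x in lebesgue. F x t = G x t" "AE x in lebesgue. AE t in lebesgue. F x t = G x t"
    and q: "q \<in> bounded_exponents"
    and v: "\<And>x. 0 \<le> v x" "v \<in> borel_measurable lebesgue"
    and less: "(\<integral>\<^sup>+t. lp_norm q (\<lambda>x. complex_of_real (v x * norm (F x t))) \<partial>lebesgue) < ennreal \<eta>"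
  shows "AE x in lebesgue. 0 < v x \<longrightarrow> integrable lebesgue (F x)"
    and "modular (\<lambda>x. enn2real (q x)) (\<lambda>x. v x * norm (\<integral>t. F x t \<partial>lebesgue) / \<eta>) \<le> 1"
proof -
  note Q = bounded_exponentsD[OF q]
  have "0 < \<eta>"
  proof (rule ccontr)
    assume "\<not> 0 < \<eta>"
    then have "ennreal \<eta> = 0" by (simp add: ennreal_neg)
    with less show False by simp
  qed
  have [measurable]: "(\<lambda>p. G (fst p) (snd p)) \<in> borel_measurable (lebesgue \<Otimes>\<^sub>M lebesgue)"
    using G by (simp add: case_prod_beta')
  have [measurable]: "v \<in> borel_measurable lebesgue" by (rule v)
  have K: "(\<lambda>(x, t). v x * norm (G x t)) \<in> borel_measurable (lebesgue \<Otimes>\<^sub>M lebesgue)"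
    unfolding case_prod_beta' by measurable
  have "(\<integral>\<^sup>+t. lp_norm q (\<lambda>x. complex_of_real (v x * norm (G x t))) \<partial>lebesgue)
      = (\<integral>\<^sup>+t. lp_norm q (\<lambda>x. complex_of_real (v x * norm (F x t))) \<partial>lebesgue)"
  proof (rule nn_integral_cong_AE)
    show "AE t in lebesgue. lp_norm q (\<lambda>x. complex_of_real (v x * norm (G x t))) = lp_norm q (\<lambda>x. complex_of_real (v x * norm (F x t)))"
      using FG(1)
    proof eventually_elim
      case (elim t)
      show ?case
        by (rule lp_norm_cong_AE[OF Q(2)]) (use elim in \<open>eventually_elim, simp\<close>)
    qed
  qed
  then have less': "(\<integral>\<^sup>+t. lp_norm q (\<lambda>x. complex_of_real (v x * norm (G x t))) \<partial>lebesgue) < ennreal \<eta>"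
    using less by simp
  have K0: "0 \<le> v x * norm (G x t)" for x t using v(1)[of x] by simp
  note M = minkowski_integral[OF sigma_finite_lebesgue K0 K Q(2) Q(3) Q(1) less']
  have Gx: "G x \<in> borel_measurable lebesgue" for x
    using measurable_Pair2[OF G, of x] by simp
  have split: "(\<integral>\<^sup>+t. ennreal (v x * norm (G x t)) \<partial>lebesgue) = ennreal (v x) * (\<integral>\<^sup>+t. ennreal (norm (G x t)) \<partial>lebesgue)" for x
    using Gx[of x] v(1)[of x] by (simp add: ennreal_mult' nn_integral_cmult)
  from M have fin: "AE x in lebesgue. (\<integral>\<^sup>+t. ennreal (v x * norm (G x t)) \<partial>lebesgue) < \<infinity>" by blast
  have int: "integrable lebesgue (G x)" if "0 < v x" "(\<integral>\<^sup>+t. ennreal (v x * norm (G x t)) \<partial>lebesgue) < \<infinity>" for x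
  proof (rule integrableI_bounded[OF Gx])
    show "(\<integral>\<^sup>+t. ennreal (norm (G x t)) \<partial>lebesgue) < \<infinity>"
      using that unfolding split by (auto simp: ennreal_mult_less_top ennreal_eq_0_iff)
  qed
  have Fm: "F x \<in> borel_measurable lebesgue" if "AE t in lebesgue. F x t = G x t" for x
    by (rule borel_measurable_AE[OF Gx[of x]]) (use that in \<open>eventually_elim, simp\<close>)
  show "AE x in lebesgue. 0 < v x \<longrightarrow> integrable lebesgue (F x)"
    using fin FG(2)
  proof eventually_elim
    case (elim x)
    show ?case
    proof
      assume "0 < v x"
      from int[OF this elim(1)] show "integrable lebesgue (F x)"
        by (rule integrable_cong_AE_imp[OF _ Fm[OF elim(2)]]) (use elim(2) in \<open>eventually_elim, simp\<close>)
    qed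
  qed
  have "modular (\<lambda>x. enn2real (q x)) (\<lambda>x. v x * norm (\<integral>t. F x t \<partial>lebesgue) / \<eta>)
     \<le> modular (\<lambda>x. enn2real (q x)) (\<lambda>x. enn2real (\<integral>\<^sup>+t. ennreal (v x * norm (G x t)) \<partial>lebesgue) / \<eta>)"
  proof (rule modular_mono)
    show "AE x in lebesgue. 0 \<le> v x * norm (\<integral>t. F x t \<partial>lebesgue) / \<eta> \<and> v x * norm (\<integral>t. F x t \<partial>lebesgue) / \<eta>
        \<le> enn2real (\<integral>\<^sup>+t. ennreal (v x * norm (G x t)) \<partial>lebesgue) / \<eta>"
      using fin FG(2)
    proof eventually_elim
      case (elim x)
      have FGi: "(\<integral>t. F x t \<partial>lebesgue) = (\<integral>t. G x t \<partial>lebesgue)"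
        by (rule integral_cong_AE[OF Fm[OF elim(2)] Gx elim(2)])
      have "v x * norm (\<integral>t. F x t \<partial>lebesgue) \<le> enn2real (\<integral>\<^sup>+t. ennreal (v x * norm (G x t)) \<partial>lebesgue)"
      proof (cases "v x = 0")
        case False
        then have "0 < v x" using v(1)[of x] by simp
        have "ennreal (v x * norm (\<integral>t. F x t \<partial>lebesgue)) = ennreal (v x) * ennreal (norm (\<integral>t. G x t \<partial>lebesgue))"
          using v(1)[of x] by (simp add: FGi ennreal_mult')
        also have "\<dots> \<le> ennreal (v x) * (\<integral>\<^sup>+t. ennreal (norm (G x t)) \<partial>lebesgue)"
          by (intro mult_left_mono integral_norm_bound_ennreal int \<open>0 < v x\<close> elim) simp
        finally have "ennreal (v x * norm (\<integral>t. F x t \<partial>lebesgue)) \<le> (\<integral>\<^sup>+t. ennreal (v x * norm (G x t)) \<partial>lebesgue)"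
          unfolding split .
        then have "enn2real (ennreal (v x * norm (\<integral>t. F x t \<partial>lebesgue))) \<le> enn2real (\<integral>\<^sup>+t. ennreal (v x * norm (G x t)) \<partial>lebesgue)"
          by (rule enn2real_mono) (use elim(1) in simp)
        then show ?thesis using v(1)[of x] by simp
      qed simp
      then show ?case using \<open>0 < \<eta>\<close> v(1)[of x] by (auto intro: divide_right_mono)
    qed
  qed simp
  also have "\<dots> \<le> 1" using M by blast
  finally show "modular (\<lambda>x. enn2real (q x)) (\<lambda>x. v x * norm (\<integral>t. F x t \<partial>lebesgue) / \<eta>) \<le> 1" .
qed

text \<open>
  A compact set that avoids the origin meets finitely many annuli, and on each of them the weight is bounded below by a
  positive constant, as \<open>\<alpha>\<close> is bounded.
\<close>

lemma lp_loc_puncturedI: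
  fixes H :: "real^'n \<Rightarrow> complex" and \<alpha> :: "real^'n \<Rightarrow> real"
  assumes H[measurable]: "H \<in> borel_measurable lebesgue" and q: "q \<in> bounded_exponents"
    and \<alpha>: "\<And>x. \<bar>\<alpha> x\<bar> \<le> B" and [measurable]: "\<alpha> \<in> borel_measurable lebesgue"
    and mod: "\<And>k. \<exists>\<eta>>0. modular (\<lambda>x. enn2real (q x))
      (\<lambda>x. 2 powr (of_int k * \<alpha> x) * norm x powr \<gamma> * indicator (dyadic_annulus k) x * norm (H x) / \<eta>) \<le> 1"
  shows "H \<in> lp_loc_punctured q"
  unfolding lp_loc_punctured_def
proof (intro CollectI conjI allI impI H)
  note Q = bounded_exponentsD[OF q]
  have [measurable]: "q \<in> borel_measurable lebesgue" by (rule Q)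
  fix K :: "(real^'n) set" assume K: "compact K \<and> 0 \<notin> K"
  define v where "v k x = 2 powr (of_int k * \<alpha> x) * norm x powr \<gamma> * indicator (dyadic_annulus k) x" for k :: int and x
  have [measurable]: "v k \<in> borel_measurable lebesgue" for k unfolding v_def by measurable
  have "\<forall>k. \<exists>\<eta>. 0 < \<eta> \<and> modular (\<lambda>x. enn2real (q x)) (\<lambda>x. v k x * norm (H x) / \<eta>) \<le> 1"
    using mod unfolding v_def by blast
  from choice[OF this] obtain \<eta> where \<eta>: "\<And>k. 0 < \<eta> k"
      "\<And>k. modular (\<lambda>x. enn2real (q x)) (\<lambda>x. v k x * norm (H x) / \<eta> k) \<le> 1"
    by blast
  define l where "l k = 2 powr (- \<bar>of_int k\<bar> * B) * min (2 powr ((of_int k - 1) * \<gamma>)) (2 powr (of_int k * \<gamma>))" for k :: int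
  have "0 < l k" for k by (simp add: l_def)
  have l: "l k \<le> v k x" if "x \<in> dyadic_annulus k" for k x
  proof -
    have nx: "2 powr (of_int k - 1) < norm x" "norm x \<le> 2 powr of_int k" "x \<noteq> 0"
      using that dyadic_annulus_iff_ceiling[of x k] by (auto simp: dyadic_annulus_iff)
    have "- (of_int k * \<alpha> x) \<le> \<bar>of_int k\<bar> * \<bar>\<alpha> x\<bar>"
      by (metis abs_ge_minus_self abs_mult)
    also have "\<dots> \<le> \<bar>of_int k\<bar> * B"
      by (intro mult_left_mono \<alpha>) simp
    finally have 1: "2 powr (- \<bar>of_int k\<bar> * B) \<le> 2 powr (of_int k * \<alpha> x)"
      by (intro powr_mono) auto
    have 2: "min (2 powr ((of_int k - 1) * \<gamma>)) (2 powr (of_int k * \<gamma>)) \<le> norm x powr \<gamma>"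
    proof (cases "0 \<le> \<gamma>")
      case True
      have "(2 powr (of_int k - 1)) powr \<gamma> \<le> norm x powr \<gamma>"
        using True nx by (intro powr_mono2) auto
      then show ?thesis by (simp add: powr_powr)
    next
      case False
      have "(2 powr of_int k) powr \<gamma> \<le> norm x powr \<gamma>"
        using False nx by (intro powr_mono2') auto
      then show ?thesis by (simp add: powr_powr)
    qed
    have "l k \<le> 2 powr (of_int k * \<alpha> x) * norm x powr \<gamma>"
      unfolding l_def by (intro mult_mono 1 2) auto
    then show ?thesis using that by (simp add: v_def)
  qed
  obtain F where F: "finite F" "\<And>x. x \<in> K \<Longrightarrow> \<exists>k\<in>F. x \<in> dyadic_annulus k"
  proof -
    have "bounded K" using K compact_imp_bounded by blast
    then obtain b where b: "\<And>x. x \<in> K \<Longrightarrow> norm x \<le> b"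
      unfolding bounded_iff by blast
    have "open (- K)" using K compact_imp_closed by blast
    then obtain e where e: "0 < e" "ball 0 e \<subseteq> - K"
      using K openE[of "- K" 0] by blast
    have e': "e \<le> norm x" if "x \<in> K" for x
    proof (rule ccontr)
      assume "\<not> e \<le> norm x"
      then have "x \<in> ball 0 e" by simp
      with e(2) that show False by blast
    qed
    show ?thesis
    proof (rule that[of "{\<lceil>log 2 e\<rceil>..\<lceil>log 2 b\<rceil>}"])
      fix x assume x: "x \<in> K"
      then have "0 < norm x" using less_le_trans[OF e(1) e'] by blast
      have "log 2 e \<le> log 2 (norm x)" "log 2 (norm x) \<le> log 2 b"
        using e'[OF x] b[OF x] e(1) \<open>0 < norm x\<close> by (auto intro!: log_mono)
      then have "\<lceil>log 2 (norm x)\<rceil> \<in> {\<lceil>log 2 e\<rceil>..\<lceil>log 2 b\<rceil>}"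
        by (auto intro: ceiling_mono)
      then show "\<exists>k\<in>{\<lceil>log 2 e\<rceil>..\<lceil>log 2 b\<rceil>}. x \<in> dyadic_annulus k"
        using \<open>0 < norm x\<close> by (auto simp: dyadic_annulus_iff_ceiling)
    qed simp
  qed
  define M where "M = 1 + (\<Sum>k\<in>F. \<eta> k / l k)"
  have pos: "0 \<le> \<eta> k / l k" for k using \<eta>(1)[of k] \<open>0 < l k\<close> by simp
  then have "0 < M" unfolding M_def by (intro add_pos_nonneg sum_nonneg) auto
  have "modular (\<lambda>x. enn2real (q x)) (\<lambda>x. norm (H x * indicator K x) / M)
    \<le> (\<integral>\<^sup>+x. (\<Sum>k\<in>F. ennreal ((v k x * norm (H x) / \<eta> k) powr enn2real (q x))) \<partial>lebesgue)"
    unfolding modular_def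
  proof (rule nn_integral_mono)
    fix x
    show "ennreal ((norm (H x * indicator K x) / M) powr enn2real (q x))
      \<le> (\<Sum>k\<in>F. ennreal ((v k x * norm (H x) / \<eta> k) powr enn2real (q x)))"
    proof (cases "x \<in> K")
      case True
      then obtain k where k: "k \<in> F" "x \<in> dyadic_annulus k" using F by blast
      have "\<eta> k / l k \<le> M"
        unfolding M_def using member_le_sum[OF k(1), of "\<lambda>k. \<eta> k / l k"] pos F(1) by simp
      then have "\<eta> k \<le> M * l k"
        using \<open>0 < l k\<close> by (simp add: pos_divide_le_eq)
      also have "\<dots> \<le> M * v k x"
        using l[OF k(2)] \<open>0 < M\<close> by (intro mult_left_mono) auto
      finally have "\<eta> k \<le> M * v k x" .
      then have "\<eta> k * norm (H x) \<le> M * v k x * norm (H x)"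
        by (rule mult_right_mono) simp
      then have "norm (H x * indicator K x) / M \<le> v k x * norm (H x) / \<eta> k"
        using True \<eta>(1)[of k] \<open>0 < M\<close> by (simp add: field_simps)
      then have "ennreal ((norm (H x * indicator K x) / M) powr enn2real (q x))
          \<le> ennreal ((v k x * norm (H x) / \<eta> k) powr enn2real (q x))"
        using \<open>0 < M\<close> by (intro ennreal_leI powr_mono2) auto
      also have "\<dots> \<le> (\<Sum>k\<in>F. ennreal ((v k x * norm (H x) / \<eta> k) powr enn2real (q x)))"
        using k(1) F(1) by (intro member_le_sum) auto
      finally show ?thesis .
    qed simp
  qed
  also have "\<dots> = (\<Sum>k\<in>F. modular (\<lambda>x. enn2real (q x)) (\<lambda>x. v k x * norm (H x) / \<eta> k))"
    unfolding modular_def by (rule nn_integral_sum) measurable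
  also have "\<dots> \<le> (\<Sum>k\<in>F. 1)"
    by (intro sum_mono \<eta>)
  also have "\<dots> < top" by (simp add: of_nat_less_top)
  finally have "lp_modular q (\<lambda>x. H x * indicator K x / complex_of_real M) < top"
    using \<open>0 < M\<close> by (simp add: lp_modular_finite_exponent[OF Q(2)] norm_divide)
  moreover have "K \<in> sets lebesgue"
    using K by (simp add: borel_compact)
  then have "(\<lambda>x. H x * indicator K x) \<in> borel_measurable lebesgue"
    by (intro borel_measurable_times H borel_measurable_indicator)
  ultimately show "(\<lambda>x. H x * indicator K x) \<in> lp_space q"
    unfolding lp_space_def using \<open>0 < M\<close> by auto
qed

section \<open>Boundedness of the Hausdorff operator\<close>

theorem theorem3p3:
  fixes m :: nat
    and \<Phi> :: "real^'n \<Rightarrow> real"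
    and A :: "nat \<Rightarrow> real^'n \<Rightarrow> real^'n^'n"
    and \<gamma> lam p :: "nat \<Rightarrow> real"
    and q :: "nat \<Rightarrow> real^'n \<Rightarrow> ennreal"
    and q0 :: "real^'n \<Rightarrow> ennreal"
    and \<alpha> :: "nat \<Rightarrow> real^'n \<Rightarrow> real"
    and \<zeta> p0 :: real
  assumes "m \<ge> 1"
    and "\<Phi> \<in> borel_measurable lebesgue" and "\<And>t. 0 \<le> \<Phi> t"
    and "\<And>i. i \<in> {1..m} \<Longrightarrow> A i \<in> borel_measurable lebesgue"
    and "AE t in lebesgue. t \<in> support_on UNIV \<Phi> \<longrightarrow> (\<forall>i\<in>{1..m}. invertible (A i t))"
    and "\<And>i. i \<in> {1..m} \<Longrightarrow> q i \<in> bounded_exponents" and "q0 \<in> bounded_exponents"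
    and "\<And>x. (\<Sum>i\<in>{1..m}. 1 / q i x) = 1 / q0 x"
    and "\<And>i. i \<in> {1..m} \<Longrightarrow> 0 < lam i" and "0 < \<zeta>"
    and "0 < p0" and "\<And>i. i \<in> {1..m} \<Longrightarrow> 0 < p i"
    and "\<And>i. i \<in> {1..m} \<Longrightarrow> \<alpha> i \<in> L_infinity \<inter> C_log_zero \<inter> C_log_infinity"
    and "AE t in lebesgue. t \<in> support_on UNIV \<Phi> \<longrightarrow> (\<forall>i\<in>{1..m}.
           (\<forall>x. q i (matrix_inv (A i t) *v x) \<le> ennreal \<zeta> * q i x) \<and>
           lp_norm (r_exponent (q i) \<zeta> (matrix_inv (A i t))) (\<lambda>_. 1) < top)"
    and "\<And>i. i \<in> {1..m} \<Longrightarrow> \<alpha> i 0 - value_infinity (\<alpha> i) \<ge> 0"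
    and "C3 m \<Phi> A q \<gamma> \<zeta> lam \<alpha> < top"
  shows "\<exists>C\<ge>0. \<forall>f :: nat \<Rightarrow> real^'n \<Rightarrow> complex.
    (\<forall>i\<in>{1..m}. f i \<in> morrey_herz (\<alpha> i) (lam i) (p i) (\<lambda>x. ennreal \<zeta> * q i x) (\<lambda>x. norm x powr \<gamma> i))
    \<longrightarrow> (AE x in lebesgue. integrable lebesgue (hausdorff_integrand m \<Phi> A f x)) \<and>
        hausdorff m \<Phi> A f \<in> morrey_herz (\<lambda>x. \<Sum>i\<in>{1..m}. \<alpha> i x) (\<Sum>i\<in>{1..m}. lam i) p0 q0
                              (\<lambda>x. norm x powr (\<Sum>i\<in>{1..m}. \<gamma> i)) \<and>
        morrey_herz_norm (\<lambda>x. \<Sum>i\<in>{1..m}. \<alpha> i x) (\<Sum>i\<in>{1..m}. lam i) p0 q0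
            (\<lambda>x. norm x powr (\<Sum>i\<in>{1..m}. \<gamma> i)) (hausdorff m \<Phi> A f)
          \<le> ennreal C * (\<Prod>i\<in>{1..m}.
              morrey_herz_norm (\<alpha> i) (lam i) (p i) (\<lambda>x. ennreal \<zeta> * q i x) (\<lambda>x. norm x powr \<gamma> i) (f i))"
proof -
  let ?I = "{1..m}"
  let ?b = "\<lambda>i. value_infinity (\<alpha> i)"
  let ?lam = "\<Sum>i\<in>?I. lam i"
  let ?\<alpha> = "\<lambda>x. \<Sum>i\<in>?I. \<alpha> i x"
  let ?\<gamma> = "\<Sum>i\<in>?I. \<gamma> i"
  have I: "finite ?I" "?I \<noteq> {}" using \<open>m \<ge> 1\<close> by auto
  note q = assms(6,7)
  have \<alpha>_meas: "\<alpha> i \<in> borel_measurable lebesgue" if "i \<in> ?I" for i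
    using assms(13)[OF that] by (auto simp: L_infinity_def)
  have "\<forall>i\<in>?I. \<exists>c>0. \<forall>k j x z. x \<in> dyadic_annulus k \<longrightarrow> z \<in> dyadic_annulus j \<longrightarrow>
      2 powr (of_int k * \<alpha> i x) \<le> c * max (2 powr (of_int (k - j) * \<alpha> i 0)) (2 powr (of_int (k - j) * ?b i)) * 2 powr (of_int j * \<alpha> i z)"
  proof
    fix i assume i: "i \<in> ?I"
    have "\<alpha> i \<in> C_log_zero" "\<alpha> i \<in> C_log_infinity" "?b i \<le> \<alpha> i 0"
      using assms(13)[OF i] assms(15)[OF i] by auto
    from annulus_weight_transfer[OF this] obtain c where "0 < c"
      "\<And>k j x z. x \<in> dyadic_annulus k \<Longrightarrow> z \<in> dyadic_annulus j \<Longrightarrow>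
        2 powr (of_int k * \<alpha> i x) \<le> c * max (2 powr (of_int (k - j) * \<alpha> i 0)) (2 powr (of_int (k - j) * ?b i)) * 2 powr (of_int j * \<alpha> i z)"
      by blast
    then show "\<exists>c>0. \<forall>k j x z. x \<in> dyadic_annulus k \<longrightarrow> z \<in> dyadic_annulus j \<longrightarrow>
      2 powr (of_int k * \<alpha> i x) \<le> c * max (2 powr (of_int (k - j) * \<alpha> i 0)) (2 powr (of_int (k - j) * ?b i)) * 2 powr (of_int j * \<alpha> i z)"
      by blast
  qed
  from bchoice[OF this] obtain c where c: "\<And>i. i \<in> ?I \<Longrightarrow> 0 < c i"
    "\<And>i k j x z. i \<in> ?I \<Longrightarrow> x \<in> dyadic_annulus k \<Longrightarrow> z \<in> dyadic_annulus j \<Longrightarrow>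
      2 powr (of_int k * \<alpha> i x) \<le> c i * max (2 powr (of_int (k - j) * \<alpha> i 0)) (2 powr (of_int (k - j) * ?b i)) * 2 powr (of_int j * \<alpha> i z)"
    by blast
  have \<alpha>_bounded: "\<exists>B. \<forall>x. \<bar>?\<alpha> x\<bar> \<le> B"
  proof -
    have "\<forall>i\<in>?I. \<exists>B. \<forall>x. \<bar>\<alpha> i x\<bar> \<le> B"
    proof
      fix i assume "i \<in> ?I"
      from assms(13)[OF this] have "\<alpha> i \<in> C_log_zero" by blast
      then show "\<exists>B. \<forall>x. \<bar>\<alpha> i x\<bar> \<le> B" by (rule C_log_zero_bounded) blast
    qed
    from bchoice[OF this] obtain B where B: "\<And>i x. i \<in> ?I \<Longrightarrow> \<bar>\<alpha> i x\<bar> \<le> B i" by blast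
    have "\<bar>?\<alpha> x\<bar> \<le> (\<Sum>i\<in>?I. B i)" for x
      by (rule order_trans[OF sum_abs sum_mono]) (rule B)
    then show ?thesis by blast
  qed
  define D where "D t = ennreal (\<Phi> t / norm t ^ CARD('n)) *
        (\<Prod>i\<in>?I.
           ennreal (c_factor (A i t) (q i) (\<gamma> i)) *
           lp_norm (r_exponent (q i) \<zeta> (matrix_inv (A i t))) (\<lambda>_. 1) *
           ennreal (max (norm (A i t) powr (lam i - \<alpha> i 0)) (norm (A i t) powr (lam i - ?b i))) *
           ennreal (max (\<Sum>r\<in>{Theta m A t - 1..0}. 2 powr (of_int r * (lam i - \<alpha> i 0)))
                        (\<Sum>r\<in>{Theta m A t - 1..0}. 2 powr (of_int r * (lam i - ?b i)))))" for t
  define c3 where "c3 = enn2real (C3 m \<Phi> A q \<gamma> \<zeta> lam \<alpha>)"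
  have c3: "(\<integral>\<^sup>+t. D t \<partial>lebesgue) = ennreal c3" "0 \<le> c3"
    using assms(16) by (simp_all add: c3_def C3_def D_def)
  define K where "K = real (2 * card ?I) * (\<Prod>i\<in>?I. c i * (2 * 2 powr (\<bar>lam i - \<alpha> i 0\<bar> + \<bar>lam i - ?b i\<bar>)))"
  have "0 \<le> K"
    unfolding K_def using c(1) by (intro mult_nonneg_nonneg prod_nonneg ballI) (auto simp: less_imp_le)
  have "0 < ?lam" using I assms(9) by (intro sum_pos) auto
  define C where "C = (1 / (1 - 2 powr (- (?lam * p0)))) powr (1 / p0) * (K * c3)"
  have "0 \<le> C" using \<open>0 \<le> K\<close> c3(2) by (simp add: C_def)
  show ?thesis
  proof (intro exI[of _ C] conjI allI impI)
    fix f :: "nat \<Rightarrow> real^'n \<Rightarrow> complex"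
    assume f: "\<forall>i\<in>?I. f i \<in> morrey_herz (\<alpha> i) (lam i) (p i) (\<lambda>x. ennreal \<zeta> * q i x) (\<lambda>x. norm x powr \<gamma> i)"
    define P where "P i = enn2real (morrey_herz_norm (\<alpha> i) (lam i) (p i) (\<lambda>x. ennreal \<zeta> * q i x) (\<lambda>x. norm x powr \<gamma> i) (f i))" for i
    have P: "morrey_herz_norm (\<alpha> i) (lam i) (p i) (\<lambda>x. ennreal \<zeta> * q i x) (\<lambda>x. norm x powr \<gamma> i) (f i) = ennreal (P i)"
      "0 \<le> P i" if "i \<in> ?I" for i
      using f that by (auto simp: P_def morrey_herz_def)
    have f_meas: "f i \<in> borel_measurable lebesgue" if "i \<in> ?I" for i
      using f that by (auto simp: morrey_herz_def lp_loc_punctured_def)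
    have f_annulus: "lp_norm_weighted (\<lambda>x. ennreal \<zeta> * q i x) (\<lambda>x. norm x powr \<gamma> i)
        (\<lambda>x. complex_of_real (2 powr (of_int j * \<alpha> i x)) * f i x * indicator (dyadic_annulus j) x)
        \<le> ennreal (2 powr (of_int j * lam i) * P i)" if "i \<in> ?I" for i j
      using morrey_herz_norm_annulus[OF assms(12)[OF that], of "\<lambda>x. ennreal \<zeta> * q i x" "\<lambda>x. norm x powr \<gamma> i" j "\<alpha> i" "f i" "lam i"]
      unfolding P(1)[OF that] by (simp add: ennreal_mult')
    define F where "F = hausdorff_integrand m \<Phi> A f"
    have H: "hausdorff m \<Phi> A f = (\<lambda>x. \<integral>t. F x t \<partial>lebesgue)"
      by (simp add: hausdorff_def F_def fun_eq_iff)
    have inv: "AE t in lebesgue. \<Phi> t \<noteq> 0 \<longrightarrow> (\<forall>i\<in>?I. invertible (A i t))"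
      using assms(5) by (simp add: support_on_def)
    obtain G where "(\<lambda>(x, t). G x t) \<in> borel_measurable (lebesgue \<Otimes>\<^sub>M lebesgue)"
      "AE t in lebesgue. AE x in lebesgue. hausdorff_integrand m \<Phi> A f x t = G x t"
      "AE x in lebesgue. AE t in lebesgue. hausdorff_integrand m \<Phi> A f x t = G x t"
      by (rule measurable_version_of_integrand[OF assms(2,4) inv f_meas])
    note G = this[folded F_def]
    define v where "v k x = 2 powr (of_int k * ?\<alpha> x) * norm x powr ?\<gamma> * indicator (dyadic_annulus k) x" for k :: int and x :: "real^'n"
    have v0: "0 \<le> v k x" for k x by (simp add: v_def)
    have \<alpha>_sum_meas[measurable]: "?\<alpha> \<in> borel_measurable lebesgue"
      by (rule borel_measurable_sum) (rule \<alpha>_meas)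
    have v_meas: "v k \<in> borel_measurable lebesgue" for k
      unfolding v_def by measurable
    \<comment> \<open>The weight is a product over \<open>i\<close>, because \<open>\<alpha>\<close> and \<open>\<gamma>\<close> are sums and an indicator is its own power.\<close>
    have vF: "v k x * norm (F x t) = \<Phi> t / norm t ^ CARD('n) * (\<Prod>i\<in>?I.
        2 powr (of_int k * \<alpha> i x) * norm x powr \<gamma> i * indicator (dyadic_annulus k) x * norm (f i (A i t *v x)))" for k x t
    proof (cases "x \<in> dyadic_annulus k")
      case True
      then have "norm x \<noteq> 0" by (auto simp: dyadic_annulus_iff_ceiling)
      then have "v k x = (\<Prod>i\<in>?I. 2 powr (of_int k * \<alpha> i x)) * (\<Prod>i\<in>?I. norm x powr \<gamma> i)"
        using True I by (simp add: v_def sum_distrib_left powr_sum)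
      moreover have "norm (F x t) = \<Phi> t / norm t ^ CARD('n) * (\<Prod>i\<in>?I. norm (f i (A i t *v x)))"
        using assms(3)[of t] by (simp add: F_def hausdorff_integrand_def norm_mult prod_norm norm_divide norm_power)
      ultimately show ?thesis
        using True by (simp add: prod.distrib)
    next
      case False
      then have "(\<Prod>i\<in>?I. 2 powr (of_int k * \<alpha> i x) * norm x powr \<gamma> i * indicator (dyadic_annulus k) x * norm (f i (A i t *v x))) = 0"
        using I by (intro prod_zero) auto
      then show ?thesis using False by (simp add: v_def)
    qed
    define E where "E k = K * 2 powr (of_int k * ?lam) * (\<Prod>i\<in>?I. P i)" for k :: int
    have E0: "0 \<le> E k" for k
      unfolding E_def using \<open>0 \<le> K\<close> P(2) by (intro mult_nonneg_nonneg prod_nonneg) auto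
    have slice: "AE t in lebesgue. lp_norm q0 (\<lambda>x. complex_of_real (v k x * norm (F x t))) \<le> ennreal (E k) * D t" for k
      using inv assms(14)
    proof eventually_elim
      case (elim t)
      show ?case
      proof (cases "\<Phi> t = 0")
        case True
        then show ?thesis
          using lp_norm_zero[of q0] bounded_exponentsD(2)[OF q(2)] by (simp add: vF)
      next
        case False
        then have t: "\<And>i. i \<in> ?I \<Longrightarrow> invertible (A i t)"
          "\<And>i x. i \<in> ?I \<Longrightarrow> q i (matrix_inv (A i t) *v x) \<le> ennreal \<zeta> * q i x"
          "\<And>i. i \<in> ?I \<Longrightarrow> lp_norm (r_exponent (q i) \<zeta> (matrix_inv (A i t))) (\<lambda>_. 1) < top"
          using elim by (auto simp: support_on_def)
        have \<theta>: "norm (A i t) * norm (matrix_inv (A i t)) \<le> 2 powr (- of_int (Theta m A t))" if "i \<in> ?I" for i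
          using Theta_greatest[of m A t, OF t(1) that] by simp
        have \<phi>: "0 \<le> \<Phi> t / norm t ^ CARD('n)" using assms(3)[of t] by simp
        show ?thesis
          unfolding vF D_def E_def K_def
          by (rule slice_norm_le[where A="\<lambda>i. A i t" and c=c and \<theta>="Theta m A t", OF I t(1) q assms(8,10) t(2,3) f_meas \<alpha>_meas P(2) f_annulus c \<theta> \<phi>])
      qed
    qed
    have integrated: "(\<integral>\<^sup>+t. lp_norm q0 (\<lambda>x. complex_of_real (v k x * norm (F x t))) \<partial>lebesgue) \<le> ennreal (E k * c3)" for k
    proof -
      have "(\<integral>\<^sup>+t. lp_norm q0 (\<lambda>x. complex_of_real (v k x * norm (F x t))) \<partial>lebesgue) \<le> (\<integral>\<^sup>+t. ennreal (E k) * D t \<partial>lebesgue)"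
        by (rule nn_integral_mono_AE[OF slice])
      also have "\<dots> \<le> ennreal (E k) * (\<integral>\<^sup>+t. D t \<partial>lebesgue)"
        by (rule nn_integral_cmult_le)
      finally show ?thesis unfolding c3(1) using E0[of k] by (simp add: ennreal_mult')
    qed
    have Ec: "0 \<le> E k * c3" for k using E0[of k] c3(2) by simp
    have bound: "(AE x in lebesgue. 0 < v k x \<longrightarrow> integrable lebesgue (F x)) \<and>
        modular (\<lambda>x. enn2real (q0 x)) (\<lambda>x. v k x * norm (\<integral>t. F x t \<partial>lebesgue) / \<eta>) \<le> 1" if "E k * c3 < \<eta>" for k \<eta>
    proof -
      have "(\<integral>\<^sup>+t. lp_norm q0 (\<lambda>x. complex_of_real (v k x * norm (F x t))) \<partial>lebesgue) < ennreal \<eta>"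
        using integrated ennreal_lessI[of \<eta> "E k * c3"] that Ec[of k] by (auto intro: le_less_trans)
      from weighted_integral_bound[OF G q(2) v0 v_meas this] show ?thesis by blast
    qed
    \<comment> \<open>Every point except the origin lies in an annulus, where the weight is positive.\<close>
    have integrable: "AE x in lebesgue. integrable lebesgue (F x)"
    proof -
      have "AE x in lebesgue. \<forall>k. 0 < v k x \<longrightarrow> integrable lebesgue (F x)"
        unfolding AE_all_countable using bound[OF less_add_one] by blast
      moreover have "AE x::real^'n in lebesgue. x \<noteq> 0"
        by (intro AE_completion AE_lborel_singleton)
      ultimately show ?thesis
      proof eventually_elim
        case (elim x)
        have "x \<in> dyadic_annulus \<lceil>log 2 (norm x)\<rceil>"
          using elim(2) by (simp add: dyadic_annulus_iff_ceiling)
        then have "0 < v \<lceil>log 2 (norm x)\<rceil> x"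
          using elim(2) by (simp add: v_def)
        with elim(1) show ?case by blast
      qed
    qed
    then show "AE x in lebesgue. integrable lebesgue (hausdorff_integrand m \<Phi> A f x)"
      by (simp add: F_def)
    have H_meas: "hausdorff m \<Phi> A f \<in> borel_measurable lebesgue"
    proof (rule borel_measurable_AE)
      show "(\<lambda>x. \<integral>t. G x t \<partial>lebesgue) \<in> borel_measurable lebesgue"
        by (rule sigma_finite_measure.borel_measurable_lebesgue_integral[OF sigma_finite_lebesgue G(1)])
      show "AE x in lebesgue. (\<integral>t. G x t \<partial>lebesgue) = hausdorff m \<Phi> A f x"
        using G(3) integrable
      proof eventually_elim
        case (elim x)
        have "G x \<in> borel_measurable lebesgue"
          using measurable_Pair2[OF G(1), of x] by simp
        then show ?case
          unfolding H using elim by (intro integral_cong_AE) auto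
      qed
    qed
    have annulus: "lp_norm_weighted q0 (\<lambda>x. norm x powr ?\<gamma>)
        (\<lambda>x. complex_of_real (2 powr (of_int k * ?\<alpha> x)) * hausdorff m \<Phi> A f x * indicator (dyadic_annulus k) x)
        \<le> ennreal (2 powr (of_int k * ?lam) * (K * c3 * (\<Prod>i\<in>?I. P i)))" for k
    proof -
      let ?h = "\<lambda>x. complex_of_real (2 powr (of_int k * ?\<alpha> x)) * hausdorff m \<Phi> A f x * indicator (dyadic_annulus k) x * complex_of_real (norm x powr ?\<gamma>)"
      have h: "norm (?h x) = v k x * norm (\<integral>t. F x t \<partial>lebesgue)" for x
        by (simp add: norm_mult norm_indicator_complex v_def H)
      have [measurable]: "hausdorff m \<Phi> A f \<in> borel_measurable lebesgue" by (rule H_meas)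
      have h_meas: "?h \<in> borel_measurable lebesgue"
        by measurable
      have "lp_norm q0 ?h \<le> ennreal \<eta>" if "E k * c3 < \<eta>" for \<eta>
      proof -
        note Q0 = bounded_exponentsD[OF q(2)]
        have "lp_norm q0 ?h \<le> ennreal (1 * \<eta>)"
        proof (rule lp_norm_le_of_modular[OF Q0(2,3,1) h_meas])
          show "0 < \<eta>" using that Ec[of k] by simp
          show "modular (\<lambda>x. enn2real (q0 x)) (\<lambda>x. norm (?h x) / \<eta>) \<le> ennreal 1"
            unfolding h using bound[OF that] by simp
        qed simp
        then show ?thesis by simp
      qed
      then have "lp_norm q0 ?h \<le> ennreal (E k * c3) + ennreal \<epsilon>" if "0 < \<epsilon>" for \<epsilon>
        using that Ec[of k] by (simp flip: ennreal_plus)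
      then have "lp_norm q0 ?h \<le> ennreal (E k * c3)"
        by (rule ennreal_le_epsilon)
      then show ?thesis
        by (simp add: lp_norm_weighted_def E_def ac_simps)
    qed
    have PK: "0 \<le> K * c3 * (\<Prod>i\<in>?I. P i)"
      using \<open>0 \<le> K\<close> c3(2) P(2) by (intro mult_nonneg_nonneg prod_nonneg) auto
    have "morrey_herz_norm ?\<alpha> ?lam p0 q0 (\<lambda>x. norm x powr ?\<gamma>) (hausdorff m \<Phi> A f)
        \<le> ennreal ((1 / (1 - 2 powr (- (?lam * p0)))) powr (1 / p0) * (K * c3 * (\<Prod>i\<in>?I. P i)))"
      by (rule morrey_herz_norm_le[OF assms(11) \<open>0 < ?lam\<close> PK annulus])
    also have "\<dots> = ennreal (C * (\<Prod>i\<in>?I. P i))"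
      by (simp add: C_def ac_simps)
    also have "\<dots> = ennreal C * (\<Prod>i\<in>?I. ennreal (P i))"
      by (subst prod_ennreal) (simp_all add: P(2) ennreal_mult' \<open>0 \<le> C\<close>)
    also have "(\<Prod>i\<in>?I. ennreal (P i)) = (\<Prod>i\<in>?I.
        morrey_herz_norm (\<alpha> i) (lam i) (p i) (\<lambda>x. ennreal \<zeta> * q i x) (\<lambda>x. norm x powr \<gamma> i) (f i))"
      by (rule prod.cong) (simp_all add: P(1))
    finally show norm_le: "morrey_herz_norm ?\<alpha> ?lam p0 q0 (\<lambda>x. norm x powr ?\<gamma>) (hausdorff m \<Phi> A f)
        \<le> ennreal C * (\<Prod>i\<in>?I. morrey_herz_norm (\<alpha> i) (lam i) (p i) (\<lambda>x. ennreal \<zeta> * q i x) (\<lambda>x. norm x powr \<gamma> i) (f i))" .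
    have "(\<Prod>i\<in>?I. morrey_herz_norm (\<alpha> i) (lam i) (p i) (\<lambda>x. ennreal \<zeta> * q i x) (\<lambda>x. norm x powr \<gamma> i) (f i))
        = (\<Prod>i\<in>?I. ennreal (P i))"
      by (rule prod.cong) (simp_all add: P(1))
    also have "\<dots> = ennreal (\<Prod>i\<in>?I. P i)"
      by (rule prod_ennreal) (rule P(2))
    finally have "morrey_herz_norm ?\<alpha> ?lam p0 q0 (\<lambda>x. norm x powr ?\<gamma>) (hausdorff m \<Phi> A f) < top"
      using norm_le by (auto intro: le_less_trans simp: ennreal_mult_less_top)
    moreover have "hausdorff m \<Phi> A f \<in> lp_loc_punctured q0"
    proof -
      obtain B where "\<And>x. \<bar>?\<alpha> x\<bar> \<le> B" using \<alpha>_bounded by blast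
      then show ?thesis
      proof (rule lp_loc_puncturedI[OF H_meas q(2) _ \<alpha>_sum_meas])
        fix k
        have "0 < E k * c3 + 1" using Ec[of k] by simp
        with bound[of k "E k * c3 + 1"]
        show "\<exists>\<eta>>0. modular (\<lambda>x. enn2real (q0 x)) (\<lambda>x. 2 powr (of_int k * ?\<alpha> x) * norm x powr ?\<gamma> *
            indicator (dyadic_annulus k) x * norm (hausdorff m \<Phi> A f x) / \<eta>) \<le> 1"
          unfolding H v_def by auto
      qed
    qed
    ultimately show "hausdorff m \<Phi> A f \<in> morrey_herz ?\<alpha> ?lam p0 q0 (\<lambda>x. norm x powr ?\<gamma>)"
      by (simp add: morrey_herz_def)
  qed (rule \<open>0 \<le> C\<close>)
qed

end
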